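(* Let $\gamma$ be a generic track whose attraction diagram has exactly two essential critical cycles (not necessarily simple). Then every configuration on $\gamma$ is dexter or sinister; consequently, the human can catch the puppy on $\gamma$ from any starting configuration.
   Context: A track is a regular $C^3$ closed curve $\gamma\colon S^1\to\mathbb{R}^2$. A configuration is $(x,y)\in S^1\times S^1$: a human at $\gamma(x)$ and a puppy at $\gamma(y)$; $D(x,y)=\|\gamma(x)-\gamma(y)\|$. Rules: the human walks along the track at bounded speed and may change direction. If $D(x,y+\varepsilon)<D(x,y)$ for all small $\varepsilon>0$ the puppy runs forward (increasing $y$), if $D(x,y-\varepsilon)<D(x,y)$ for all small $\varepsilon>0$ it runs backward, arbitrarily if both; while it runs (with unbounded speed) the human is stationary. If neither holds the configuration is stable: the puppy stays put until the human moves, and then moves so as to keep the configuration stable until forced to run again. The human catches the puppy when $x=y$. A configuration is forward if $\partial_yD<0$, backward if $\partial_yD>0$, critical if $\partial_yD=0$ (the main diagonal $x=y$ being critical); critical configurations are stable ($\partial_y^2D>0$), unstable ($\partial_y^2D<0$), forward pivot ($\partial_y^2D=0$, $\partial_y^3D<0$) or backward pivot ($\partial_y^2D=0$, $\partial_y^3D>0$). Genericity means: finitely many critical configurations for each fixed $x$ and each fixed $y$; every critical configuration is of one of these types; finitely many pivot configurations; $\gamma$ meets its evolute transversely away from its cusps; and the critical set is a union of finitely many pairwise disjoint simple closed curves in the torus (critical cycles). The attraction diagram is the decomposition of the torus by the critical set; a critical cycle is essential if it does not bound a simply connected subset of the torus. A strategy (for catching the puppy) is a path in the torus, realizable under the rules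 above, ending on the main diagonal, consisting of pieces of stable critical paths (traversed as the human walks) and vertical segments called pivots (the puppy running with the human fixed), where every pivot except possibly the first starts at a pivot configuration and every pivot ends at a stable configuration. A strategy is dexter if it ends with a backward pivot (a vertical segment with $y$ decreasing, reaching the main diagonal) and sinister if it ends with a forward pivot (a vertical segment with $y$ increasing, reaching the main diagonal). A configuration is dexter (resp. sinister) if some dexter (resp. sinister) strategy starts at it.
   Formalization: "Every configuration is dexter or sinister" is proved for configurations off the main diagonal; on the diagonal the puppy is already caught, cannot run, and no strategy there ends with a pivot, so the claim fails there. *)

theory Defs
  imports "HOL-Analysis.Analysis"
begin

text \<open>The plane R^2 is modelled by the complex numbers; S^1 = R/Z, so a closed curve is a
  1-periodic map real => complex.  Configurations (x,y) in S^1 x S^1 are represented by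
  pairs of reals (lifts), all notions below being invariant under Z^2-translations.\<close>

definition C3_curve :: "(real \<Rightarrow> complex) \<Rightarrow> bool" where
  "C3_curve \<gamma> \<longleftrightarrow> (\<exists>g1 g2 g3.
      (\<forall>t. (\<gamma> has_vector_derivative g1 t) (at t)) \<and>
      (\<forall>t. (g1 has_vector_derivative g2 t) (at t)) \<and>
      (\<forall>t. (g2 has_vector_derivative g3 t) (at t)) \<and>
      continuous_on UNIV g3)"

definition track :: "(real \<Rightarrow> complex) \<Rightarrow> bool" where
  "track \<gamma> \<longleftrightarrow> C3_curve \<gamma> \<and> (\<forall>t. \<gamma> (t + 1) = \<gamma> t) \<and>
      (\<forall>t. vector_derivative \<gamma> (at t) \<noteq> 0)"

definition vderiv :: "nat \<Rightarrow> (real \<Rightarrow> complex) \<Rightarrow> real \<Rightarrow> complex" where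
  "vderiv k \<gamma> = ((\<lambda>f t. vector_derivative f (at t)) ^^ k) \<gamma>"

definition D :: "(real \<Rightarrow> complex) \<Rightarrow> real \<Rightarrow> real \<Rightarrow> real" where
  "D \<gamma> x y = cmod (\<gamma> x - \<gamma> y)"

definition dyD2 :: "(real \<Rightarrow> complex) \<Rightarrow> nat \<Rightarrow> real \<Rightarrow> real \<Rightarrow> real" where
  "dyD2 \<gamma> k x y = (deriv ^^ k) (\<lambda>t. (D \<gamma> x t)\<^sup>2) y"

definition critical :: "(real \<Rightarrow> complex) \<Rightarrow> real \<times> real \<Rightarrow> bool" where
  "critical \<gamma> p \<longleftrightarrow> dyD2 \<gamma> 1 (fst p) (snd p) = 0"

definition forward_conf :: "(real \<Rightarrow> complex) \<Rightarrow> real \<times> real \<Rightarrow> bool" where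
  "forward_conf \<gamma> p \<longleftrightarrow> dyD2 \<gamma> 1 (fst p) (snd p) < 0"

definition backward_conf :: "(real \<Rightarrow> complex) \<Rightarrow> real \<times> real \<Rightarrow> bool" where
  "backward_conf \<gamma> p \<longleftrightarrow> dyD2 \<gamma> 1 (fst p) (snd p) > 0"

definition stable_conf :: "(real \<Rightarrow> complex) \<Rightarrow> real \<times> real \<Rightarrow> bool" where
  "stable_conf \<gamma> p \<longleftrightarrow> critical \<gamma> p \<and> dyD2 \<gamma> 2 (fst p) (snd p) > 0"

definition unstable_conf :: "(real \<Rightarrow> complex) \<Rightarrow> real \<times> real \<Rightarrow> bool" where
  "unstable_conf \<gamma> p \<longleftrightarrow> critical \<gamma> p \<and> dyD2 \<gamma> 2 (fst p) (snd p) < 0"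

definition forward_pivot_conf :: "(real \<Rightarrow> complex) \<Rightarrow> real \<times> real \<Rightarrow> bool" where
  "forward_pivot_conf \<gamma> p \<longleftrightarrow> critical \<gamma> p \<and> dyD2 \<gamma> 2 (fst p) (snd p) = 0 \<and>
      dyD2 \<gamma> 3 (fst p) (snd p) < 0"

definition backward_pivot_conf :: "(real \<Rightarrow> complex) \<Rightarrow> real \<times> real \<Rightarrow> bool" where
  "backward_pivot_conf \<gamma> p \<longleftrightarrow> critical \<gamma> p \<and> dyD2 \<gamma> 2 (fst p) (snd p) = 0 \<and>
      dyD2 \<gamma> 3 (fst p) (snd p) > 0"

definition pivot_conf :: "(real \<Rightarrow> complex) \<Rightarrow> real \<times> real \<Rightarrow> bool" where
  "pivot_conf \<gamma> p \<longleftrightarrow> forward_pivot_conf \<gamma> p \<or> backward_pivot_conf \<gamma> p"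

definition on_diagonal :: "real \<times> real \<Rightarrow> bool" where
  "on_diagonal p \<longleftrightarrow> fst p - snd p \<in> \<int>"

definition runs_forward :: "(real \<Rightarrow> complex) \<Rightarrow> real \<Rightarrow> real \<Rightarrow> bool" where
  "runs_forward \<gamma> x y \<longleftrightarrow> (\<exists>\<delta>>0. \<forall>\<epsilon>. 0 < \<epsilon> \<and> \<epsilon> < \<delta> \<longrightarrow> D \<gamma> x (y + \<epsilon>) < D \<gamma> x y)"

definition runs_backward :: "(real \<Rightarrow> complex) \<Rightarrow> real \<Rightarrow> real \<Rightarrow> bool" where
  "runs_backward \<gamma> x y \<longleftrightarrow> (\<exists>\<delta>>0. \<forall>\<epsilon>. 0 < \<epsilon> \<and> \<epsilon> < \<delta> \<longrightarrow> D \<gamma> x (y - \<epsilon>) < D \<gamma> x y)"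

text \<open>A piece of a strategy (in the lift R^2 of the torus): either a walk along a path c
  (parametrised by [0,1]) of stable critical configurations, or a pivot: a vertical segment
  from (x, y0) to (x, y1).\<close>
datatype piece = Walk "real \<Rightarrow> real \<times> real" | Pivot real real real

fun piece_start :: "piece \<Rightarrow> real \<times> real" where
  "piece_start (Walk c) = c 0"
| "piece_start (Pivot x y0 y1) = (x, y0)"

fun piece_finish :: "piece \<Rightarrow> real \<times> real" where
  "piece_finish (Walk c) = c 1"
| "piece_finish (Pivot x y0 y1) = (x, y1)"

fun is_walk :: "piece \<Rightarrow> bool" where
  "is_walk (Walk c) = True"
| "is_walk (Pivot x y0 y1) = False"

text \<open>Realisability of a piece. For a pivot, the flag says whether it is the first pivot of
  the strategy (only that one may start at a configuration other than a pivot
  configuration). While the puppy runs forward (backward), at every intermediate position the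
  rules must make it run forward (backward); it stops at a stable configuration.\<close>
fun valid_piece :: "(real \<Rightarrow> complex) \<Rightarrow> bool \<Rightarrow> piece \<Rightarrow> bool" where
  "valid_piece \<gamma> first (Walk c) \<longleftrightarrow>
      path c \<and> (\<forall>t\<in>{0..<1}. stable_conf \<gamma> (c t))"
| "valid_piece \<gamma> first (Pivot x y0 y1) \<longleftrightarrow>
      y0 \<noteq> y1 \<and> (first \<or> pivot_conf \<gamma> (x, y0)) \<and> stable_conf \<gamma> (x, y1) \<and>
      (if y0 < y1 then (\<forall>t\<in>{y0..<y1}. runs_forward \<gamma> x t)
       else (\<forall>t\<in>{y1<..y0}. runs_backward \<gamma> x t))"

definition strategy :: "(real \<Rightarrow> complex) \<Rightarrow> real \<times> real \<Rightarrow> piece list \<Rightarrow> bool" where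
  "strategy \<gamma> p ps \<longleftrightarrow> ps \<noteq> [] \<and> piece_start (hd ps) = p \<and>
      (\<forall>i. Suc i < length ps \<longrightarrow> piece_finish (ps ! i) = piece_start (ps ! Suc i)) \<and>
      (\<forall>i < length ps. valid_piece \<gamma> (\<forall>j<i. is_walk (ps ! j)) (ps ! i)) \<and>
      on_diagonal (piece_finish (last ps))"

definition dexter_strategy :: "(real \<Rightarrow> complex) \<Rightarrow> real \<times> real \<Rightarrow> piece list \<Rightarrow> bool" where
  "dexter_strategy \<gamma> p ps \<longleftrightarrow> strategy \<gamma> p ps \<and>
      (\<exists>x y0 y1. last ps = Pivot x y0 y1 \<and> y1 < y0)"

definition sinister_strategy :: "(real \<Rightarrow> complex) \<Rightarrow> real \<times> real \<Rightarrow> piece list \<Rightarrow> bool" where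
  "sinister_strategy \<gamma> p ps \<longleftrightarrow> strategy \<gamma> p ps \<and>
      (\<exists>x y0 y1. last ps = Pivot x y0 y1 \<and> y0 < y1)"

definition dexter :: "(real \<Rightarrow> complex) \<Rightarrow> real \<times> real \<Rightarrow> bool" where
  "dexter \<gamma> p \<longleftrightarrow> (\<exists>ps. dexter_strategy \<gamma> p ps)"

definition sinister :: "(real \<Rightarrow> complex) \<Rightarrow> real \<times> real \<Rightarrow> bool" where
  "sinister \<gamma> p \<longleftrightarrow> (\<exists>ps. sinister_strategy \<gamma> p ps)"

definition torus :: "(complex \<times> complex) set" where
  "torus = sphere 0 1 \<times> sphere 0 1"

definition torus_pt :: "real \<times> real \<Rightarrow> complex \<times> complex" where
  "torus_pt p = (cis (2 * pi * fst p), cis (2 * pi * snd p))"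

definition critical_set :: "(real \<Rightarrow> complex) \<Rightarrow> (complex \<times> complex) set" where
  "critical_set \<gamma> = torus_pt ` {p. critical \<gamma> p}"

definition simple_closed_curve_in_torus :: "(complex \<times> complex) set \<Rightarrow> bool" where
  "simple_closed_curve_in_torus C \<longleftrightarrow> C \<subseteq> torus \<and> C homeomorphic (sphere (0::complex) 1)"

text \<open>Critical cycles: the connected components of the critical set (under genericity these
  are exactly the finitely many disjoint simple closed curves making up the critical set).\<close>
definition critical_cycles :: "(real \<Rightarrow> complex) \<Rightarrow> (complex \<times> complex) set set" where
  "critical_cycles \<gamma> = components (critical_set \<gamma>)"

definition essential :: "(complex \<times> complex) set \<Rightarrow> bool" where
  "essential C \<longleftrightarrow> \<not> (\<exists>U. openin (top_of_set torus) U \<and> simply_connected U \<and>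
                           (top_of_set torus) frontier_of U = C)"

definition cross2 :: "complex \<Rightarrow> complex \<Rightarrow> real" where
  "cross2 a b = Im (cnj a * b)"

definition curvature :: "(real \<Rightarrow> complex) \<Rightarrow> real \<Rightarrow> real" where
  "curvature \<gamma> s = cross2 (vderiv 1 \<gamma> s) (vderiv 2 \<gamma> s) / (cmod (vderiv 1 \<gamma> s)) ^ 3"

text \<open>Evolute: the centre of curvature gamma + (1/kappa) N, N = i gamma'/|gamma'|
  (meaningful where the curvature is nonzero).\<close>
definition evolute :: "(real \<Rightarrow> complex) \<Rightarrow> real \<Rightarrow> complex" where
  "evolute \<gamma> s = \<gamma> s + \<i> * vderiv 1 \<gamma> s / (of_real (cmod (vderiv 1 \<gamma> s) * curvature \<gamma> s))"

definition meets_evolute_transversely :: "(real \<Rightarrow> complex) \<Rightarrow> bool" where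
  "meets_evolute_transversely \<gamma> \<longleftrightarrow>
     (\<forall>s t. curvature \<gamma> s \<noteq> 0 \<and> vector_derivative (evolute \<gamma>) (at s) \<noteq> 0 \<and>
            \<gamma> t = evolute \<gamma> s \<longrightarrow>
            cross2 (vderiv 1 \<gamma> t) (vector_derivative (evolute \<gamma>) (at s)) \<noteq> 0)"

definition generic :: "(real \<Rightarrow> complex) \<Rightarrow> bool" where
  "generic \<gamma> \<longleftrightarrow>
     (\<forall>x. finite {y\<in>{0..<1}. critical \<gamma> (x, y)}) \<and>
     (\<forall>y. finite {x\<in>{0..<1}. critical \<gamma> (x, y)}) \<and>
     (\<forall>p. critical \<gamma> p \<longrightarrow> stable_conf \<gamma> p \<or> unstable_conf \<gamma> p \<or>
                           forward_pivot_conf \<gamma> p \<or> backward_pivot_conf \<gamma> p) \<and>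
     finite {p\<in>{0..<1}\<times>{0..<1}. pivot_conf \<gamma> p} \<and>
     meets_evolute_transversely \<gamma> \<and>
     (\<exists>\<C>. finite \<C> \<and> (\<forall>C\<in>\<C>. simple_closed_curve_in_torus C) \<and>
          pairwise disjnt \<C> \<and> \<Union>\<C> = critical_set \<gamma>)"

end

theory Submission
  imports Defs "HOL-Complex_Analysis.Contour_Integration"
begin

text \<open>Write F for the derivative of the squared distance in the puppy's coordinate y, and lift to the
  strip \<open>x < y < x + 1\<close>, where F is positive near the lower and negative near the upper
  diagonal. Suppose some stable configurations are trapped, that is, no sequence of walks and
  pivots leads from them to the diagonal. Walking along a trapped stable branch ends at a pivot
  whose run lands on another trapped branch, so there are trapped configurations over every x.
  Their lower envelope, completed by the upward runs, lies in \<open>F \<le> 0\<close> and crosses the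
  whole strip; symmetrically, \<open>F > 0\<close> holds immediately above their upper envelope. Hence
  the positive region at the lower diagonal, the positive region above the upper envelope
  and the negative region at the upper diagonal are pairwise separated by critical cycles, all
  of them essential. If only one essential cycle besides the diagonal existed, a single Jordan
  curve in the annulus would separate three regions pairwise.\<close>

subsection \<open>Separation by Jordan curves in the plane\<close>

text \<open>The obstacle is that neither envelope of the trap is a curve: both are graphs with
  jumps, so no Jordan curve is built from them. What survives is semicontinuity and a sign. Where
  the bottom jumps, the gap is filled by an upward run with \<open>F \<le> 0\<close>; where the top
  jumps, by a downward run with \<open>F \<ge> 0\<close>. The first fact makes the positive points
  above the bottom and those below it two open sets, which is all that separation requires. The
  second lets one component of the positive set follow the whole graph of the top, so that it
  contains some \<open>a\<close> together with \<open>a + (1, 1)\<close>; such a set cannot sit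
  inside an inessential cycle. Thus the bottom separates and the top supplies a witness. Cutting the
  torus along the diagonal leaves an annulus, realised as the punctured plane, where the theorems of
  Jordan and Janiszewski apply. The lower diagonal becomes the point 0, itself the witness for the
  positive collar. The choice between dexter and sinister is free: a strategy ending with a pivot is
  one or the other by the direction of that pivot.\<close>

lemma circle_complement_three_points:
  fixes C :: "complex set"
  assumes C: "C homeomorphic sphere (0::complex) 1"
    and z: "z1 \<notin> C" "z2 \<notin> C" "z3 \<notin> C"
  shows "connected_component (- C) z1 z2 \<or> connected_component (- C) z1 z3 \<or>
         connected_component (- C) z2 z3"
proof -
  obtain f g where fg: "homeomorphism (sphere (0::complex) 1) C f g"
    using C[unfolded homeomorphic_sym[of C]] unfolding homeomorphic_def by blast
  have im: "path_image (circlepath 0 1) = sphere (0::complex) 1"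
    by simp
  have sp: "simple_path (f \<circ> circlepath 0 1)"
    by (rule simple_path_continuous_image)
       (use fg in \<open>auto simp: simple_path_circlepath homeomorphism_def
          intro!: inj_on_inverseI[where g=g]\<close>)
  have pi: "path_image (f \<circ> circlepath 0 1) = C"
    using fg by (simp add: path_image_compose homeomorphism_def im)
  have loop: "pathfinish (f \<circ> circlepath 0 1) = pathstart (f \<circ> circlepath 0 1)"
    by (simp add: pathfinish_compose pathstart_compose)
  obtain I J where IJ: "connected I" "connected J" "I \<union> J = - C"
    using Jordan_curve[OF sp loop] pi by metis
  have I: "connected_component (- C) a b" if "a \<in> I" "b \<in> I" for a b
    unfolding connected_component_def using that IJ by (intro exI[of _ I]) auto
  have J: "connected_component (- C) a b" if "a \<in> J" "b \<in> J" for a b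
    unfolding connected_component_def using that IJ by (intro exI[of _ J]) auto
  \<comment> \<open>Pigeonhole: two of the three points lie in the same of the two connected
    pieces.\<close>
  have "z1 \<in> I \<or> z1 \<in> J" "z2 \<in> I \<or> z2 \<in> J" "z3 \<in> I \<or> z3 \<in> J"
    using IJ(3) z by auto
  then show ?thesis using I J by metis
qed

text \<open>\<open>V\<close> is open and closed relative to the complement of \<open>C\<close>, so
  no point of it can be joined to \<open>a\<close> or \<open>b\<close>. The curve leaves only two
  classes, hence \<open>a\<close> and \<open>b\<close> share the other one. This replaces any
  discussion of which side of \<open>C\<close> is the inside.\<close>

lemma circle_complement_avoiding_region:
  fixes C V :: "complex set"
  assumes C: "C homeomorphic sphere (0::complex) 1"
    and V: "open V" "V \<noteq> {}" "V \<inter> C = {}" "closure V \<subseteq> V \<union> C"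
    and z: "a \<notin> V \<union> C" "b \<notin> V \<union> C"
  shows "connected_component (- C) a b"
proof -
  obtain v where v: "v \<in> V" using V by blast
  have no: "\<not> connected_component (- C) v c" if c: "c \<notin> V \<union> C" for c
  proof
    assume "connected_component (- C) v c"
    then obtain K where K: "connected K" "K \<subseteq> - C" "v \<in> K" "c \<in> K"
      unfolding connected_component_def by blast
    have "K \<inter> V \<noteq> {}" "K - V \<noteq> {}" using K v c by auto
    then have "K \<inter> frontier V \<noteq> {}" using connected_Int_frontier K(1) by blast
    moreover have "frontier V \<subseteq> C" using V by (auto simp: frontier_def interior_open)
    ultimately show False using K by blast
  qed
  have "v \<notin> C" "a \<notin> C" "b \<notin> C" using v V z by auto
  then show ?thesis
    using circle_complement_three_points[OF C, of v a b] no[OF z(1)] no[OF z(2)] by simp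
qed

text \<open>Janiszewski's theorem, with the empty set as the connected intersection. Read
  contrapositively: if disjoint compact sets together separate two points, one of them already does.
  This extracts a single critical cycle from the whole critical set.\<close>

lemma finite_compact_separation:
  fixes a b :: complex
  assumes "finite \<C>" "\<And>C. C \<in> \<C> \<Longrightarrow> compact C" "pairwise disjnt \<C>"
    and "\<And>C. C \<in> \<C> \<Longrightarrow> connected_component (- C) a b"
  shows "connected_component (- \<Union>\<C>) a b"
  using assms
proof (induction \<C> rule: finite_induct)
  case empty
  show ?case by (auto simp: connected_component_def)
next
  case (insert C \<C>)
  have "connected_component (- \<Union>\<C>) a b"
    using insert by (simp add: pairwise_insert)
  moreover have "compact (\<Union>\<C>)" using insert by blast
  moreover have "C \<inter> \<Union>\<C> = {}"
    using insert.prems(2) insert.hyps(2) by (auto simp: pairwise_insert disjnt_def)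
  ultimately have "connected_component (- (C \<union> \<Union>\<C>)) a b"
    by (intro Janiszewski) (use insert.prems in \<open>auto simp: compact_imp_closed\<close>)
  then show ?case by simp
qed

text \<open>\<open>generic\<close> supplies some family of disjoint curves, whereas
  \<open>critical_cycles\<close> are the components of the critical set; this identifies the
  two.\<close>

lemma components_finite_disjoint_union:
  fixes \<C> :: "'a::t2_space set set"
  assumes "finite \<C>" "pairwise disjnt \<C>"
    and "\<And>C. C \<in> \<C> \<Longrightarrow> compact C \<and> connected C \<and> C \<noteq> {}"
  shows "components (\<Union>\<C>) = \<C>"
proof -
  have comp: "connected_component_set (\<Union>\<C>) x = C" if "C \<in> \<C>" "x \<in> C" for C x
  proof
    have "closed (\<Union>(\<C> - {C}))" "closed C"
      using assms that by (auto intro!: closed_Union simp: compact_imp_closed)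
    moreover have "C \<inter> \<Union>(\<C> - {C}) = {}"
      using assms(2) that by (auto simp: pairwise_def disjnt_def)
    moreover have "connected_component_set (\<Union>\<C>) x \<subseteq> C \<union> \<Union>(\<C> - {C})"
      using connected_component_subset[of "\<Union>\<C>" x] by blast
    moreover have "x \<in> connected_component_set (\<Union>\<C>) x"
      using that by (auto simp: connected_component_refl_eq)
    ultimately have "\<Union>(\<C> - {C}) \<inter> connected_component_set (\<Union>\<C>) x = {}"
      using connected_closedD[OF connected_connected_component[of "\<Union>\<C>" x],
          of C "\<Union>(\<C> - {C})"] that by blast
    then show "connected_component_set (\<Union>\<C>) x \<subseteq> C"
      using connected_component_subset[of "\<Union>\<C>" x] by blast
    show "C \<subseteq> connected_component_set (\<Union>\<C>) x"
      using assms that by (intro connected_component_maximal) auto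
  qed
  show ?thesis
  proof
    show "components (\<Union>\<C>) \<subseteq> \<C>"
      using comp by (auto simp: components_def) 
    show "\<C> \<subseteq> components (\<Union>\<C>)"
    proof
      fix C assume C: "C \<in> \<C>"
      then obtain x where "x \<in> C" using assms(3) by blast
      then show "C \<in> components (\<Union>\<C>)"
        using comp[OF C] C unfolding components_def by blast
    qed
  qed
qed

subsection \<open>The torus cut along the main diagonal is a punctured plane\<close>

lemma cis_2pi_eq_iff: "cis (2 * pi * x) = cis (2 * pi * y) \<longleftrightarrow> x - y \<in> \<int>"
proof
  assume "cis (2 * pi * x) = cis (2 * pi * y)"
  then have "exp (\<i> * of_real (2 * pi * x)) = exp (\<i> * of_real (2 * pi * y))"
    by (simp add: cis_conv_exp)
  then obtain n :: int
    where "\<i> * of_real (2 * pi * x) = \<i> * of_real (2 * pi * y) + (of_int (2 * n) * pi) * \<i>"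
    unfolding exp_eq by auto
  from arg_cong[where f=Im, OF this] have "2 * pi * x = 2 * pi * y + 2 * of_int n * pi" by simp
  then have "2 * pi * (x - y) = 2 * pi * of_int n" by (simp add: algebra_simps)
  then have "x - y = of_int n" by simp
  then show "x - y \<in> \<int>" by simp
next
  assume "x - y \<in> \<int>"
  then have "cis (2 * pi * (x - y)) = 1" by simp
  moreover have "cis (2 * pi * x) = cis (2 * pi * (x - y)) * cis (2 * pi * y)"
    by (simp add: cis_mult algebra_simps)
  ultimately show "cis (2 * pi * x) = cis (2 * pi * y)" by simp
qed

lemma torus_pt_eq_iff:
  "torus_pt p = torus_pt q \<longleftrightarrow> fst p - fst q \<in> \<int> \<and> snd p - snd q \<in> \<int>"
  by (simp add: torus_pt_def cis_2pi_eq_iff)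

lemma torus_pt_in_torus [simp]: "torus_pt p \<in> torus"
  by (simp add: torus_pt_def torus_def)

lemma continuous_on_torus_pt [continuous_intros]:
  "continuous_on S f \<Longrightarrow> continuous_on S (\<lambda>x. torus_pt (f x))"
  unfolding torus_pt_def by (intro continuous_intros)

lemma compact_torus: "compact torus"
  unfolding torus_def by (intro compact_Times) auto

lemma locally_path_connected_torus: "locally path_connected torus"
  unfolding torus_def
  by (intro ANR_imp_locally_path_connected ANR_Times ANR_sphere)

text \<open>The first coordinate has a continuous logarithm on a simply connected set, while along
  the connected set its argument increases by a full turn.\<close>

lemma essential_not_in_simply_connected:
  assumes U: "openin (top_of_set torus) U" "simply_connected U"
    and K: "connected K" "p \<in> K" "p + (1, 1) \<in> K"
  shows "\<not> torus_pt ` K \<subseteq> U"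
proof
  assume sub: "torus_pt ` K \<subseteq> U"
  have "U \<subseteq> torus" using U(1) openin_imp_subset by blast
  then have nz: "fst z \<noteq> 0" if "z \<in> U" for z using that by (auto simp: torus_def)
  have "continuous_on U fst" by (intro continuous_intros)
  moreover have "locally path_connected U"
    using locally_open_subset locally_path_connected_torus U(1) by blast
  ultimately obtain g where g: "continuous_on U g" "\<And>z. z \<in> U \<Longrightarrow> fst z = exp (g z)"
    using continuous_logarithm_on_simply_connected[of U fst] U(2) nz by blast
  \<comment> \<open>\<open>h\<close> compares the logarithm pulled back from \<open>U\<close> with
    the angle of the human, in units of a full turn. It is integer-valued, hence constant on
    \<open>K\<close>, although passing from \<open>p\<close> to \<open>p + (1, 1)\<close> fixes the
    first term and raises the angle by one turn.\<close>
  define h where "h q = (g (torus_pt q) - \<i> * of_real (2 * pi * fst q)) / (2 * pi * \<i>)" for q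
  have h_int: "h q \<in> \<int>" if "q \<in> K" for q
  proof -
    have "exp (g (torus_pt q)) = exp (\<i> * of_real (2 * pi * fst q))"
      using g(2)[of "torus_pt q"] that sub by (auto simp: torus_pt_def cis_conv_exp)
    then obtain n :: int where
      "g (torus_pt q) = \<i> * of_real (2 * pi * fst q) + (of_int (2 * n) * pi) * \<i>"
      unfolding exp_eq by auto
    then have "h q = of_int n" by (simp add: h_def field_simps)
    then show ?thesis by simp
  qed
  have "continuous_on K (\<lambda>q. g (torus_pt q))"
    using sub by (intro continuous_on_compose2[OF g(1)] continuous_intros)
  then have "continuous_on K h"
    unfolding h_def by (intro continuous_intros) auto
  moreover have "\<exists>e>0. \<forall>y. y \<in> K \<and> h y \<noteq> h x \<longrightarrow> e \<le> cmod (h y - h x)" if "x \<in> K" for x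
  proof (intro exI[of _ 1] conjI allI impI)
    fix y assume "y \<in> K \<and> h y \<noteq> h x"
    then have "h y - h x \<in> \<int>" "h y - h x \<noteq> 0" using h_int that by auto
    then obtain n :: int where "h y - h x = of_int n" "n \<noteq> 0"
      by (metis Ints_cases of_int_0)
    then show "1 \<le> cmod (h y - h x)" by simp
  qed simp
  ultimately have "h constant_on K" using continuous_discrete_range_constant[OF K(1)] by blast
  then have "h p = h (p + (1, 1))" using K unfolding constant_on_def by metis
  moreover have "torus_pt (p + (1, 1)) = torus_pt p" by (simp add: torus_pt_eq_iff)
  ultimately show False by (simp add: h_def field_simps)
qed

definition strip :: "(real \<times> real) set" where
  "strip = {p. fst p < snd p \<and> snd p < fst p + 1}"

definition diagonal_cycle :: "(complex \<times> complex) set" where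
  "diagonal_cycle = torus_pt ` {p. fst p = snd p}"

text \<open>The angle of the human becomes the imaginary part, so that \<open>exp\<close> divides
  out exactly the translations along the diagonal; \<open>arctan\<close> squeezes the real line into
  the width of the strip. The lower diagonal is approached as the real part tends to minus infinity,
  that is, near 0 in the punctured plane, and the upper one near infinity.\<close>

definition strip_of_plane :: "complex \<Rightarrow> real \<times> real" where
  "strip_of_plane z = (Im z / (2 * pi), Im z / (2 * pi) + 1 / 2 + arctan (Re z) / pi)"

text \<open>The map that \<open>strip_of_plane\<close> induces modulo the period of
  \<open>exp\<close>. The fraction is the Cayley transform of \<open>ln (cmod w)\<close>, a unit
  complex number encoding the angle from human to puppy.\<close>

definition torus_of_plane :: "complex \<Rightarrow> complex \<times> complex" where
  "torus_of_plane w = (sgn w, sgn w * ((of_real (ln (cmod w)) - \<i>) / (of_real (ln (cmod w)) + \<i>)))"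

text \<open>For distinct \<open>a\<close>, \<open>b\<close> on the unit circle,
  \<open>\<i> * (a + b) / (a - b)\<close> is real and inverts the Cayley transform;
  \<open>Re\<close> only changes the type.\<close>

definition plane_of_torus :: "complex \<times> complex \<Rightarrow> complex" where
  "plane_of_torus q =
     fst q * of_real (exp (Re (\<i> * (fst q + snd q) / (fst q - snd q))))"

lemma continuous_on_strip_of_plane: "continuous_on UNIV strip_of_plane"
  unfolding strip_of_plane_def by (intro continuous_intros) auto

lemma range_strip_of_plane: "range strip_of_plane = strip"
proof
  have "arctan t / pi > - (1/2) \<and> arctan t / pi < 1/2" for t
    using arctan_bounded[of t] by (simp add: field_simps)
  then show "range strip_of_plane \<subseteq> strip"
    unfolding strip_def strip_of_plane_def by (auto, (smt (verit) field_sum_of_halves)+)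
  show "strip \<subseteq> range strip_of_plane"
  proof
    fix p assume p: "p \<in> strip"
    define s where "s = pi * (snd p - fst p - 1/2)"
    have "snd p - fst p - 1/2 < 1/2" "-(1/2) < snd p - fst p - 1/2"
      using p by (auto simp: strip_def)
    then have "s < pi / 2" "- (pi / 2) < s"
      using mult_strict_left_mono[of "snd p - fst p - 1/2" "1/2" pi]
        mult_strict_left_mono[of "-(1/2)" "snd p - fst p - 1/2" pi] by (simp_all add: s_def)
    then have "arctan (tan s) = s" by (intro arctan_tan)
    then have "strip_of_plane (Complex (tan s) (2 * pi * fst p)) = p"
      by (simp add: strip_of_plane_def s_def prod_eq_iff)
    then show "p \<in> range strip_of_plane" by (metis rangeI)
  qed
qed

lemma of_real_add_ii_neq_0: "of_real t + \<i> \<noteq> 0"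
  by (simp add: complex_eq_iff)

text \<open>The Cayley transform in terms of angles: double the angle of
  \<open>1 + \<i> * t\<close>, then turn by \<open>pi\<close>.\<close>

lemma cis_arctan: "cis (pi + 2 * arctan t) = (of_real t - \<i>) / (of_real t + \<i>)"
proof -
  have *: "cis (arctan t) = (1 + \<i> * of_real t) / of_real (sqrt (1 + t\<^sup>2))"
    by (simp add: complex_eq_iff cos_arctan sin_arctan Re_divide_of_real Im_divide_of_real)
  have nz: "1 + (of_real t)\<^sup>2 \<noteq> (0::complex)"
  proof -
    have "1 + t\<^sup>2 \<noteq> 0" by (smt (verit) zero_le_power2)
    then show ?thesis by (metis of_real_1 of_real_add of_real_eq_0_iff of_real_power)
  qed
  have "cis (pi + 2 * arctan t) = - (cis (arctan t))\<^sup>2"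
    by (simp add: power2_eq_square cis_mult flip: cis_mult[of pi])
  also have "\<dots> = - ((1 + \<i> * of_real t)\<^sup>2 / (1 + (of_real t)\<^sup>2))"
    unfolding * by (simp add: power_divide flip: of_real_power)
  also have "\<dots> = (of_real t - \<i>) / (of_real t + \<i>)"
    using nz of_real_add_ii_neq_0[of t]
    by (simp add: field_simps) (simp add: power2_eq_square algebra_simps)
  finally show ?thesis .
qed

lemma torus_of_plane_exp: "torus_of_plane (exp z) = torus_pt (strip_of_plane z)"
proof -
  have a: "sgn (exp z) = cis (Im z)"
    by (simp add: sgn_eq exp_eq_polar norm_mult)
  have "cis (2 * pi * snd (strip_of_plane z)) = cis (Im z + (pi + 2 * arctan (Re z)))"
    by (simp add: strip_of_plane_def algebra_simps)
  also have "\<dots> = cis (Im z) * cis (pi + 2 * arctan (Re z))" by (simp add: cis_mult)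
  finally show ?thesis
    by (simp add: torus_of_plane_def torus_pt_def a cis_arctan) (simp add: strip_of_plane_def)
qed

lemma plane_of_torus_of_plane:
  assumes "w \<noteq> 0" shows "plane_of_torus (torus_of_plane w) = w"
proof -
  define a t where "a = sgn w" and "t = complex_of_real (ln (cmod w))"
  have a: "a \<noteq> 0" using assms by (simp add: a_def sgn_zero_iff)
  have t: "t + \<i> \<noteq> 0" unfolding t_def by (rule of_real_add_ii_neq_0)
  have "a + a * ((t - \<i>) / (t + \<i>)) = a * (2 * t) / (t + \<i>)"
       "a - a * ((t - \<i>) / (t + \<i>)) = a * (2 * \<i>) / (t + \<i>)"
    using t by (simp_all add: field_simps)
  then have "\<i> * (a + a * ((t - \<i>) / (t + \<i>))) / (a - a * ((t - \<i>) / (t + \<i>))) = t"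
    using a t by simp
  then have "plane_of_torus (torus_of_plane w) = a * of_real (exp (ln (cmod w)))"
    by (simp add: plane_of_torus_def torus_of_plane_def flip: a_def t_def) (simp add: t_def)
  then show ?thesis using assms by (simp add: a_def sgn_eq)
qed

lemma torus_minus_diagonal: "torus - diagonal_cycle = torus_pt ` strip"
proof
  show "torus_pt ` strip \<subseteq> torus - diagonal_cycle"
  proof (clarsimp simp: diagonal_cycle_def)
    fix x y t assume xy: "(x, y) \<in> strip" and "torus_pt (x, y) = torus_pt (t, t)"
    then have "x - t \<in> \<int>" "y - t \<in> \<int>" by (auto simp: torus_pt_eq_iff)
    then have "(y - t) - (x - t) \<in> \<int>" by (rule Ints_diff[rotated])
    then have "y - x \<in> \<int>" by simp
    then obtain n :: int where "y - x = of_int n" by (elim Ints_cases)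
    moreover have "0 < y - x" "y - x < 1" using xy by (auto simp: strip_def)
    ultimately show False by simp
  qed
  show "torus - diagonal_cycle \<subseteq> torus_pt ` strip"
  proof
    fix q assume q: "q \<in> torus - diagonal_cycle"
    have unit: "\<exists>x. u = cis (2 * pi * x)" if "u \<in> sphere 0 1" for u
    proof
      show "u = cis (2 * pi * (Arg u / (2 * pi)))"
        using cis_Arg[of u] that by (cases "u = 0") (auto simp: sgn_eq)
    qed
    have "fst q \<in> sphere 0 1" "snd q \<in> sphere 0 1" using q by (auto simp: torus_def)
    from this[THEN unit] obtain x y where xy: "q = torus_pt (x, y)"
      by (auto simp: torus_pt_def prod_eq_iff)
    define y' where "y' = y - of_int \<lfloor>y - x\<rfloor>"
    have q': "q = torus_pt (x, y')" unfolding xy by (simp add: torus_pt_eq_iff y'_def)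
    have "x \<le> y'" "y' < x + 1" unfolding y'_def by linarith+
    moreover have "x \<noteq> y'" using q q' by (auto simp: diagonal_cycle_def)
    ultimately have "(x, y') \<in> strip" by (auto simp: strip_def)
    then show "q \<in> torus_pt ` strip" using q' by blast
  qed
qed

lemma torus_of_plane_range: "torus_of_plane ` (- {0}) = torus - diagonal_cycle"
proof -
  have "- {0} = exp ` (UNIV :: complex set)"
    using covering_space_exp_punctured_plane by (metis covering_space_imp_surjective)
  then show ?thesis
    unfolding torus_minus_diagonal range_strip_of_plane[symmetric]
    by (auto simp: torus_of_plane_exp image_iff)
qed

lemma torus_of_plane_of_torus:
  assumes "q \<in> torus - diagonal_cycle"
  shows "torus_of_plane (plane_of_torus q) = q"
  using assms plane_of_torus_of_plane unfolding torus_of_plane_range[symmetric] by force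

lemma homeomorphism_torus_plane:
  "homeomorphism (torus - diagonal_cycle) (- {0}) plane_of_torus torus_of_plane"
proof (rule homeomorphismI)
  have ne: "fst q \<noteq> snd q" if "q \<in> torus - diagonal_cycle" for q
    using that unfolding torus_minus_diagonal
    by (clarsimp simp: strip_def torus_pt_def cis_2pi_eq_iff) (smt (verit) Ints_cases of_int_less_0_iff of_int_less_iff of_int_1_less_iff minus_diff_eq of_int_minus of_int_0_less_iff of_int_1)
  show "continuous_on (torus - diagonal_cycle) plane_of_torus"
    unfolding plane_of_torus_def using ne by (intro continuous_intros) auto
  show "continuous_on (- {0}) torus_of_plane"
    unfolding torus_of_plane_def using of_real_add_ii_neq_0
    by (intro continuous_intros) (auto simp: sgn_zero_iff)
  show "plane_of_torus ` (torus - diagonal_cycle) \<subseteq> - {0}"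
    by (auto simp: plane_of_torus_def torus_def)
qed (use torus_of_plane_range plane_of_torus_of_plane torus_of_plane_of_torus in auto)

subsection \<open>Essential critical cycles\<close>

text \<open>The last conclusion is the useful one: as \<open>C\<close> is the whole relative
  frontier of \<open>U\<close>, the set \<open>U\<close> is open and closed in the torus minus
  \<open>C\<close>. Closedness of the torus identifies relative and absolute closure.\<close>

lemma inessential_region:
  assumes "C \<noteq> {}" "\<not> essential C"
  obtains U where "openin (top_of_set torus) U" "simply_connected U" "U \<noteq> {}"
    "U \<inter> C = {}" "closure U = U \<union> C"
    "\<And>K. connected K \<Longrightarrow> K \<subseteq> torus \<Longrightarrow> K \<inter> C = {} \<Longrightarrow> K \<inter> U \<noteq> {} \<Longrightarrow> K \<subseteq> U"
proof -
  obtain U where U: "openin (top_of_set torus) U" "simply_connected U"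
      "(top_of_set torus) frontier_of U = C"
    using assms unfolding essential_def by blast
  have sub: "U \<subseteq> torus" using U(1) openin_imp_subset by blast
  have "closure U \<subseteq> torus"
    using sub compact_torus by (simp add: closure_minimal compact_imp_closed)
  then have cl: "(top_of_set torus) closure_of U = closure U"
    using sub by (simp add: closure_of_subtopology Int_absorb1 Int_absorb2)
  have C: "C = closure U - U"
    using U(3) by (simp add: frontier_of_def cl interior_of_openin[OF U(1)])
  have eq: "closure U = U \<union> C" using C closure_subset[of U] by auto
  have clopen: "K \<subseteq> U" if K: "connected K" "K \<subseteq> torus" "K \<inter> C = {}" "K \<inter> U \<noteq> {}" for K
  proof -
    obtain G where G: "open G" "U = torus \<inter> G" using U(1) by (auto simp: openin_open)
    have "K \<inter> G \<inter> (- closure U) = {}" using K(2) G(2) closure_subset[of U] by blast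
    moreover have "K \<subseteq> G \<union> - closure U" using K(3) eq G(2) by blast
    moreover have "K \<inter> G \<noteq> {}" using K G(2) by blast
    ultimately have "K \<inter> - closure U = {}"
      using connectedD[OF K(1) G(1), of "- closure U"] by blast
    then show ?thesis using K(3) eq by blast
  qed
  have "U \<noteq> {}" using assms(1) eq by auto
  with that[OF U(1,2) _ _ eq clopen] C show thesis by blast
qed

text \<open>A period of \<open>exp\<close> is a translation of the strip along the diagonal, so
  disjoint translation-invariant regions of the strip keep disjoint images in the plane.\<close>

lemma exp_strip_eq:
  assumes "exp z = exp z'"
  shows "\<exists>k::int. strip_of_plane z = strip_of_plane z' + (of_int k, of_int k)"
proof -
  obtain n :: int where n: "z = z' + (of_int (2 * n) * pi) * \<i>"
    using assms exp_eq by blast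
  then have "Im z = Im z' + 2 * of_int n * pi" "Re z = Re z'" by auto
  then have "strip_of_plane z = strip_of_plane z' + (of_int n, of_int n)"
    by (simp add: strip_of_plane_def field_simps)
  then show ?thesis by blast
qed

text \<open>The rest of the torus is connected, so a region bounded by the diagonal would be all of
  it; but it carries a connected set through (0, 1/2) and (1, 3/2), along which the human makes a
  full turn.\<close>

lemma essential_diagonal: "essential diagonal_cycle"
proof (rule ccontr)
  have ne: "diagonal_cycle \<noteq> {}" by (auto simp: diagonal_cycle_def)
  assume "\<not> essential diagonal_cycle"
  then obtain U where U: "openin (top_of_set torus) U" "simply_connected U" "U \<noteq> {}"
    "U \<inter> diagonal_cycle = {}"
    "\<And>K. connected K \<Longrightarrow> K \<subseteq> torus \<Longrightarrow> K \<inter> diagonal_cycle = {} \<Longrightarrow> K \<inter> U \<noteq> {} \<Longrightarrow> K \<subseteq> U"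
    using inessential_region[OF ne] by metis
  have "connected (range strip_of_plane)"
    by (intro connected_continuous_image continuous_on_strip_of_plane connected_UNIV)
  then have con: "connected strip" by (simp add: range_strip_of_plane)
  have "connected (torus_pt ` strip)"
    by (intro connected_continuous_image con continuous_intros)
  moreover have "torus_pt ` strip \<inter> diagonal_cycle = {}" "torus_pt ` strip \<subseteq> torus"
    using torus_minus_diagonal by auto
  moreover have "torus_pt ` strip \<inter> U \<noteq> {}"
    using U(3,4) openin_imp_subset[OF U(1)] unfolding torus_minus_diagonal[symmetric] by blast
  ultimately have "torus_pt ` strip \<subseteq> U" by (intro U(5))
  moreover have "(0, 1/2) \<in> strip" "(0, 1/2) + (1, 1) \<in> strip" by (auto simp: strip_def)
  ultimately show False using essential_not_in_simply_connected[OF U(1,2) con] by blast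
qed

text \<open>Two translation-invariant regions in the strip that touch neither each other nor the
  critical cycles become, together with the collar of the diagonal, three pairwise separated
  regions of the plane. Each pair is separated by a single cycle, which must be essential; but
  a single Jordan curve cannot separate three points pairwise.\<close>

lemma three_regions:
  fixes \<C> :: "(complex \<times> complex) set set"
  assumes fin: "finite \<C>" and scc: "\<And>C. C \<in> \<C> \<Longrightarrow> simple_closed_curve_in_torus C"
    and dis: "pairwise disjnt \<C>" and diag: "diagonal_cycle \<in> \<C>"
    and op: "open A" "open B" "open N"
    and inv: "\<And>p k. p \<in> A \<Longrightarrow> p + (of_int k, of_int k) \<in> A"
      "\<And>p k. p \<in> B \<Longrightarrow> p + (of_int k, of_int k) \<in> B"
      "\<And>p k. p \<in> N \<Longrightarrow> p + (of_int k, of_int k) \<in> N"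
    and disj: "A \<inter> B = {}" "A \<inter> N = {}" "B \<inter> N = {}"
    and cover: "\<And>p. p \<in> strip \<Longrightarrow> torus_pt p \<notin> \<Union>\<C> \<Longrightarrow> p \<in> A \<union> B \<union> N"
    and collar: "0 < \<epsilon>" "\<And>x y. x < y \<Longrightarrow> y < x + \<epsilon> \<Longrightarrow> (x, y) \<in> B"
    and a: "a \<in> A" "a \<in> strip" "connected K" "a \<in> K" "a + (1, 1) \<in> K"
      "torus_pt ` K \<inter> \<Union>\<C> = {}"
    and n: "n \<in> N" "n \<in> strip" "connected L" "n \<in> L" "n + (1, 1) \<in> L"
      "torus_pt ` L \<inter> \<Union>\<C> = {}"
  shows "card {C \<in> \<C>. essential C} \<noteq> 2"
proof
  let ?P = "plane_of_torus" and ?R = "\<lambda>X. exp ` (strip_of_plane -` X)"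
  let ?D = "\<C> - {diagonal_cycle}"
  note hom = homeomorphism_torus_plane
  have inj: "inj_on ?P (torus - diagonal_cycle)"
    by (rule inj_on_inverseI[of _ torus_of_plane]) (rule torus_of_plane_of_torus)
  have open_R: "open (?R X)" if "open X" for X
  proof -
    have "open (strip_of_plane -` X)"
      using that continuous_on_strip_of_plane by (simp add: continuous_on_open_vimage)
    then have "openin (top_of_set (- {0})) (?R X)"
      by (intro covering_space_open_map[OF covering_space_exp_punctured_plane]) simp
    then show ?thesis by (rule openin_open_trans) auto
  qed
  have disj_R: "?R X \<inter> ?R Y = {}"
    if XY: "X \<inter> Y = {}" "\<And>p k. p \<in> X \<Longrightarrow> p + (of_int k, of_int k) \<in> X" for X Y
  proof (rule ccontr)
    assume "?R X \<inter> ?R Y \<noteq> {}"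
    then obtain z z' where z: "exp z = exp z'" "strip_of_plane z' \<in> X" "strip_of_plane z \<in> Y"
      by (auto simp: image_iff) metis
    obtain k :: int where "strip_of_plane z = strip_of_plane z' + (of_int k, of_int k)"
      using exp_strip_eq[OF z(1)] by blast
    with XY z show False by (metis disjoint_iff)
  qed
  \<comment> \<open>The origin stands for the lower diagonal. By the collar hypothesis
    \<open>B\<close> fills a punctured disc around it, so adding the point keeps the set open and
    provides a witness that lies on the image of no other cycle.\<close>
  define O1 where "O1 = insert 0 (?R B)"
  have "open O1"
  proof -
    \<comment> \<open>The bound 1/2 keeps \<open>pi * (e - 1/2)\<close> in the range where
      \<open>arctan\<close> inverts \<open>tan\<close>; \<open>\<rho>\<close> is the radius that
      corresponds to height \<open>e\<close> above the lower diagonal.\<close>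
    define e where "e = min \<epsilon> (1/2)"
    have e: "0 < e" "e \<le> 1/2" "e \<le> \<epsilon>" using collar(1) by (auto simp: e_def)
    define \<rho> where "\<rho> = exp (tan (pi * (e - 1/2)))"
    have "w \<in> ?R B" if w: "w \<in> ball 0 \<rho>" "w \<noteq> 0" for w
    proof -
      have "ln (cmod w) < ln \<rho>" using w by (subst ln_less_cancel_iff) (auto simp: \<rho>_def)
      then have lt: "Re (Ln w) < tan (pi * (e - 1/2))" using w by (simp add: \<rho>_def)
      have "- (pi / 2) < pi * (e - 1/2)" "pi * (e - 1/2) < pi / 2"
        using e mult_strict_left_mono[of "-(1/2)" "e - 1/2" pi]
          mult_strict_left_mono[of "e - 1/2" "1/2" pi] by simp_all
      then have "arctan (tan (pi * (e - 1/2))) = pi * (e - 1/2)" by (intro arctan_tan)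
      with lt have "arctan (Re (Ln w)) < pi * (e - 1/2)" by (metis arctan_less_iff)
      then have "1/2 + arctan (Re (Ln w)) / pi < e" by (simp add: field_simps)
      moreover have "strip_of_plane (Ln w) \<in> strip" using range_strip_of_plane by blast
      ultimately have "strip_of_plane (Ln w) \<in> B"
        using e(3) by (auto simp: strip_of_plane_def strip_def intro!: collar(2))
      then show ?thesis using w by (intro image_eqI[of _ _ "Ln w"]) auto
    qed
    then have "ball 0 \<rho> \<subseteq> O1" unfolding O1_def by blast
    moreover have "0 \<in> ball 0 \<rho>" by (simp add: \<rho>_def)
    ultimately have "O1 = ?R B \<union> ball 0 \<rho>" unfolding O1_def by blast
    then show ?thesis using open_R[OF op(2)] by auto
  qed
  have opens: "open (?R A)" "open (?R N)" using open_R op by auto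
  have O_disj: "O1 \<inter> ?R A = {}" "O1 \<inter> ?R N = {}" "?R A \<inter> ?R N = {}"
  proof -
    have "?R B \<inter> ?R A = {}" "?R B \<inter> ?R N = {}"
      using inv disj by (intro disj_R; blast)+
    then show "O1 \<inter> ?R A = {}" "O1 \<inter> ?R N = {}" by (auto simp: O1_def)
    show "?R A \<inter> ?R N = {}" using inv disj by (intro disj_R; blast)
  qed
  have D_sub: "C \<subseteq> torus - diagonal_cycle" if "C \<in> ?D" for C
    using that scc dis diag by (fastforce simp: simple_closed_curve_in_torus_def pairwise_def disjnt_def)
  have O_cover: "- \<Union>((`) ?P ` ?D) \<subseteq> O1 \<union> ?R A \<union> ?R N"
  proof
    fix w assume w: "w \<in> - \<Union>((`) ?P ` ?D)"
    show "w \<in> O1 \<union> ?R A \<union> ?R N"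
    proof (cases "w = 0")
      case False
      define p where "p = strip_of_plane (Ln w)"
      have p: "p \<in> strip" using range_strip_of_plane by (auto simp: p_def)
      have w_eq: "w = ?P (torus_pt p)"
        using plane_of_torus_of_plane[OF False] torus_of_plane_exp[of "Ln w"] False
        by (simp add: p_def)
      have "torus_pt p \<notin> \<Union>\<C>"
      proof
        assume "torus_pt p \<in> \<Union>\<C>"
        then obtain C where C: "C \<in> \<C>" "torus_pt p \<in> C" by blast
        have "torus_pt p \<notin> diagonal_cycle" using p torus_minus_diagonal by blast
        then have "C \<in> ?D" using C by auto
        then show False using w w_eq C by blast
      qed
      then have "p \<in> A \<union> B \<union> N" using cover p by blast
      moreover have "w = exp (Ln w)" using False by simp
      ultimately show ?thesis by (auto simp: O1_def p_def)
    qed (simp add: O1_def)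
  qed
  \<comment> \<open>Two disjoint open sets covering the complement of all cycles disconnect it, so
    some single cycle must separate \<open>u\<close> from \<open>v\<close>.\<close>
  have sep: "\<exists>C\<in>?D. \<not> connected_component (- ?P ` C) u v"
    if uv: "u \<in> G" "v \<in> H" "open G" "open H" "G \<inter> H = {}"
      "- \<Union>((`) ?P ` ?D) \<subseteq> G \<union> H" for u v G H
  proof (rule ccontr)
    assume neg: "\<not> (\<exists>C\<in>?D. \<not> connected_component (- ?P ` C) u v)"
    have "connected_component (- \<Union>((`) ?P ` ?D)) u v"
    proof (rule finite_compact_separation)
      show "pairwise disjnt ((`) ?P ` ?D)"
      proof (clarsimp simp: pairwise_def disjnt_def)
        fix X Y assume XY: "X \<in> \<C>" "X \<noteq> diagonal_cycle" "Y \<in> \<C>" "Y \<noteq> diagonal_cycle"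
          "?P ` X \<noteq> ?P ` Y"
        then have "X \<inter> Y = {}" using dis by (auto simp: pairwise_def disjnt_def)
        moreover have "X \<subseteq> torus - diagonal_cycle" "Y \<subseteq> torus - diagonal_cycle"
          using XY D_sub by auto
        ultimately show "?P ` X \<inter> ?P ` Y = {}"
          using inj_on_image_Int[OF inj, of X Y] by simp
      qed
      show "compact X" if X: "X \<in> (`) ?P ` ?D" for X
      proof -
        obtain C where C: "C \<in> ?D" "X = ?P ` C" using X by blast
        have "compact C"
          using scc[of C] C homeomorphic_compactness[of C "sphere (0::complex) 1"]
          by (auto simp: simple_closed_curve_in_torus_def)
        then show ?thesis unfolding C(2)
          using D_sub[OF C(1)] hom
          by (intro compact_continuous_image) (auto simp: homeomorphism_def intro: continuous_on_subset)
      qed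
    qed (use fin neg in auto)
    then obtain M where M: "connected M" "M \<subseteq> - \<Union>((`) ?P ` ?D)" "u \<in> M" "v \<in> M"
      unfolding connected_component_def by blast
    have "M \<subseteq> G \<union> H" using M(2) uv(6) by (rule order_trans)
    moreover have "G \<inter> H \<inter> M = {}" using uv(5) by simp
    ultimately have "G \<inter> M = {} \<or> H \<inter> M = {}" by (intro connectedD[OF M(1) uv(3,4)])
    then show False using M(3,4) uv(1,2) by blast
  qed
  \<comment> \<open>If \<open>torus_pt p\<close> were in \<open>U\<close>, the whole image of
    \<open>M\<close> would be, since it is connected and misses \<open>C\<close>; but it wraps
    around the torus, which a simply connected open set forbids.\<close>
  have avoid: "torus_pt p \<notin> U"
    if "openin (top_of_set torus) U" "simply_connected U"
      "\<And>K. connected K \<Longrightarrow> K \<subseteq> torus \<Longrightarrow> K \<inter> C = {} \<Longrightarrow> K \<inter> U \<noteq> {} \<Longrightarrow> K \<subseteq> U"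
      "connected M" "p \<in> M" "p + (1, 1) \<in> M" "torus_pt ` M \<inter> C = {}" for U C p M
  proof
    assume "torus_pt p \<in> U"
    then have "torus_pt ` M \<inter> U \<noteq> {}" using that(5) by blast
    then have "torus_pt ` M \<subseteq> U" using that
      by (intro that(3) connected_continuous_image continuous_intros) auto
    then show False using essential_not_in_simply_connected[OF that(1,2,4,5,6)] by blast
  qed
  have circ: "?P ` C homeomorphic sphere (0::complex) 1" if C: "C \<in> ?D" for C
  proof -
    have "homeomorphism C (?P ` C) ?P torus_of_plane"
      using homeomorphism_of_subsets[OF hom D_sub[OF C]] homeomorphism_image1[OF hom] by blast
    then have "C homeomorphic ?P ` C" using homeomorphic_def by blast
    then show ?thesis
      using scc[of C] C homeomorphic_sym homeomorphic_trans
      by (metis DiffD1 simple_closed_curve_in_torus_def)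
  qed
  define Q where "Q = {0, ?P (torus_pt a), ?P (torus_pt n)}"
  have strip_cut: "torus_pt p \<in> torus - diagonal_cycle" if "p \<in> strip" for p
    using that torus_minus_diagonal by blast
  have Q_avoid: "u \<notin> ?P ` X"
    if "u \<in> Q" "X \<subseteq> torus - diagonal_cycle" "torus_pt a \<notin> X" "torus_pt n \<notin> X" for u X
  proof -
    have zero: "0 \<notin> ?P ` X"
      using homeomorphism_image1[OF hom] that(2) by blast
    have *: "?P (torus_pt p) \<notin> ?P ` X" if "p \<in> strip" "torus_pt p \<notin> X" for p
    proof
      assume "?P (torus_pt p) \<in> ?P ` X"
      then obtain q where "q \<in> X" "?P (torus_pt p) = ?P q" by blast
      with strip_cut[OF that(1)] \<open>X \<subseteq> torus - diagonal_cycle\<close>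
      have "torus_pt p = q" by (metis subsetD torus_of_plane_of_torus)
      with that \<open>q \<in> X\<close> show False by simp
    qed
    have "u = 0 \<or> u = ?P (torus_pt a) \<or> u = ?P (torus_pt n)" using that(1) by (simp add: Q_def)
    then show ?thesis using zero *[OF a(2) that(3)] *[OF n(2) that(4)] by (elim disjE) simp_all
  qed
  have C_avoid: "torus_pt a \<notin> C" "torus_pt n \<notin> C" if "C \<in> \<C>" for C
    using that a(4,6) n(4,6) by blast+
  \<comment> \<open>An inessential cycle bounds a region \<open>U\<close> that misses the diagonal,
    \<open>a\<close> and \<open>n\<close>, since each of them lies on a wrapping connected set off
    the cycle. The image of \<open>U\<close> in the plane then uses up one of the two sides and
    leaves all points of \<open>Q\<close> on the other.\<close>
  have ess: "essential C"
    if C: "C \<in> ?D" and uv: "u \<in> Q" "v \<in> Q" "\<not> connected_component (- ?P ` C) u v" for C u v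
  proof (rule ccontr)
    have ne: "C \<noteq> {}"
      using scc[of C] C by (auto simp: simple_closed_curve_in_torus_def)
    assume iness: "\<not> essential C"
    obtain U where U: "openin (top_of_set torus) U" "simply_connected U" "U \<noteq> {}"
      "U \<inter> C = {}" "closure U = U \<union> C" and clopen:
      "\<And>K. connected K \<Longrightarrow> K \<subseteq> torus \<Longrightarrow> K \<inter> C = {} \<Longrightarrow> K \<inter> U \<noteq> {} \<Longrightarrow> K \<subseteq> U"
      by (rule inessential_region[OF ne iness]) (rule that)
    have U_sub: "U \<subseteq> torus" using U(1) openin_imp_subset by blast
    have Cdis: "torus_pt ` K \<inter> C = {}" "torus_pt ` L \<inter> C = {}" using a(6) n(6) C by blast+
    have "torus_pt p \<notin> U" if "fst p = snd p" for p
    proof (rule avoid[OF U(1,2) clopen])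
      show "connected {p :: real \<times> real. fst p = snd p}"
      proof -
        have "{p :: real \<times> real. fst p = snd p} = (\<lambda>t. (t, t)) ` UNIV" by (auto simp: image_iff)
        then show ?thesis
          by (simp only:) (intro connected_continuous_image continuous_intros connected_UNIV)
      qed
      show "torus_pt ` {p. fst p = snd p} \<inter> C = {}"
        using D_sub[OF C] by (auto simp: diagonal_cycle_def)
    qed (use that in auto)
    then have U_cut: "U \<subseteq> torus - diagonal_cycle" using U_sub by (auto simp: diagonal_cycle_def)
    define V where "V = ?P ` U"
    have "openin (top_of_set (torus - diagonal_cycle)) U"
      using U(1) U_cut by (auto simp: openin_open)
    then have "openin (top_of_set (- {0})) V"
      unfolding V_def using hom homeomorphism_imp_open_map by blast
    then have "open V" by (rule openin_open_trans) auto
    have UC: "U \<union> C \<subseteq> torus - diagonal_cycle" using U_cut D_sub[OF C] by blast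
    have "bounded U" using U_sub compact_torus compact_imp_bounded bounded_subset by blast
    then have "compact (U \<union> C)" using U(5) by (metis compact_closure)
    then have "compact (?P ` (U \<union> C))"
      using UC hom by (intro compact_continuous_image)
        (auto simp: homeomorphism_def intro: continuous_on_subset)
    then have "closure V \<subseteq> ?P ` (U \<union> C)"
      by (intro closure_minimal) (auto simp: V_def compact_imp_closed)
    then have cl: "closure V \<subseteq> V \<union> ?P ` C" by (auto simp: V_def)
    have "V \<inter> ?P ` C = {}"
    proof -
      have False if "x \<in> U" "y \<in> C" "?P x = ?P y" for x y
      proof -
        have "x = y" using that UC torus_of_plane_of_torus by (metis UnCI subsetD)
        then show False using that U(4) by blast
      qed
      then show ?thesis by (auto simp: V_def)
    qed
    moreover have "u \<notin> V \<union> ?P ` C" "v \<notin> V \<union> ?P ` C"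
    proof -
      have "torus_pt a \<notin> U" by (rule avoid[OF U(1,2) clopen a(3-5) Cdis(1)])
      moreover have "torus_pt n \<notin> U" by (rule avoid[OF U(1,2) clopen n(3-5) Cdis(2)])
      ultimately have *: "torus_pt a \<notin> U \<union> C" "torus_pt n \<notin> U \<union> C"
        using C_avoid[of C] C by simp_all
      show "u \<notin> V \<union> ?P ` C" "v \<notin> V \<union> ?P ` C"
        using Q_avoid[OF uv(1) UC *] Q_avoid[OF uv(2) UC *] by (simp_all add: V_def image_Un)
    qed
    ultimately have "connected_component (- ?P ` C) u v"
      using U(3) by (intro circle_complement_avoiding_region[OF circ[OF C] \<open>open V\<close> _ _ cl])
        (auto simp: V_def)
    with uv(3) show False by simp
  qed
  have mem: "?P (torus_pt p) \<in> ?R X" if p: "p \<in> strip" "p \<in> X" for p X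
  proof -
    obtain z where z: "p = strip_of_plane z" using p range_strip_of_plane by blast
    have "?P (torus_pt p) = exp z"
      unfolding z torus_of_plane_exp[symmetric] by (simp add: plane_of_torus_of_plane)
    then show ?thesis using z p by blast
  qed
  \<comment> \<open>Grouping the three open sets in different ways yields a separating cycle for
    each pair of witnesses.\<close>
  obtain C1 where C1: "C1 \<in> ?D" "\<not> connected_component (- ?P ` C1) 0 (?P (torus_pt a))"
    using sep[of 0 O1 "?P (torus_pt a)" "?R A \<union> ?R N"] mem[OF a(2,1)] O_disj O_cover
      \<open>open O1\<close> opens by (auto simp: O1_def Un_assoc Int_Un_distrib)
  obtain C2 where C2: "C2 \<in> ?D" "\<not> connected_component (- ?P ` C2) 0 (?P (torus_pt n))"
    using sep[of 0 O1 "?P (torus_pt n)" "?R A \<union> ?R N"] mem[OF n(2,1)] O_disj O_cover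
      \<open>open O1\<close> opens by (auto simp: O1_def Un_assoc Int_Un_distrib)
  obtain C3 where C3: "C3 \<in> ?D"
    "\<not> connected_component (- ?P ` C3) (?P (torus_pt a)) (?P (torus_pt n))"
    using sep[of "?P (torus_pt a)" "?R A \<union> O1" "?P (torus_pt n)" "?R N"]
      mem[OF n(2,1)] mem[OF a(2,1)] O_disj O_cover \<open>open O1\<close> opens
    by (auto simp: Un_commute Int_Un_distrib2)
  have ess': "essential C1" "essential C2" "essential C3"
    using ess[OF C1(1) _ _ C1(2)] ess[OF C2(1) _ _ C2(2)] ess[OF C3(1) _ _ C3(2)]
    by (auto simp: Q_def)
  assume "card {C \<in> \<C>. essential C} = 2"
  then obtain X Y where XY: "{C \<in> \<C>. essential C} = {X, Y}" "X \<noteq> Y"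
    by (meson card_2_iff)
  have "diagonal_cycle \<in> {X, Y}" using XY(1) essential_diagonal diag by blast
  moreover have "C1 \<in> {X, Y}" "C2 \<in> {X, Y}" "C3 \<in> {X, Y}"
    using C1 C2 C3 ess' unfolding XY(1)[symmetric] by auto
  \<comment> \<open>The diagonal takes one of the two essential places, so the three cycles are one
    and the same curve.\<close>
  ultimately have eq: "C2 = C1" "C3 = C1" using C1(1) C2(1) C3(1) by auto
  have "C1 \<in> \<C>" using C1(1) by simp
  then have "u \<notin> ?P ` C1" if "u \<in> Q" for u
    using Q_avoid[OF that D_sub[OF C1(1)]] C_avoid by blast
  then show False
    using circle_complement_three_points[OF circ[OF C1(1)], of 0 "?P (torus_pt a)" "?P (torus_pt n)"]
      C1(2) C2(2) C3(2) eq by (auto simp: Q_def)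
qed

subsection \<open>Superlevel sets near regular points\<close>

text \<open>Monotonicity is demanded for all pairs in a ball instead of through a derivative at
  \<open>p\<close>, so that it applies uniformly to the points near \<open>p\<close>.\<close>

definition increasing_along :: "('a::real_normed_vector \<Rightarrow> real) \<Rightarrow> 'a \<Rightarrow> 'a \<Rightarrow> bool" where
  "increasing_along f v p \<longleftrightarrow>
     (\<exists>R>0. \<forall>q\<in>ball p R. \<forall>t>0. q + t *\<^sub>R v \<in> ball p R \<longrightarrow> f q < f (q + t *\<^sub>R v))"

definition regular_nonneg :: "('a::real_normed_vector \<Rightarrow> real) \<Rightarrow> 'a \<Rightarrow> bool" where
  "regular_nonneg f p \<longleftrightarrow> 0 < f p \<or> f p = 0 \<and> (\<exists>v. norm v = 1 \<and> increasing_along f v p)"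

text \<open>Near a regular point the positive side is a single local piece; \<open>borders\<close>
  records which global component owns it.\<close>

definition borders :: "('a::real_normed_vector \<Rightarrow> real) \<Rightarrow> 'a set \<Rightarrow> 'a \<Rightarrow> bool" where
  "borders f W p \<longleftrightarrow> (\<forall>\<^sub>F q in nhds p. 0 < f q \<longrightarrow> q \<in> W)"

lemma bordersI:
  assumes "0 < e" "\<And>q. q \<in> ball p e \<Longrightarrow> 0 < f q \<Longrightarrow> q \<in> W"
  shows "borders f W p"
  unfolding borders_def eventually_nhds_metric using assms by (metis dist_commute mem_ball)

lemma increasing_along_pos:
  assumes "increasing_along f v p" "norm v = 1" "f p = 0" "0 < \<epsilon>"
  shows "\<exists>q\<in>ball p \<epsilon>. 0 < f q"
proof -
  obtain R where R: "0 < R" "\<And>q t. q \<in> ball p R \<Longrightarrow> 0 < t \<Longrightarrow> q + t *\<^sub>R v \<in> ball p R \<Longrightarrow>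
      f q < f (q + t *\<^sub>R v)"
    using assms(1) unfolding increasing_along_def by metis
  define t where "t = min R \<epsilon> / 2"
  have t: "0 < t" "t < R" "t < \<epsilon>" using R(1) assms(4) by (auto simp: t_def)
  then have "f p < f (p + t *\<^sub>R v)" using R assms(2) by (intro R(2)) (auto simp: dist_norm)
  then show ?thesis using t assms(2,3) by (intro bexI[of _ "p + t *\<^sub>R v"]) (auto simp: dist_norm)
qed

lemma regular_nonneg_pos:
  assumes "regular_nonneg f p" "0 < \<epsilon>"
  shows "\<exists>q\<in>ball p \<epsilon>. 0 < f q"
  using assms increasing_along_pos[of f _ p \<epsilon>] unfolding regular_nonneg_def
  by (metis centre_in_ball)

text \<open>Push all positive points near \<open>p\<close> by the same vector
  \<open>r *\<^sub>R v\<close>. They stay positive on the way and arrive in a ball around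
  \<open>w\<close> on which \<open>f\<close> is positive, so they all belong to the component of
  \<open>w\<close>.\<close>

lemma regular_nonneg_borders:
  assumes cont: "continuous_on UNIV f" and reg: "regular_nonneg f p"
  shows "\<exists>w. borders f (connected_component_set {q. 0 < f q} w) p"
proof -
  have op: "open {q. 0 < f q}" using cont by (simp add: open_Collect_less)
  show ?thesis
  proof (cases "0 < f p")
    case True
    then obtain e where e: "0 < e" "ball p e \<subseteq> {q. 0 < f q}"
      using op by (auto simp: open_contains_ball)
    have "ball p e \<subseteq> connected_component_set {q. 0 < f q} p"
      using e by (intro connected_component_maximal) auto
    then have "borders f (connected_component_set {q. 0 < f q} p) p"
      using e(1) by (intro bordersI[of e]) blast+
    then show ?thesis by blast
  next
    case False
    then obtain v where v: "norm v = 1" "increasing_along f v p" "f p = 0"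
      using reg by (auto simp: regular_nonneg_def)
    obtain R where R: "0 < R" "\<And>q t. q \<in> ball p R \<Longrightarrow> 0 < t \<Longrightarrow> q + t *\<^sub>R v \<in> ball p R \<Longrightarrow>
        f q < f (q + t *\<^sub>R v)"
      using v(2) unfolding increasing_along_def by metis
    \<comment> \<open>Half of \<open>R\<close>, so that a point within \<open>r\<close> of
      \<open>p\<close> may be moved by \<open>r\<close> without leaving the ball.\<close>
    define r where "r = R / 2"
    define w where "w = p + r *\<^sub>R v"
    have "f p < f w" unfolding w_def using R(1) v(1)
      by (intro R(2)) (auto simp: r_def dist_norm)
    then obtain e where e: "0 < e" "ball w e \<subseteq> {q. 0 < f q}"
      using op v(3) by (auto simp: open_contains_ball)
    define \<rho> where "\<rho> = min e r"
    have \<rho>: "0 < \<rho>" "\<rho> \<le> e" "\<rho> \<le> r" using e R by (auto simp: \<rho>_def r_def)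
    have "connected_component {q. 0 < f q} w q" if q: "q \<in> ball p \<rho>" "0 < f q" for q
    proof -
      have *: "q + t *\<^sub>R v \<in> ball p R" if "0 \<le> t" "t \<le> r" for t
      proof -
        have "norm (q - p + t *\<^sub>R v) \<le> norm (q - p) + norm (t *\<^sub>R v)" by (rule norm_triangle_ineq)
        also have "\<dots> < \<rho> + r" using q(1) that v(1) by (simp add: dist_norm norm_minus_commute)
        finally have "norm (q + t *\<^sub>R v - p) < R" using \<rho>(3) by (simp add: r_def algebra_simps)
        then show ?thesis by (simp add: dist_norm norm_minus_commute)
      qed
      have pos: "0 < f (q + t *\<^sub>R v)" if "0 \<le> t" "t \<le> r" for t
      proof (cases "t = 0")
        case False
        have "q \<in> ball p R" using *[of 0] R(1) by (simp add: r_def)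
        then have "f q < f (q + t *\<^sub>R v)" using False that *[OF that] by (intro R(2)) auto
        then show ?thesis using q(2) by simp
      qed (use q(2) in simp)
      have "closed_segment q (q + r *\<^sub>R v) \<subseteq> {q. 0 < f q}"
      proof
        fix x assume "x \<in> closed_segment q (q + r *\<^sub>R v)"
        then obtain s where s: "0 \<le> s" "s \<le> 1" "x = (1 - s) *\<^sub>R q + s *\<^sub>R (q + r *\<^sub>R v)"
          unfolding closed_segment_def by auto
        have "x = q + (s * r) *\<^sub>R v" by (simp add: s(3) algebra_simps)
        moreover have "s * r \<le> r" using s R(1) by (simp add: r_def mult_left_le_one_le)
        ultimately show "x \<in> {q. 0 < f q}" using pos[of "s * r"] s R(1) by (auto simp: r_def)
      qed
      then have "connected_component {q. 0 < f q} q (q + r *\<^sub>R v)"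
        unfolding connected_component_def
        by (intro exI[of _ "closed_segment q (q + r *\<^sub>R v)"]) auto
      moreover have "q + r *\<^sub>R v \<in> ball w e"
        using q(1) \<rho>(2) by (auto simp: w_def dist_norm)
      then have "connected_component {q. 0 < f q} (q + r *\<^sub>R v) w"
        unfolding connected_component_def using e by (intro exI[of _ "ball w e"]) auto
      ultimately show ?thesis by (meson connected_component_sym connected_component_trans)
    qed
    then have "borders f (connected_component_set {q. 0 < f q} w) p"
      using \<rho>(1) by (intro bordersI[of \<rho>]) auto
    then show ?thesis by blast
  qed
qed

text \<open>Any two components bordering a common regular point coincide, hence bordering a fixed
  component is a locally constant property of regular points.\<close>

lemma borders_eventually_iff:
  assumes cont: "continuous_on UNIV f" and reg: "regular_nonneg f p"
    and W: "W = connected_component_set {q. 0 < f q} w0"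
  shows "\<forall>\<^sub>F q in nhds p. regular_nonneg f q \<longrightarrow> (borders f W q \<longleftrightarrow> borders f W p)"
proof -
  obtain w where w: "borders f (connected_component_set {q. 0 < f q} w) p" (is "borders f ?V p")
    using regular_nonneg_borders[OF cont reg] by blast
  have eq: "V1 = V2"
    if V: "regular_nonneg f q" "borders f V1 q" "borders f V2 q"
      "V1 = connected_component_set {q. 0 < f q} u1" "V2 = connected_component_set {q. 0 < f q} u2"
    for q V1 V2 u1 u2
  proof -
    have "\<forall>\<^sub>F z in nhds q. 0 < f z \<longrightarrow> z \<in> V1 \<inter> V2"
      using V(2,3) unfolding borders_def by eventually_elim auto
    then obtain e where e: "0 < e" "\<And>z. dist z q < e \<Longrightarrow> 0 < f z \<Longrightarrow> z \<in> V1 \<inter> V2"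
      unfolding eventually_nhds_metric by blast
    obtain z where "z \<in> ball q e" "0 < f z" using regular_nonneg_pos[OF V(1) e(1)] by blast
    then have "z \<in> V1 \<inter> V2" using e(2) by (simp add: dist_commute)
    then have "z \<in> connected_component_set {q. 0 < f q} u1"
      "z \<in> connected_component_set {q. 0 < f q} u2" by (simp_all only: V(4,5) Int_iff)
    from this[THEN connected_component_eq] show ?thesis unfolding V(4,5) by simp
  qed
  have "\<forall>\<^sub>F q in nhds p. borders f ?V q"
    using w unfolding borders_def by (simp add: eventually_eventually)
  then show ?thesis
  proof eventually_elim
    case (elim q)
    then show ?case using eq[of q W ?V] eq[OF reg, of W ?V] w W by metis
  qed
qed

lemma borders_connected:
  assumes cont: "continuous_on UNIV f" and W: "W = connected_component_set {q. 0 < f q} w"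
    and K: "connected K" "\<And>p. p \<in> K \<Longrightarrow> regular_nonneg f p" "p \<in> K" "q \<in> K"
    and p: "borders f W p"
  shows "borders f W q"
proof (rule connected_induction_simple[of K p q "borders f W"])
  show "\<exists>T. openin (top_of_set K) T \<and> a \<in> T \<and> (\<forall>x\<in>T. \<forall>y\<in>T. borders f W x \<longrightarrow> borders f W y)"
    if a: "a \<in> K" for a
  proof -
    obtain S where S: "open S" "a \<in> S"
      "\<And>x. x \<in> S \<Longrightarrow> regular_nonneg f x \<Longrightarrow> borders f W x \<longleftrightarrow> borders f W a"
      using borders_eventually_iff[OF cont K(2)[OF a] W] unfolding eventually_nhds by blast
    show ?thesis
    proof (intro exI conjI ballI impI)
      show "openin (top_of_set K) (K \<inter> S)" using S(1) by (rule openin_open_Int)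
      show "a \<in> K \<inter> S" using a S(2) by simp
      show "borders f W y" if "x \<in> K \<inter> S" "y \<in> K \<inter> S" "borders f W x" for x y
        using that S(3)[of x] S(3)[of y] K(2)[of x] K(2)[of y] by simp
    qed
  qed
qed (use K p in auto)

subsection \<open>Zero sets as local graphs\<close>

text \<open>The implicit function theorem with strict monotonicity in the second variable in place
  of a nonzero derivative. It serves stable branches as stated and pivots with the two coordinates
  exchanged.\<close>

lemma local_graph:
  fixes F :: "real \<Rightarrow> real \<Rightarrow> real"
  assumes cont: "continuous_on UNIV (\<lambda>p. F (fst p) (snd p))"
    and r: "0 < r" "\<And>x y y'. x \<in> ball a r \<Longrightarrow> y \<in> ball b r \<Longrightarrow> y' \<in> ball b r \<Longrightarrow> y < y' \<Longrightarrow> F x y < F x y'"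
    and zero: "F a b = 0"
  obtains \<delta> h where "0 < \<delta>" "\<delta> \<le> r" "continuous_on (ball a \<delta>) h" "h a = b"
    "\<And>x. x \<in> ball a \<delta> \<Longrightarrow> h x \<in> ball b r \<and> F x (h x) = 0"
    "\<And>x y. x \<in> ball a \<delta> \<Longrightarrow> y \<in> ball b r \<Longrightarrow> F x y = 0 \<Longrightarrow> y = h x"
proof -
  have cx: "isCont (\<lambda>x. F x y) x0" and cy: "isCont (\<lambda>y. F x0 y) y" for x0 y
    using cont continuous_on_compose2[OF cont, of UNIV "\<lambda>x. (x, y)"]
      continuous_on_compose2[OF cont, of UNIV "\<lambda>y. (x0, y)"]
    by (auto simp: continuous_on_eq_continuous_at intro!: continuous_intros)
  have stay: "\<forall>\<^sub>F x in nhds x0. F x (y - e) < 0 \<and> 0 < F x (y + e)"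
    if "F x0 (y - e) < 0" "0 < F x0 (y + e)" for x0 y e
  proof -
    have "((\<lambda>x. F x (y - e)) \<longlongrightarrow> F x0 (y - e)) (nhds x0)" "((\<lambda>x. F x (y + e)) \<longlongrightarrow> F x0 (y + e)) (nhds x0)"
      using cx by (auto simp: isCont_def tendsto_nhds_iff)
    then show ?thesis using that by (intro eventually_conj) (auto elim: order_tendstoD)
  qed
  have uniq: "y = y'" if "x \<in> ball a r" "y \<in> ball b r" "y' \<in> ball b r" "F x y = 0" "F x y' = 0" for x y y'
    using r(2)[of x y y'] r(2)[of x y' y] that by (cases y y' rule: linorder_cases) auto
  define e where "e = r / 2"
  have e: "0 < e" "e < r" using r(1) by (auto simp: e_def)
  have mem: "a \<in> ball a r" "b \<in> ball b r" "b - e \<in> ball b r" "b + e \<in> ball b r"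
    using e by (auto simp: dist_real_def)
  have "F a (b - e) < 0" "0 < F a (b + e)"
    using r(2)[OF mem(1,3,2)] r(2)[OF mem(1,2,4)] zero e by auto
  then obtain d where d: "0 < d" "\<And>x. dist x a < d \<Longrightarrow> F x (b - e) < 0 \<and> 0 < F x (b + e)"
    using stay unfolding eventually_nhds_metric by metis
  define \<delta> where "\<delta> = min d r"
  have \<delta>: "0 < \<delta>" "\<delta> \<le> r" "\<delta> \<le> d" using d r by (auto simp: \<delta>_def)
  have ex: "\<exists>y. y \<in> ball b r \<and> F x y = 0" if "x \<in> ball a \<delta>" for x
  proof -
    have "F x (b - e) < 0" "0 < F x (b + e)" using d(2)[of x] that \<delta> by (auto simp: dist_commute)
    then have "\<exists>y\<ge>b - e. y \<le> b + e \<and> F x y = 0"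
      using cy e by (intro IVT) auto
    then obtain y where "b - e \<le> y" "y \<le> b + e" "F x y = 0" by blast
    then show ?thesis using e by (intro exI[of _ y]) (auto simp: dist_real_def)
  qed
  define h where "h x = (SOME y. y \<in> ball b r \<and> F x y = 0)" for x
  have h: "h x \<in> ball b r \<and> F x (h x) = 0" if "x \<in> ball a \<delta>" for x
    unfolding h_def using someI_ex[OF ex[OF that]] .
  have sub: "ball a \<delta> \<subseteq> ball a r" using \<delta> by auto
  have cont_h: "continuous_on (ball a \<delta>) h"
    unfolding continuous_on_iff
  proof (intro ballI allI impI)
    fix x0 \<epsilon> :: real assume x0: "x0 \<in> ball a \<delta>" and \<epsilon>: "0 < \<epsilon>"
    define y0 where "y0 = h x0"
    have y0: "y0 \<in> ball b r" "F x0 y0 = 0" using h[OF x0] by (auto simp: y0_def)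
    define \<eta> where "\<eta> = min (\<epsilon> / 2) ((r - dist b y0) / 2)"
    have \<eta>: "0 < \<eta>" "\<eta> < \<epsilon>" "\<eta> < r - dist b y0"
      using \<epsilon> y0 by (auto simp: \<eta>_def min_def field_simps)
    have in_b: "y0 - \<eta> \<in> ball b r" "y0 + \<eta> \<in> ball b r"
      using \<eta> by (auto simp: dist_real_def)
    have "F x0 (y0 - \<eta>) < 0" "0 < F x0 (y0 + \<eta>)"
      using r(2)[of x0 "y0 - \<eta>" y0] r(2)[of x0 y0 "y0 + \<eta>"] y0 in_b x0 sub \<eta> by auto
    then obtain d' where d': "0 < d'"
      "\<And>x. dist x x0 < d' \<Longrightarrow> F x (y0 - \<eta>) < 0 \<and> 0 < F x (y0 + \<eta>)"
      using stay unfolding eventually_nhds_metric by metis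
    show "\<exists>d>0. \<forall>x'\<in>ball a \<delta>. dist x' x0 < d \<longrightarrow> dist (h x') (h x0) < \<epsilon>"
    proof (intro exI[of _ d'] conjI ballI impI d'(1))
      fix x assume x: "x \<in> ball a \<delta>" "dist x x0 < d'"
      have s: "F x (y0 - \<eta>) < 0" "0 < F x (y0 + \<eta>)" using d'(2)[OF x(2)] by auto
      have "y0 - \<eta> < h x"
      proof (rule ccontr)
        assume "\<not> y0 - \<eta> < h x"
        then have "F x (h x) \<le> F x (y0 - \<eta>)"
          using r(2)[of x "h x" "y0 - \<eta>"] h[OF x(1)] in_b x(1) sub
          by (cases "h x = y0 - \<eta>") auto
        then show False using s h[OF x(1)] by simp
      qed
      moreover have "h x < y0 + \<eta>"
      proof (rule ccontr)
        assume "\<not> h x < y0 + \<eta>"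
        then have "F x (y0 + \<eta>) \<le> F x (h x)"
          using r(2)[of x "y0 + \<eta>" "h x"] h[OF x(1)] in_b x(1) sub
          by (cases "h x = y0 + \<eta>") auto
        then show False using s h[OF x(1)] by simp
      qed
      ultimately show "dist (h x) (h x0) < \<epsilon>"
        using \<eta>(2) by (auto simp: dist_real_def y0_def[symmetric])
    qed
  qed
  have ha: "h a = b" using uniq[of a "h a" b] h[of a] \<delta>(1) mem zero by auto
  have uq: "y = h x" if "x \<in> ball a \<delta>" "y \<in> ball b r" "F x y = 0" for x y
    using uniq[of x y "h x"] that h[OF that(1)] sub by blast
  show thesis by (rule that[OF \<delta>(1,2) cont_h ha h uq])
qed

subsection \<open>The first stable zero\<close>

text \<open>Take the infimum \<open>z\<close> of the positive points after \<open>a\<close>. To its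
  left \<open>f\<close> is nonpositive, and to its right \<open>f\<close> is positive arbitrarily
  close to \<open>z\<close>; of the three kinds of zero this leaves only \<open>S\<close>. The
  condition at \<open>b\<close> guarantees that there are positive points and bounds
  \<open>z\<close>.\<close>

lemma first_stable_zero:
  fixes f :: "real \<Rightarrow> real"
  assumes cont: "continuous_on UNIV f"
    and zero: "\<And>z. f z = 0 \<Longrightarrow>
      S z \<or> (\<forall>\<^sub>F t in at_right z. f t < 0) \<or> (\<forall>\<^sub>F t in at_left z. 0 < f t)"
    and start: "\<forall>\<^sub>F t in at_right a. f t < 0"
    and stop: "a < b" "\<forall>\<^sub>F t in at_right b. 0 < f t"
  obtains z where "a < z" "z \<le> b" "f z = 0" "S z" "\<And>t. a < t \<Longrightarrow> t \<le> z \<Longrightarrow> f t \<le> 0"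
proof -
  define E where "E = {t. a < t \<and> 0 < f t}"
  have lim: "(f \<longlongrightarrow> f t) (nhds t)" for t
    using cont by (simp add: continuous_on_eq_continuous_at isCont_def tendsto_nhds_iff)
  obtain c where c: "a < c" "\<And>t. a < t \<Longrightarrow> t < c \<Longrightarrow> f t < 0"
    using start unfolding eventually_at_right_field by blast
  obtain d where d: "b < d" "\<And>t. b < t \<Longrightarrow> t < d \<Longrightarrow> 0 < f t"
    using stop(2) unfolding eventually_at_right_field by blast
  have Eb: "t \<in> E" if "b < t" "t < d" for t using d(2) that stop(1) by (auto simp: E_def)
  have ne: "E \<noteq> {}" using Eb[of "(b + d) / 2"] d(1) by auto
  have lower: "c \<le> t" if "t \<in> E" for t using that c(2)[of t] by (force simp: E_def)
  have bdd: "bdd_below E" by (rule bdd_belowI[of _ c]) (rule lower)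
  define z where "z = Inf E"
  have cz: "c \<le> z" unfolding z_def using ne lower by (intro cInf_greatest)
  have zb: "z \<le> b"
  proof (rule ccontr)
    assume "\<not> z \<le> b"
    then have "(b + min z d) / 2 \<in> E" "(b + min z d) / 2 < z" using d(1) by (auto intro!: Eb)
    then show False using cInf_lower[OF _ bdd, of "(b + min z d) / 2"] by (simp add: z_def)
  qed
  have neg: "f t \<le> 0" if "a < t" "t < z" for t
  proof (rule ccontr)
    assume "\<not> f t \<le> 0"
    then have "t \<in> E" using that by (simp add: E_def)
    then show False using cInf_lower[OF _ bdd, of t] that by (simp add: z_def)
  qed
  have approx: "\<exists>t\<in>E. t < u" if "z < u" for u
    using cInf_lessD[OF ne] that unfolding z_def by blast
  have "f z \<le> 0"
  proof (rule ccontr)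
    assume "\<not> f z \<le> 0"
    then have "\<forall>\<^sub>F t in nhds z. 0 < f t" using order_tendstoD(1)[OF lim] by simp
    then have "\<forall>\<^sub>F t in at_left z. 0 < f t" 
      unfolding eventually_at_filter by eventually_elim simp
    then obtain l where l: "l < z" "\<And>t. l < t \<Longrightarrow> t < z \<Longrightarrow> 0 < f t"
      unfolding eventually_at_left_field by blast
    define t where "t = (max a l + z) / 2"
    have "l < t" "a < t" "t < z" using l(1) cz c(1) by (auto simp: t_def)
    then show False using l(2)[of t] neg[of t] by simp
  qed
  moreover have no_neg: "\<not> (\<forall>\<^sub>F t in at_right z. f t < 0)" if "f z \<le> 0"
  proof
    assume "\<forall>\<^sub>F t in at_right z. f t < 0"
    then obtain u where u: "z < u" "\<And>t. z < t \<Longrightarrow> t < u \<Longrightarrow> f t < 0"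
      unfolding eventually_at_right_field by blast
    obtain t where t: "t \<in> E" "t < u" using approx u(1) by blast
    have "z \<le> t" unfolding z_def using cInf_lower[OF t(1) bdd] .
    then show False using t u(2)[of t] that by (cases "t = z") (auto simp: E_def)
  qed
  moreover have "\<not> f z < 0"
  proof
    assume "f z < 0"
    then have "\<forall>\<^sub>F t in nhds z. f t < 0" using order_tendstoD(2)[OF lim] by simp
    then have "\<forall>\<^sub>F t in at_right z. f t < 0" 
      unfolding eventually_at_filter by eventually_elim simp
    then show False using no_neg \<open>f z < 0\<close> by simp
  qed
  ultimately have z: "f z = 0" by simp
  have "\<not> (\<forall>\<^sub>F t in at_left z. 0 < f t)"
  proof
    assume "\<forall>\<^sub>F t in at_left z. 0 < f t"
    then obtain l where l: "l < z" "\<And>t. l < t \<Longrightarrow> t < z \<Longrightarrow> 0 < f t"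
      unfolding eventually_at_left_field by blast
    define t where "t = (max a l + z) / 2"
    have "l < t" "a < t" "t < z" using l(1) cz c(1) by (auto simp: t_def)
    then show False using l(2)[of t] neg[of t] by simp
  qed
  then have "S z" using zero[OF z] no_neg z by auto
  then show thesis using that[of z] cz c(1) zb z neg by force
qed

text \<open>The preceding lemma applied to \<open>\<lambda>t. - f (- t)\<close>.\<close>

lemma last_stable_zero:
  fixes f :: "real \<Rightarrow> real"
  assumes cont: "continuous_on UNIV f"
    and zero: "\<And>z. f z = 0 \<Longrightarrow>
      S z \<or> (\<forall>\<^sub>F t in at_right z. f t < 0) \<or> (\<forall>\<^sub>F t in at_left z. 0 < f t)"
    and start: "\<forall>\<^sub>F t in at_left a. 0 < f t"
    and stop: "b < a" "\<forall>\<^sub>F t in at_left b. f t < 0"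
  obtains z where "z < a" "b \<le> z" "f z = 0" "S z" "\<And>t. t < a \<Longrightarrow> z \<le> t \<Longrightarrow> 0 \<le> f t"
proof -
  have flip: "(\<forall>\<^sub>F t in at_right (- u). P (- t)) \<longleftrightarrow> (\<forall>\<^sub>F t in at_left u. P t)"
    "(\<forall>\<^sub>F t in at_left (- u). P (- t)) \<longleftrightarrow> (\<forall>\<^sub>F t in at_right u. P t)" for u :: real and P
    by (simp_all add: at_left_minus[of u] at_right_minus[of u] eventually_filtermap)
  obtain z where z: "- a < z" "z \<le> - b" "- f (- z) = 0" "S (- z)"
    "\<And>t. - a < t \<Longrightarrow> t \<le> z \<Longrightarrow> - f (- t) \<le> 0"
  proof (rule first_stable_zero[of "\<lambda>t. - f (- t)" "\<lambda>z. S (- z)" "- a" "- b"])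
    show "continuous_on UNIV (\<lambda>t. - f (- t))"
      by (intro continuous_intros continuous_on_compose2[OF cont]) auto
    show "S (- z) \<or> (\<forall>\<^sub>F t in at_right z. - f (- t) < 0) \<or> (\<forall>\<^sub>F t in at_left z. 0 < - f (- t))"
      if "- f (- z) = 0" for z
      using zero[of "- z"] that flip(1)[where u="- z" and P="\<lambda>t. - f t < 0"]
        flip(2)[where u="- z" and P="\<lambda>t. 0 < - f t"] by auto
    show "\<forall>\<^sub>F t in at_right (- a). - f (- t) < 0" using start flip(1)[where u="a" and P="\<lambda>t. - f t < 0"] by simp
    show "\<forall>\<^sub>F t in at_right (- b). 0 < - f (- t)" using stop(2) flip(1)[where u="b" and P="\<lambda>t. 0 < - f t"] by simp
  qed (use stop(1) in auto)
  show thesis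
  proof (rule that[of "- z"])
    show "0 \<le> f t" if "t < a" "- z \<le> t" for t using z(5)[of "- t"] that by simp
  qed (use z in auto)
qed

lemma not_eventually_nhds_sequence:
  fixes a :: "'a::metric_space"
  assumes "\<not> eventually P (nhds a)"
  obtains f where "f \<longlonglongrightarrow> a" "\<And>n. \<not> P (f n)"
proof -
  have "\<exists>x. dist x a < inverse (real (Suc n)) \<and> \<not> P x" for n
    using assms unfolding eventually_nhds_metric by (metis inverse_positive_iff_positive of_nat_0_less_iff zero_less_Suc)
  then obtain f where f: "\<And>n. dist (f n) a < inverse (real (Suc n))" "\<And>n. \<not> P (f n)" by metis
  have "(\<lambda>n. dist (f n) a) \<longlonglongrightarrow> 0"
    by (rule tendsto_sandwich[OF _ _ tendsto_const LIMSEQ_inverse_real_of_nat])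
       (use f(1) in \<open>auto intro!: always_eventually less_imp_le\<close>)
  then have "f \<longlonglongrightarrow> a" by (rule tendsto_dist_iff[THEN iffD2])
  then show thesis using that f(2) by blast
qed

lemma open_if_eventually_mem:
  assumes "\<And>p. p \<in> S \<Longrightarrow> \<forall>\<^sub>F q in nhds p. q \<in> S"
  shows "open S"
proof (subst open_subopen, intro ballI)
  fix p assume "p \<in> S"
  then obtain T where "open T" "p \<in> T" "\<forall>q\<in>T. q \<in> S"
    using assms unfolding eventually_nhds by blast
  then show "\<exists>T. open T \<and> p \<in> T \<and> T \<subseteq> S" by (intro exI[of _ T]) auto
qed

subsection \<open>The centre of curvature\<close>

text \<open>Here \<open>a\<close>, \<open>b\<close>, \<open>d\<close> are the derivatives of the
  track at the puppy and \<open>w\<close> is the vector from human to puppy; the hypotheses say that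
  the first two \<open>y\<close>-derivatives of the squared distance vanish. Then the curvature is
  nonzero, the human stands at the centre of curvature, and the velocity of the evolute is normal to
  the track with a factor proportional to the third derivative. So a pivot never sees a
  cusp.\<close>

lemma evolute_algebra:
  fixes a b d w :: complex
  assumes a: "a \<noteq> 0" and wa: "w \<bullet> a = 0" and wb: "a \<bullet> a + w \<bullet> b = 0"
  defines "c \<equiv> cross2 a b"
  shows "c \<noteq> 0"
    and "w = - ((a \<bullet> a / c) *\<^sub>R (\<i> * a))"
    and "a + (a \<bullet> a / c) *\<^sub>R (\<i> * b) +
           ((2 * (a \<bullet> b) * c - (a \<bullet> a) * cross2 a d) / c\<^sup>2) *\<^sub>R (\<i> * a) =
         ((3 * (a \<bullet> b) + w \<bullet> d) / c) *\<^sub>R (\<i> * a)"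
proof -
  have aa: "a \<bullet> a \<noteq> 0" using a by simp
  have decomp: "z = (z \<bullet> a / (a \<bullet> a)) *\<^sub>R a + (z \<bullet> (\<i> * a) / (a \<bullet> a)) *\<^sub>R (\<i> * a)" for z
  proof -
    have "(a \<bullet> a) *\<^sub>R z = (z \<bullet> a) *\<^sub>R a + (z \<bullet> (\<i> * a)) *\<^sub>R (\<i> * a)"
      by (simp add: complex_eq_iff inner_complex_def algebra_simps)
    then have "inverse (a \<bullet> a) *\<^sub>R ((a \<bullet> a) *\<^sub>R z) =
        inverse (a \<bullet> a) *\<^sub>R ((z \<bullet> a) *\<^sub>R a + (z \<bullet> (\<i> * a)) *\<^sub>R (\<i> * a))" by simp
    then show ?thesis using aa by (simp add: scaleR_add_right divide_inverse mult.commute)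
  qed
  have ip1: "(\<i> * a) \<bullet> z = cross2 a z" for z
    by (simp add: inner_complex_def cross2_def)
  have ip: "(\<i> * b) \<bullet> a = - c" "(\<i> * a) \<bullet> a = 0" "a \<bullet> (\<i> * a) = 0"
      "(\<i> * b) \<bullet> (\<i> * a) = a \<bullet> b" "(\<i> * a) \<bullet> (\<i> * a) = a \<bullet> a"
    by (simp_all add: inner_complex_def cross2_def c_def)
  define s where "s = w \<bullet> (\<i> * a) / (a \<bullet> a)"
  have w: "w = s *\<^sub>R (\<i> * a)" using decomp[of w] wa by (simp add: s_def)
  have wz: "w \<bullet> z = s * cross2 a z" for z
    by (subst w) (simp only: inner_scaleR_left ip1)
  have sc: "s * c = - (a \<bullet> a)" using wb wz[of b] by (simp add: c_def)
  then show c: "c \<noteq> 0" using aa by auto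
  have s: "s = - (a \<bullet> a / c)" using sc c by (simp add: field_simps)
  show "w = - ((a \<bullet> a / c) *\<^sub>R (\<i> * a))" using w s by simp
  define E where "E = a + (a \<bullet> a / c) *\<^sub>R (\<i> * b) +
      ((2 * (a \<bullet> b) * c - (a \<bullet> a) * cross2 a d) / c\<^sup>2) *\<^sub>R (\<i> * a)"
  have "E \<bullet> a = 0" using c by (simp only: E_def inner_add_left inner_scaleR_left ip) simp
  moreover have "E \<bullet> (\<i> * a) / (a \<bullet> a) = (3 * (a \<bullet> b) + w \<bullet> d) / c"
    using c aa by (simp only: E_def inner_add_left inner_scaleR_left ip wz s)
      (simp add: field_simps power2_eq_square)
  ultimately show "a + (a \<bullet> a / c) *\<^sub>R (\<i> * b) +
           ((2 * (a \<bullet> b) * c - (a \<bullet> a) * cross2 a d) / c\<^sup>2) *\<^sub>R (\<i> * a) =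
         ((3 * (a \<bullet> b) + w \<bullet> d) / c) *\<^sub>R (\<i> * a)"
    using decomp[of E] unfolding E_def[symmetric] by simp
qed

subsection \<open>Signs near a zero\<close>

lemma sign_at_simple_zero:
  fixes f :: "real \<Rightarrow> real"
  assumes "(f has_real_derivative l) (at z)" "f z = 0" "0 < l"
  shows "\<forall>\<^sub>F t in at_right z. 0 < f t" "\<forall>\<^sub>F t in at_left z. f t < 0"
proof -
  obtain d where d: "0 < d" "\<And>h. 0 < h \<Longrightarrow> h < d \<Longrightarrow> f z < f (z + h)"
    using DERIV_pos_inc_right[OF assms(1,3)] by blast
  have "0 < f t" if "z < t" "t < z + d" for t
    using d(2)[of "t - z"] that assms(2) by simp
  then show "\<forall>\<^sub>F t in at_right z. 0 < f t"
    unfolding eventually_at_right_field using d(1) by (intro exI[of _ "z + d"]) simp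
  obtain e where e: "0 < e" "\<And>h. 0 < h \<Longrightarrow> h < e \<Longrightarrow> f (z - h) < f z"
    using DERIV_pos_inc_left[OF assms(1,3)] by blast
  have "f t < 0" if "z - e < t" "t < z" for t
    using e(2)[of "z - t"] that assms(2) by simp
  then show "\<forall>\<^sub>F t in at_left z. f t < 0"
    unfolding eventually_at_left_field using e(1) by (intro exI[of _ "z - e"]) simp
qed

text \<open>The derivative passes from negative to positive, so \<open>z\<close> is a strict local
  minimum: at a pivot \<open>F\<close> touches zero without crossing it.\<close>

lemma sign_at_double_zero:
  fixes f :: "real \<Rightarrow> real"
  assumes f: "\<And>t. (f has_real_derivative f' t) (at t)" "f z = 0"
    and f': "(f' has_real_derivative l) (at z)" "f' z = 0" "0 < l"
  shows "\<forall>\<^sub>F t in at_right z. 0 < f t" "\<forall>\<^sub>F t in at_left z. 0 < f t"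
proof -
  obtain d where d: "z < d" "\<And>t. z < t \<Longrightarrow> t < d \<Longrightarrow> 0 < f' t"
    using sign_at_simple_zero(1)[OF f'] unfolding eventually_at_right_field by blast
  have cont: "continuous_on A f" for A
    using DERIV_isCont[OF f(1)] by (simp add: continuous_at_imp_continuous_on)
  have "f z < f t" if "z < t" "t < d" for t
  proof (rule DERIV_pos_imp_increasing_open[OF that(1) _ cont])
    show "\<exists>l. (f has_real_derivative l) (at s) \<and> 0 < l" if "z < s" "s < t" for s
      using f(1)[of s] d(2)[of s] that \<open>t < d\<close> by auto
  qed
  then show "\<forall>\<^sub>F t in at_right z. 0 < f t"
    unfolding eventually_at_right_field using d(1) f(2) by auto
  obtain e where e: "e < z" "\<And>t. e < t \<Longrightarrow> t < z \<Longrightarrow> f' t < 0"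
    using sign_at_simple_zero(2)[OF f'] unfolding eventually_at_left_field by blast
  have "f z < f t" if "e < t" "t < z" for t
  proof (rule DERIV_neg_imp_decreasing_open[OF that(2) _ cont])
    show "\<exists>l. (f has_real_derivative l) (at s) \<and> l < 0" if "t < s" "s < z" for s
      using f(1)[of s] e(2)[of s] that \<open>e < t\<close> by auto
  qed
  then show "\<forall>\<^sub>F t in at_left z. 0 < f t"
    unfolding eventually_at_left_field using e(1) f(2) by auto
qed

subsection \<open>Critical configurations\<close>

locale generic_track =
  fixes \<gamma> g1 g2 g3 :: "real \<Rightarrow> complex"
  assumes g1: "\<And>t. (\<gamma> has_vector_derivative g1 t) (at t)"
    and g2: "\<And>t. (g1 has_vector_derivative g2 t) (at t)"
    and g3: "\<And>t. (g2 has_vector_derivative g3 t) (at t)"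
    and periodic: "\<And>t. \<gamma> (t + 1) = \<gamma> t"
    and g1_nz: "\<And>t. g1 t \<noteq> 0"
    and generic: "generic \<gamma>"
begin

definition F :: "real \<Rightarrow> real \<Rightarrow> real" where
  "F x y = 2 * ((\<gamma> y - \<gamma> x) \<bullet> g1 y)"

definition Fx :: "real \<Rightarrow> real \<Rightarrow> real" where
  "Fx x y = - 2 * (g1 x \<bullet> g1 y)"

definition Fy :: "real \<Rightarrow> real \<Rightarrow> real" where
  "Fy x y = 2 * (g1 y \<bullet> g1 y + (\<gamma> y - \<gamma> x) \<bullet> g2 y)"

definition Fyy :: "real \<Rightarrow> real \<Rightarrow> real" where
  "Fyy x y = 2 * (3 * (g1 y \<bullet> g2 y) + (\<gamma> y - \<gamma> x) \<bullet> g3 y)"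

lemma continuous_on_curve [continuous_intros]:
  assumes "continuous_on S f"
  shows "continuous_on S (\<lambda>x. \<gamma> (f x))" "continuous_on S (\<lambda>x. g1 (f x))"
    "continuous_on S (\<lambda>x. g2 (f x))"
proof -
  have "continuous_on UNIV \<gamma>" "continuous_on UNIV g1" "continuous_on UNIV g2"
    by (auto intro!: continuous_at_imp_continuous_on has_vector_derivative_continuous g1 g2 g3)
  then show "continuous_on S (\<lambda>x. \<gamma> (f x))" "continuous_on S (\<lambda>x. g1 (f x))"
    "continuous_on S (\<lambda>x. g2 (f x))"
    by (auto intro: continuous_on_compose2[OF _ assms])
qed

lemma deriv_F: "((\<lambda>t. F x t) has_real_derivative Fy x y) (at y)"
proof -
  have "((\<lambda>t. (\<gamma> t - \<gamma> x) \<bullet> g1 t) has_vector_derivative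
      ((\<gamma> y - \<gamma> x) \<bullet> g2 y + g1 y \<bullet> g1 y)) (at y)"
    by (rule bounded_bilinear.has_vector_derivative[OF bounded_bilinear_inner _ g2])
       (auto intro!: derivative_eq_intros g1)
  from has_vector_derivative_mult_right[OF this, of 2] show ?thesis
    by (simp add: F_def[abs_def] Fy_def has_real_derivative_iff_has_vector_derivative add.commute)
qed

lemma deriv_F_x: "((\<lambda>t. F t y) has_real_derivative Fx x y) (at x)"
proof -
  have "((\<lambda>t. (\<gamma> y - \<gamma> t) \<bullet> g1 y) has_vector_derivative (- g1 x \<bullet> g1 y)) (at x)"
    by (rule bounded_linear.has_vector_derivative[OF bounded_linear_inner_left])
       (auto intro!: derivative_eq_intros g1)
  from has_vector_derivative_mult_right[OF this, of 2] show ?thesis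
    by (simp add: F_def[abs_def] Fx_def has_real_derivative_iff_has_vector_derivative)
qed

lemma deriv_Fy: "((\<lambda>t. Fy x t) has_real_derivative Fyy x y) (at y)"
proof -
  have "((\<lambda>t. (\<gamma> t - \<gamma> x) \<bullet> g2 t) has_vector_derivative
      ((\<gamma> y - \<gamma> x) \<bullet> g3 y + g1 y \<bullet> g2 y)) (at y)"
    by (rule bounded_bilinear.has_vector_derivative[OF bounded_bilinear_inner _ g3])
       (auto intro!: derivative_eq_intros g1)
  moreover have "((\<lambda>t. g1 t \<bullet> g1 t) has_vector_derivative (g1 y \<bullet> g2 y + g2 y \<bullet> g1 y)) (at y)"
    by (rule bounded_bilinear.has_vector_derivative[OF bounded_bilinear_inner g2 g2])
  ultimately have "((\<lambda>t. g1 t \<bullet> g1 t + (\<gamma> t - \<gamma> x) \<bullet> g2 t) has_vector_derivative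
      (g1 y \<bullet> g2 y + g2 y \<bullet> g1 y) + ((\<gamma> y - \<gamma> x) \<bullet> g3 y + g1 y \<bullet> g2 y)) (at y)"
    by (intro has_vector_derivative_add)
  from has_vector_derivative_mult_right[OF this, of 2] show ?thesis
    by (simp add: Fy_def[abs_def] Fyy_def has_real_derivative_iff_has_vector_derivative
        inner_commute algebra_simps)
qed

lemma deriv_D2: "((\<lambda>t. (D \<gamma> x t)\<^sup>2) has_real_derivative F x y) (at y)"
proof -
  have *: "((\<lambda>t. \<gamma> t - \<gamma> x) has_vector_derivative g1 y) (at y)"
    by (auto intro!: derivative_eq_intros g1)
  have "((\<lambda>t. (\<gamma> t - \<gamma> x) \<bullet> (\<gamma> t - \<gamma> x)) has_vector_derivative
      ((\<gamma> y - \<gamma> x) \<bullet> g1 y + g1 y \<bullet> (\<gamma> y - \<gamma> x))) (at y)"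
    by (rule bounded_bilinear.has_vector_derivative[OF bounded_bilinear_inner * *])
  moreover have "(D \<gamma> x t)\<^sup>2 = (\<gamma> t - \<gamma> x) \<bullet> (\<gamma> t - \<gamma> x)" for t
    by (simp add: D_def norm_minus_commute power2_norm_eq_inner)
  ultimately show ?thesis
    by (simp add: F_def has_real_derivative_iff_has_vector_derivative inner_commute)
qed

lemma dyD2_eq: "dyD2 \<gamma> 1 x y = F x y" "dyD2 \<gamma> 2 x y = Fy x y" "dyD2 \<gamma> 3 x y = Fyy x y"
proof -
  have 1: "deriv (\<lambda>t. (D \<gamma> x t)\<^sup>2) = F x" using deriv_D2 by (auto intro: DERIV_imp_deriv)
  have 2: "deriv (F x) = Fy x" using deriv_F by (auto intro: DERIV_imp_deriv)
  have 3: "deriv (Fy x) = Fyy x" using deriv_Fy by (auto intro: DERIV_imp_deriv)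
  have n: "(deriv ^^ 1) f = deriv f" "(deriv ^^ 2) f = deriv (deriv f)"
    "(deriv ^^ 3) f = deriv (deriv (deriv f))" for f :: "real \<Rightarrow> real"
    by (simp_all add: numeral_2_eq_2 numeral_3_eq_3)
  show "dyD2 \<gamma> 1 x y = F x y" "dyD2 \<gamma> 2 x y = Fy x y" "dyD2 \<gamma> 3 x y = Fyy x y"
    by (simp_all only: dyD2_def n 1 2 3)
qed

lemma conf_iff:
  "critical \<gamma> (x, y) \<longleftrightarrow> F x y = 0"
  "stable_conf \<gamma> (x, y) \<longleftrightarrow> F x y = 0 \<and> 0 < Fy x y"
  "unstable_conf \<gamma> (x, y) \<longleftrightarrow> F x y = 0 \<and> Fy x y < 0"
  "forward_pivot_conf \<gamma> (x, y) \<longleftrightarrow> F x y = 0 \<and> Fy x y = 0 \<and> Fyy x y < 0"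
  "backward_pivot_conf \<gamma> (x, y) \<longleftrightarrow> F x y = 0 \<and> Fy x y = 0 \<and> 0 < Fyy x y"
  "pivot_conf \<gamma> (x, y) \<longleftrightarrow> F x y = 0 \<and> Fy x y = 0 \<and> Fyy x y \<noteq> 0"
  by (auto simp: critical_def stable_conf_def unstable_conf_def forward_pivot_conf_def
      backward_pivot_conf_def pivot_conf_def dyD2_eq[unfolded One_nat_def] dyD2_eq)

lemma critical_cases:
  assumes "F x y = 0"
  obtains "stable_conf \<gamma> (x, y)" | "unstable_conf \<gamma> (x, y)" | "forward_pivot_conf \<gamma> (x, y)"
    | "backward_pivot_conf \<gamma> (x, y)"
  using generic assms unfolding generic_def conf_iff(1)[symmetric] by blast

lemma signs_right:
  "stable_conf \<gamma> (x, y) \<Longrightarrow> \<forall>\<^sub>F t in at_right y. 0 < F x t"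
  "unstable_conf \<gamma> (x, y) \<Longrightarrow> \<forall>\<^sub>F t in at_right y. F x t < 0"
  "forward_pivot_conf \<gamma> (x, y) \<Longrightarrow> \<forall>\<^sub>F t in at_right y. F x t < 0"
  "backward_pivot_conf \<gamma> (x, y) \<Longrightarrow> \<forall>\<^sub>F t in at_right y. 0 < F x t"
  using sign_at_simple_zero(1)[OF deriv_F] sign_at_simple_zero(1)[OF DERIV_minus[OF deriv_F]]
    sign_at_double_zero(1)[OF deriv_F _ deriv_Fy]
    sign_at_double_zero(1)[OF DERIV_minus[OF deriv_F] _ DERIV_minus[OF deriv_Fy]]
  by (simp_all add: conf_iff)

lemma signs_left:
  "stable_conf \<gamma> (x, y) \<Longrightarrow> \<forall>\<^sub>F t in at_left y. F x t < 0"
  "unstable_conf \<gamma> (x, y) \<Longrightarrow> \<forall>\<^sub>F t in at_left y. 0 < F x t"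
  "forward_pivot_conf \<gamma> (x, y) \<Longrightarrow> \<forall>\<^sub>F t in at_left y. F x t < 0"
  "backward_pivot_conf \<gamma> (x, y) \<Longrightarrow> \<forall>\<^sub>F t in at_left y. 0 < F x t"
  using sign_at_simple_zero(2)[OF deriv_F] sign_at_simple_zero(2)[OF DERIV_minus[OF deriv_F]]
    sign_at_double_zero(2)[OF deriv_F _ deriv_Fy]
    sign_at_double_zero(2)[OF DERIV_minus[OF deriv_F] _ DERIV_minus[OF deriv_Fy]]
  by (simp_all add: conf_iff)

section \<open>Transversality to the evolute at pivots\<close>

lemma vderiv_eq: "vderiv 1 \<gamma> = g1" "vderiv 2 \<gamma> = g2"
proof -
  have "(\<lambda>t. vector_derivative \<gamma> (at t)) = g1" "(\<lambda>t. vector_derivative g1 (at t)) = g2"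
    using g1 g2 by (auto intro: vector_derivative_at)
  then show "vderiv 1 \<gamma> = g1" "vderiv 2 \<gamma> = g2"
    by (simp_all add: vderiv_def numeral_2_eq_2)
qed

lemma evolute_eq: "evolute \<gamma> s = \<gamma> s + (g1 s \<bullet> g1 s / cross2 (g1 s) (g2 s)) *\<^sub>R (\<i> * g1 s)"
proof -
  have "cmod (g1 s) * curvature \<gamma> s = cross2 (g1 s) (g2 s) / (g1 s \<bullet> g1 s)"
    using g1_nz[of s]
    by (simp add: curvature_def vderiv_eq[unfolded One_nat_def] vderiv_eq power3_eq_cube
        power2_norm_eq_inner[symmetric] power2_eq_square)
  then show ?thesis
    by (simp add: evolute_def vderiv_eq[unfolded One_nat_def] scaleR_conv_of_real field_simps)
qed

lemma evolute_deriv: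
  assumes "cross2 (g1 s) (g2 s) \<noteq> 0"
  shows "(evolute \<gamma> has_vector_derivative
      g1 s + (g1 s \<bullet> g1 s / cross2 (g1 s) (g2 s)) *\<^sub>R (\<i> * g2 s) +
      ((2 * (g1 s \<bullet> g2 s) * cross2 (g1 s) (g2 s) - (g1 s \<bullet> g1 s) * cross2 (g1 s) (g3 s)) /
        (cross2 (g1 s) (g2 s))\<^sup>2) *\<^sub>R (\<i> * g1 s)) (at s)"
proof -
  have cross: "cross2 a b = (\<i> * a) \<bullet> b" for a b
    by (simp add: cross2_def inner_complex_def)
  have ig1: "((\<lambda>t. \<i> * g1 t) has_vector_derivative \<i> * g2 s) (at s)"
    by (intro has_vector_derivative_mult_right g2)
  have "((\<lambda>t. (\<i> * g1 t) \<bullet> g2 t) has_vector_derivative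
      (\<i> * g1 s) \<bullet> g3 s + (\<i> * g2 s) \<bullet> g2 s) (at s)"
    by (rule bounded_bilinear.has_vector_derivative[OF bounded_bilinear_inner ig1 g3])
  moreover have "(\<i> * g2 s) \<bullet> g2 s = 0" by (simp add: inner_complex_def)
  ultimately have c: "((\<lambda>t. cross2 (g1 t) (g2 t)) has_real_derivative cross2 (g1 s) (g3 s)) (at s)"
    by (simp add: cross has_real_derivative_iff_has_vector_derivative)
  have "((\<lambda>t. g1 t \<bullet> g1 t) has_vector_derivative (g1 s \<bullet> g2 s + g2 s \<bullet> g1 s)) (at s)"
    by (rule bounded_bilinear.has_vector_derivative[OF bounded_bilinear_inner g2 g2])
  then have n: "((\<lambda>t. g1 t \<bullet> g1 t) has_real_derivative 2 * (g1 s \<bullet> g2 s)) (at s)"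
    by (simp add: has_real_derivative_iff_has_vector_derivative inner_commute)
  have "((\<lambda>t. g1 t \<bullet> g1 t / cross2 (g1 t) (g2 t)) has_real_derivative
      (2 * (g1 s \<bullet> g2 s) * cross2 (g1 s) (g2 s) - (g1 s \<bullet> g1 s) * cross2 (g1 s) (g3 s)) /
        (cross2 (g1 s) (g2 s))\<^sup>2) (at s)"
    using DERIV_divide[OF n c assms] by (simp add: power2_eq_square)
  from has_vector_derivative_add[OF g1 has_vector_derivative_scaleR[OF this ig1]]
  show ?thesis by (simp add: evolute_eq[abs_def] add.assoc)
qed

text \<open>At a pivot the human stands on the evolute of the puppy's position, and transversality
  makes the critical set a vertical fold there.\<close>

lemma Fx_nonzero_at_pivot:
  assumes "pivot_conf \<gamma> (x, y)"
  shows "Fx x y \<noteq> 0"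
proof -
  define a b d w c where "a = g1 y" and "b = g2 y" and "d = g3 y" and "w = \<gamma> y - \<gamma> x"
    and "c = cross2 a b"
  have *: "w \<bullet> a = 0" "a \<bullet> a + w \<bullet> b = 0" "3 * (a \<bullet> b) + w \<bullet> d \<noteq> 0"
    using assms by (auto simp: conf_iff F_def Fy_def Fyy_def a_def b_def d_def w_def)
  have a0: "a \<noteq> 0" using g1_nz by (simp add: a_def)
  note alg = evolute_algebra[OF a0 *(1,2), folded c_def]
  have "\<gamma> x = \<gamma> y - w" by (simp add: w_def)
  then have "\<gamma> x = evolute \<gamma> y"
    using alg(2) by (simp add: evolute_eq a_def b_def c_def)
  moreover have "curvature \<gamma> y \<noteq> 0"
    using alg(1) a0 by (simp add: curvature_def vderiv_eq[unfolded One_nat_def] vderiv_eq a_def b_def c_def)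
  moreover define k where "k = (3 * (a \<bullet> b) + w \<bullet> d) / c"
  have k: "k \<noteq> 0" using *(3) alg(1) by (simp add: k_def)
  have "vector_derivative (evolute \<gamma>) (at y) = k *\<^sub>R (\<i> * a)"
    using evolute_deriv[of y] alg(1) alg(3)[of d]
    by (simp add: a_def b_def c_def d_def k_def vector_derivative_at)
  moreover have "k *\<^sub>R (\<i> * a) \<noteq> 0" using k a0 by simp
  ultimately have "cross2 (vderiv 1 \<gamma> x) (k *\<^sub>R (\<i> * a)) \<noteq> 0"
    using generic unfolding generic_def meets_evolute_transversely_def by metis
  \<comment> \<open>As the evolute moves along the normal at \<open>y\<close>, transversality says
    that the velocities at \<open>x\<close> and \<open>y\<close> are not orthogonal.\<close>
  moreover have "cross2 (g1 x) (k *\<^sub>R (\<i> * a)) = k * (g1 x \<bullet> g1 y)"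
    by (simp add: cross2_def inner_complex_def a_def algebra_simps)
  ultimately show ?thesis by (simp add: vderiv_eq[unfolded One_nat_def] Fx_def)
qed

section \<open>Invariance under integer translations\<close>

lemma curve_int_shift: "\<gamma> (t + of_int k) = \<gamma> t" "g1 (t + of_int k) = g1 t"
    "g2 (t + of_int k) = g2 t" "g3 (t + of_int k) = g3 t"
proof -
  have int: "f (t + of_int k) = f t" if "\<And>t. f (t + 1) = f t" for f :: "real \<Rightarrow> complex" and t k
  proof (induction k rule: int_induct[of _ 0])
    case (step1 i)
    then show ?case using that[of "t + of_int i"] by (simp add: add.assoc)
  next
    case (step2 i)
    then show ?case using that[of "t + of_int i - 1"] by (simp add: algebra_simps)
  qed simp
  have der: "f' (t + 1) = f' t"
    if f: "\<And>t. (f has_vector_derivative f' t) (at t)" "\<And>t. f (t + 1) = f t"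
    for f f' :: "real \<Rightarrow> complex" and t
  proof -
    have "((f \<circ> (\<lambda>s. s + 1)) has_vector_derivative 1 *\<^sub>R f' (t + 1)) (at t)"
      by (rule vector_diff_chain_at) (auto intro!: derivative_eq_intros f)
    then have "(f has_vector_derivative f' (t + 1)) (at t)" using f(2) by (simp add: o_def)
    then show ?thesis using f(1) vector_derivative_unique_at by blast
  qed
  note p1 = der[OF g1 periodic]
  note p2 = der[OF g2 p1]
  note p3 = der[OF g3 p2]
  show "\<gamma> (t + of_int k) = \<gamma> t" "g1 (t + of_int k) = g1 t"
    "g2 (t + of_int k) = g2 t" "g3 (t + of_int k) = g3 t"
    by (rule int, rule periodic, rule int, rule p1, rule int, rule p2, rule int, rule p3)
qed

lemma F_shift: "F (x + of_int i) (y + of_int j) = F x y"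
  "Fy (x + of_int i) (y + of_int j) = Fy x y" "Fyy (x + of_int i) (y + of_int j) = Fyy x y"
  by (simp_all add: F_def Fy_def Fyy_def curve_int_shift)

lemma conf_shift:
  "stable_conf \<gamma> (x + of_int i, y + of_int j) \<longleftrightarrow> stable_conf \<gamma> (x, y)"
  "pivot_conf \<gamma> (x + of_int i, y + of_int j) \<longleftrightarrow> pivot_conf \<gamma> (x, y)"
  by (simp_all add: conf_iff F_shift)

lemma D_shift: "D \<gamma> (x + of_int i) (y + of_int j) = D \<gamma> x y"
  by (simp add: D_def curve_int_shift)

lemma continuous_on_F [continuous_intros]:
  assumes "continuous_on S f" "continuous_on S g"
  shows "continuous_on S (\<lambda>p. F (f p) (g p))" "continuous_on S (\<lambda>p. Fx (f p) (g p))"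
    "continuous_on S (\<lambda>p. Fy (f p) (g p))"
  unfolding F_def Fx_def Fy_def by (intro continuous_intros assms)+

abbreviation "F2 \<equiv> \<lambda>p. F (fst p) (snd p)"

lemma continuous_F2: "continuous_on UNIV F2"
  by (intro continuous_intros)

section \<open>Local shape of the zero set of \<open>F\<close>\<close>

lemma pos_ball:
  assumes "continuous_on UNIV (H :: real \<times> real \<Rightarrow> real)" "0 < H p"
  obtains R where "0 < R" "\<And>q. q \<in> ball p R \<Longrightarrow> 0 < H q"
proof -
  have "open {q. 0 < H q}" using assms(1) by (simp add: open_Collect_less)
  moreover have "p \<in> {q. 0 < H q}" using assms(2) by simp
  ultimately obtain R where "0 < R" "ball p R \<subseteq> {q. 0 < H q}" by (rule openE)
  then show thesis using that by blast
qed

text \<open>At a zero some axis direction, with a suitable sign, increases \<open>F\<close>: a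
  vertical one at stable and unstable configurations, a horizontal one at pivots, where
  \<open>Fy\<close> vanishes but transversality keeps \<open>Fx\<close> nonzero.\<close>

lemma regular_at_nonneg:
  assumes "0 \<le> F x y"
  shows "regular_nonneg F2 (x, y)"
proof (cases "F x y = 0")
  case False
  then show ?thesis using assms by (simp add: regular_nonneg_def)
next
  case True
  have vertical: "increasing_along F2 (0, \<sigma>) (x, y)" if pos: "0 < \<sigma> * Fy x y" for \<sigma>
  proof -
    obtain R where R: "0 < R" "\<And>q. q \<in> ball (x, y) R \<Longrightarrow> 0 < \<sigma> * Fy (fst q) (snd q)"
      by (rule pos_ball[of "\<lambda>p. \<sigma> * Fy (fst p) (snd p)" "(x, y)"])
         (use pos in \<open>auto intro!: continuous_intros\<close>)
    show ?thesis unfolding increasing_along_def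
    proof (intro exI[of _ R] conjI ballI allI impI R(1))
      fix q t assume q: "q \<in> ball (x, y) R" "0 < t" "q + t *\<^sub>R (0, \<sigma>) \<in> ball (x, y) R"
      have seg: "q + s *\<^sub>R (0, \<sigma>) \<in> ball (x, y) R" if "0 \<le> s" "s \<le> t" for s
      proof -
        have "q + s *\<^sub>R (0, \<sigma>) = (1 - s / t) *\<^sub>R q + (s / t) *\<^sub>R (q + t *\<^sub>R (0, \<sigma>))"
          using q(2) by (simp add: algebra_simps)
        then show ?thesis using convexD[OF convex_ball q(1,3), of "1 - s / t" "s / t"] that q(2)
          by (simp add: field_simps)
      qed
      have "F2 (q + 0 *\<^sub>R (0, \<sigma>)) < F2 (q + t *\<^sub>R (0, \<sigma>))"
      proof (rule DERIV_pos_imp_increasing[OF q(2), of "\<lambda>s. F2 (q + s *\<^sub>R (0, \<sigma>))"])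
        fix s assume s: "0 \<le> s" "s \<le> t"
        have "((\<lambda>s. F (fst q) (snd q + s * \<sigma>)) has_real_derivative
            Fy (fst q) (snd q + s * \<sigma>) * \<sigma>) (at s)"
          by (rule DERIV_chain'[OF _ deriv_F]) (auto intro!: derivative_eq_intros)
        moreover have "0 < \<sigma> * Fy (fst q) (snd q + s * \<sigma>)" using R(2)[OF seg[OF s]] by simp
        ultimately show "\<exists>l. ((\<lambda>s. F2 (q + s *\<^sub>R (0, \<sigma>))) has_real_derivative l) (at s) \<and> 0 < l"
          by (auto simp: mult.commute)
      qed
      then show "F2 q < F2 (q + t *\<^sub>R (0, \<sigma>))" by simp
    qed
  qed
  have horizontal: "increasing_along F2 (\<sigma>, 0) (x, y)" if pos: "0 < \<sigma> * Fx x y" for \<sigma>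
  proof -
    obtain R where R: "0 < R" "\<And>q. q \<in> ball (x, y) R \<Longrightarrow> 0 < \<sigma> * Fx (fst q) (snd q)"
      by (rule pos_ball[of "\<lambda>p. \<sigma> * Fx (fst p) (snd p)" "(x, y)"])
         (use pos in \<open>auto intro!: continuous_intros\<close>)
    show ?thesis unfolding increasing_along_def
    proof (intro exI[of _ R] conjI ballI allI impI R(1))
      fix q t assume q: "q \<in> ball (x, y) R" "0 < t" "q + t *\<^sub>R (\<sigma>, 0) \<in> ball (x, y) R"
      have seg: "q + s *\<^sub>R (\<sigma>, 0) \<in> ball (x, y) R" if "0 \<le> s" "s \<le> t" for s
      proof -
        have "q + s *\<^sub>R (\<sigma>, 0) = (1 - s / t) *\<^sub>R q + (s / t) *\<^sub>R (q + t *\<^sub>R (\<sigma>, 0))"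
          using q(2) by (simp add: algebra_simps)
        then show ?thesis using convexD[OF convex_ball q(1,3), of "1 - s / t" "s / t"] that q(2)
          by (simp add: field_simps)
      qed
      have "F2 (q + 0 *\<^sub>R (\<sigma>, 0)) < F2 (q + t *\<^sub>R (\<sigma>, 0))"
      proof (rule DERIV_pos_imp_increasing[OF q(2), of "\<lambda>s. F2 (q + s *\<^sub>R (\<sigma>, 0))"])
        fix s assume s: "0 \<le> s" "s \<le> t"
        have "((\<lambda>s. F (fst q + s * \<sigma>) (snd q)) has_real_derivative
            Fx (fst q + s * \<sigma>) (snd q) * \<sigma>) (at s)"
          by (rule DERIV_chain'[OF _ deriv_F_x]) (auto intro!: derivative_eq_intros)
        moreover have "0 < \<sigma> * Fx (fst q + s * \<sigma>) (snd q)" using R(2)[OF seg[OF s]] by simp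
        ultimately show "\<exists>l. ((\<lambda>s. F2 (q + s *\<^sub>R (\<sigma>, 0))) has_real_derivative l) (at s) \<and> 0 < l"
          by (auto simp: mult.commute)
      qed
      then show "F2 q < F2 (q + t *\<^sub>R (\<sigma>, 0))" by simp
    qed
  qed
  have unit: "norm (0::real, 1::real) = 1" "norm (0::real, -1::real) = 1"
    "norm (1::real, 0::real) = 1" "norm (-1::real, 0::real) = 1" by (simp_all add: norm_Pair)
  have "Fy x y \<noteq> 0 \<or> Fx x y \<noteq> 0"
    using Fx_nonzero_at_pivot[of x y] True
    by (cases rule: critical_cases[OF True]) (auto simp: conf_iff)
  then consider "0 < 1 * Fy x y" | "0 < - 1 * Fy x y" | "0 < 1 * Fx x y" | "0 < - 1 * Fx x y"
    by fastforce
  then have "\<exists>v. norm v = 1 \<and> increasing_along F2 v (x, y)"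
    using vertical horizontal unit by cases blast+
  then show ?thesis using True by (simp add: regular_nonneg_def)
qed

text \<open>Genericity counts pivots in one unit square; those near \<open>(x0, y0)\<close> are
  translates of them to the nine unit cells around that point.\<close>

lemma pivot_isolated:
  obtains e where "0 < e"
    "\<And>x y. dist x x0 < e \<Longrightarrow> dist y y0 < e \<Longrightarrow> pivot_conf \<gamma> (x, y) \<Longrightarrow> (x, y) = (x0, y0)"
proof -
  define P where "P = {p\<in>{0..<1}\<times>{0..<1}. pivot_conf \<gamma> p}"
  define I where "I = {\<lfloor>x0\<rfloor> - 1..\<lfloor>x0\<rfloor> + 1} \<times> {\<lfloor>y0\<rfloor> - 1..\<lfloor>y0\<rfloor> + 1}"
  define Q where "Q = (\<Union>(i, j)\<in>I. (\<lambda>p. p + (of_int i, of_int j)) ` P)"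
  have "finite Q" unfolding Q_def I_def P_def
    using generic by (auto simp: generic_def)
  then obtain d where d: "0 < d" "\<And>q. q \<in> Q \<Longrightarrow> q \<noteq> (x0, y0) \<Longrightarrow> d \<le> dist (x0, y0) q"
    using finite_set_avoid[of Q "(x0, y0)"] by blast
  \<comment> \<open>The bound 1 lets each floor change by at most one; \<open>d / 2\<close> in each
    coordinate keeps the distance below \<open>d\<close>.\<close>
  define e where "e = min 1 (d / 2)"
  show thesis
  proof (rule that[of e])
    show "0 < e" using d(1) by (simp add: e_def)
    fix x y assume xy: "dist x x0 < e" "dist y y0 < e" "pivot_conf \<gamma> (x, y)"
    have "pivot_conf \<gamma> (frac x + of_int \<lfloor>x\<rfloor>, frac y + of_int \<lfloor>y\<rfloor>)"
      using xy(3) by (simp add: frac_def)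
    then have "(frac x, frac y) \<in> P"
      unfolding P_def conf_shift(2) by (auto simp: frac_lt_1)
    moreover have "(\<lfloor>x\<rfloor>, \<lfloor>y\<rfloor>) \<in> I"
      using xy(1,2) by (auto simp: I_def e_def dist_real_def) linarith+
    moreover have "(x, y) = (frac x, frac y) + (of_int \<lfloor>x\<rfloor>, of_int \<lfloor>y\<rfloor>)"
      by (simp add: frac_def)
    ultimately have "(x, y) \<in> Q" unfolding Q_def by blast
    moreover have "dist (x0, y0) (x, y) < d"
    proof -
      have "dist (x0, y0) (x, y) \<le> dist x0 x + dist y0 y"
        by (simp add: dist_Pair_Pair sqrt_sum_squares_le_sum)
      also have "\<dots> < d" using xy(1,2) by (simp add: e_def dist_commute)
      finally show ?thesis .
    qed
    ultimately show "(x, y) = (x0, y0)" using d(2) by force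
  qed
qed

lemma finite_critical_column: "finite {y\<in>{a..b}. F x y = 0}"
proof -
  define P where "P = {y\<in>{0..<1}. critical \<gamma> (x, y)}"
  have "finite (\<Union>j\<in>{\<lfloor>a\<rfloor>..\<lfloor>b\<rfloor>}. (\<lambda>y. y + of_int j) ` P)"
    using generic by (auto simp: generic_def P_def)
  moreover have "{y\<in>{a..b}. F x y = 0} \<subseteq> (\<Union>j\<in>{\<lfloor>a\<rfloor>..\<lfloor>b\<rfloor>}. (\<lambda>y. y + of_int j) ` P)"
  proof
    fix y assume y: "y \<in> {y\<in>{a..b}. F x y = 0}"
    have "F x (frac y) = F (x + of_int 0) (frac y + of_int \<lfloor>y\<rfloor>)" by (rule F_shift(1)[symmetric])
    then have "frac y \<in> P" using y by (auto simp: P_def conf_iff frac_lt_1) (simp add: frac_def)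
    moreover have "y = frac y + of_int \<lfloor>y\<rfloor>" by (simp add: frac_def)
    moreover have "\<lfloor>y\<rfloor> \<in> {\<lfloor>a\<rfloor>..\<lfloor>b\<rfloor>}" using y by (auto intro: floor_mono)
    ultimately show "y \<in> (\<Union>j\<in>{\<lfloor>a\<rfloor>..\<lfloor>b\<rfloor>}. (\<lambda>y. y + of_int j) ` P)" by blast
  qed
  ultimately show ?thesis by (rule rev_finite_subset)
qed

text \<open>Since \<open>Fy\<close> is positive nearby, \<open>F\<close> increases in
  \<open>y\<close>, and the local graph of zeros consists of stable configurations. The final
  uniqueness clause later shows that a nearby trapped configuration lies on this very
  branch.\<close>

lemma stable_branch:
  assumes st: "stable_conf \<gamma> (x0, y0)" and "0 < \<epsilon>"
  obtains \<delta> r h where "0 < \<delta>" "0 < r" "r \<le> \<epsilon>" "\<delta> \<le> \<epsilon>" "continuous_on (ball x0 \<delta>) h" "h x0 = y0"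
    "\<And>x. x \<in> ball x0 \<delta> \<Longrightarrow> h x \<in> ball y0 r \<and> stable_conf \<gamma> (x, h x)"
    "\<And>x y. x \<in> ball x0 \<delta> \<Longrightarrow> y \<in> ball y0 r \<Longrightarrow> F x y = 0 \<Longrightarrow> y = h x"
proof -
  have pos: "0 < Fy x0 y0" "F x0 y0 = 0" using st by (auto simp: conf_iff)
  obtain R where R: "0 < R" "\<And>q. q \<in> ball (x0, y0) R \<Longrightarrow> 0 < Fy (fst q) (snd q)"
    by (rule pos_ball[of "\<lambda>p. Fy (fst p) (snd p)" "(x0, y0)"])
       (use pos in \<open>auto intro!: continuous_intros\<close>)
  define r where "r = min \<epsilon> (R / 2)"
  have r: "0 < r" "r \<le> \<epsilon>" "2 * r \<le> R" using R(1) \<open>0 < \<epsilon>\<close> by (auto simp: r_def)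
  have box: "0 < Fy x y" if "x \<in> ball x0 r" "y \<in> ball y0 r" for x y
  proof -
    have "dist (x0, y0) (x, y) \<le> dist x0 x + dist y0 y"
      by (simp add: dist_Pair_Pair sqrt_sum_squares_le_sum)
    also have "\<dots> < R" using that r(3) by simp
    finally show ?thesis using R(2)[of "(x, y)"] by simp
  qed
  have inc: "F x y < F x y'" if "x \<in> ball x0 r" "y \<in> ball y0 r" "y' \<in> ball y0 r" "y < y'" for x y y'
  proof (rule DERIV_pos_imp_increasing[OF that(4)])
    fix t assume "y \<le> t" "t \<le> y'"
    then have "t \<in> ball y0 r" using that(2,3) by (auto simp: dist_real_def)
    then show "\<exists>l. (F x has_real_derivative l) (at t) \<and> 0 < l"
      using deriv_F box that(1) by blast
  qed
  obtain \<delta> h where h: "0 < \<delta>" "\<delta> \<le> r" "continuous_on (ball x0 \<delta>) h" "h x0 = y0"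
    "\<And>x. x \<in> ball x0 \<delta> \<Longrightarrow> h x \<in> ball y0 r \<and> F x (h x) = 0"
    "\<And>x y. x \<in> ball x0 \<delta> \<Longrightarrow> y \<in> ball y0 r \<Longrightarrow> F x y = 0 \<Longrightarrow> y = h x"
  proof (rule local_graph[of F r x0 y0])
  qed (use r(1) inc pos(2) that in \<open>auto intro: continuous_F2\<close>)
  show thesis
  proof (rule that[OF h(1) r(1,2) _ h(3,4) _ h(6)])
    show "h x \<in> ball y0 r \<and> stable_conf \<gamma> (x, h x)" if "x \<in> ball x0 \<delta>" for x
      using h(5)[OF that] box[of x "h x"] that h(2) by (auto simp: conf_iff)
  qed (use h r in auto)
qed

text \<open>At a pivot the critical set is a graph over \<open>y\<close> instead of
  \<open>x\<close>. A nearby stable configuration is led into the pivot by moving \<open>y\<close>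
  straight to \<open>y0\<close>: \<open>Fy\<close> cannot change sign on the way, because a zero of
  it would be a second pivot nearby.\<close>

lemma pivot_branch:
  assumes pv: "pivot_conf \<gamma> (x0, y0)"
  obtains e where "0 < e"
    "\<And>x y. dist x x0 < e \<Longrightarrow> dist y y0 < e \<Longrightarrow> stable_conf \<gamma> (x, y) \<Longrightarrow>
      \<exists>c. path c \<and> c 0 = (x, y) \<and> c 1 = (x0, y0) \<and> (\<forall>t\<in>{0..<1}. stable_conf \<gamma> (c t))"
proof -
  have zero: "F x0 y0 = 0" "Fy x0 y0 = 0" using pv by (auto simp: conf_iff)
  \<comment> \<open>The sign makes \<open>\<sigma> * F\<close> increasing in \<open>x\<close>, as
    \<open>local_graph\<close> demands.\<close>
  define \<sigma> :: real where "\<sigma> = sgn (Fx x0 y0)"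
  have \<sigma>: "\<sigma> \<noteq> 0" and pos: "0 < \<sigma> * Fx x0 y0"
    using Fx_nonzero_at_pivot[OF pv] by (auto simp: \<sigma>_def sgn_if)
  obtain R where R: "0 < R" "\<And>q. q \<in> ball (x0, y0) R \<Longrightarrow> 0 < \<sigma> * Fx (fst q) (snd q)"
    by (rule pos_ball[of "\<lambda>p. \<sigma> * Fx (fst p) (snd p)" "(x0, y0)"])
       (use pos in \<open>auto intro!: continuous_intros\<close>)
  obtain e where e: "0 < e"
    "\<And>x y. dist x x0 < e \<Longrightarrow> dist y y0 < e \<Longrightarrow> pivot_conf \<gamma> (x, y) \<Longrightarrow> (x, y) = (x0, y0)"
    by (rule pivot_isolated[of x0 y0]) (rule that)
  define r where "r = min e (R / 2)"
  have r: "0 < r" "r \<le> e" "2 * r \<le> R" using R(1) e(1) by (auto simp: r_def)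
  have inc: "\<sigma> * F x y < \<sigma> * F x' y" if "y \<in> ball y0 r" "x \<in> ball x0 r" "x' \<in> ball x0 r" "x < x'" for y x x'
  proof (rule DERIV_pos_imp_increasing[OF that(4), of "\<lambda>t. \<sigma> * F t y"])
    fix t assume "x \<le> t" "t \<le> x'"
    then have t: "t \<in> ball x0 r" using that(2,3) by (auto simp: dist_real_def)
    have "dist (x0, y0) (t, y) \<le> dist x0 t + dist y0 y"
      by (simp add: dist_Pair_Pair sqrt_sum_squares_le_sum)
    also have "\<dots> < R" using that(1) t r(3) by simp
    finally have "0 < \<sigma> * Fx t y" using R(2)[of "(t, y)"] by simp
    then show "\<exists>l. ((\<lambda>t. \<sigma> * F t y) has_real_derivative l) (at t) \<and> 0 < l"
      using DERIV_cmult[OF deriv_F_x] by blast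
  qed
  obtain \<delta> g where g: "0 < \<delta>" "\<delta> \<le> r" "continuous_on (ball y0 \<delta>) g" "g y0 = x0"
    "\<And>y. y \<in> ball y0 \<delta> \<Longrightarrow> g y \<in> ball x0 r \<and> \<sigma> * F (g y) y = 0"
    "\<And>y x. y \<in> ball y0 \<delta> \<Longrightarrow> x \<in> ball x0 r \<Longrightarrow> \<sigma> * F x y = 0 \<Longrightarrow> x = g y"
  proof (rule local_graph[of "\<lambda>y x. \<sigma> * F x y" r y0 x0])
    show "continuous_on UNIV (\<lambda>p. \<sigma> * F (snd p) (fst p))" by (intro continuous_intros)
  qed (use r(1) inc zero(1) that in auto)
  show thesis
  proof (rule that[OF g(1)])
    fix x y assume xy: "dist x x0 < \<delta>" "dist y y0 < \<delta>" "stable_conf \<gamma> (x, y)"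
    have Fxy: "F x y = 0" "0 < Fy x y" using xy(3) by (auto simp: conf_iff)
    have xg: "x = g y" using xy Fxy g(2) by (intro g(6)) (auto simp: dist_commute)
    have ne: "y \<noteq> y0" using Fxy xg g(4) zero(2) by auto
    define s where "s t = y + t * (y0 - y)" for t
    define c where "c t = (g (s t), s t)" for t
    have s_ball: "s t \<in> ball y0 \<delta>" if "0 \<le> t" "t \<le> 1" for t
    proof -
      have "y0 - s t = (1 - t) * (y0 - y)" by (simp add: s_def algebra_simps)
      then have "\<bar>y0 - s t\<bar> \<le> \<bar>y0 - y\<bar>" using that by (simp add: abs_mult mult_left_le_one_le)
      then show ?thesis using xy(2) by (simp add: dist_real_def abs_minus_commute)
    qed
    have s_cont: "continuous_on A s" for A unfolding s_def by (intro continuous_intros)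
    have gs: "continuous_on {0..1} (\<lambda>t. g (s t))"
      using s_ball by (intro continuous_on_compose2[OF g(3) s_cont]) auto
    have crit: "F (g (s t)) (s t) = 0" if "0 \<le> t" "t \<le> 1" for t
      using g(5)[OF s_ball[OF that]] \<sigma> by simp
    have Fy_ne: "Fy (g (s t)) (s t) \<noteq> 0" if t: "0 \<le> t" "t < 1" for t
    proof
      assume 0: "Fy (g (s t)) (s t) = 0"
      have "F (g (s t)) (s t) = 0" using crit[of t] t by simp
      then have "pivot_conf \<gamma> (g (s t), s t)"
        by (rule critical_cases) (use 0 in \<open>auto simp: conf_iff\<close>)
      moreover have "dist (g (s t)) x0 < e" "dist (s t) y0 < e"
        using g(5)[OF s_ball[of t]] s_ball[of t] t r g(2) by (auto simp: dist_commute)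
      ultimately have "s t = y0" using e(2) by blast
      then have "(1 - t) * (y0 - y) = 0" by (simp add: s_def algebra_simps)
      then show False using t ne by simp
    qed
    have pos: "0 < Fy (g (s t)) (s t)" if t: "0 \<le> t" "t < 1" for t
    proof (rule ccontr)
      assume neg: "\<not> 0 < Fy (g (s t)) (s t)"
      have "continuous_on {0..t} (\<lambda>t. Fy (g (s t)) (s t))"
        using t by (intro continuous_intros continuous_on_subset[OF gs] s_cont) auto
      then have "\<exists>u\<ge>0. u \<le> t \<and> Fy (g (s u)) (s u) = 0"
        using neg Fxy(2) xg t by (intro IVT2') (auto simp: s_def)
      then show False using Fy_ne t by fastforce
    qed
    show "\<exists>c. path c \<and> c 0 = (x, y) \<and> c 1 = (x0, y0) \<and> (\<forall>t\<in>{0..<1}. stable_conf \<gamma> (c t))"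
    proof (intro exI[of _ c] conjI ballI)
      show "path c" unfolding path_def c_def by (intro continuous_intros gs s_cont)
      show "c 0 = (x, y)" "c 1 = (x0, y0)" by (simp_all add: c_def s_def xg g(4))
      show "stable_conf \<gamma> (c t)" if "t \<in> {0..<1}" for t
        using crit[of t] pos[of t] that by (simp add: c_def conf_iff)
    qed
  qed
qed

subsection \<open>Runs of the puppy\<close>

lemma runs_forwardI:
  assumes "\<forall>\<^sub>F s in at_right t. F x s < 0"
  shows "runs_forward \<gamma> x t"
proof -
  obtain b where b: "t < b" "\<And>s. t < s \<Longrightarrow> s < b \<Longrightarrow> F x s < 0"
    using assms unfolding eventually_at_right_field by blast
  have cont: "continuous_on A (\<lambda>s. (D \<gamma> x s)\<^sup>2)" for A
    using DERIV_isCont[OF deriv_D2] by (simp add: continuous_at_imp_continuous_on)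
  have "D \<gamma> x (t + \<epsilon>) < D \<gamma> x t" if \<epsilon>: "0 < \<epsilon>" "\<epsilon> < b - t" for \<epsilon>
  proof -
    have "(D \<gamma> x (t + \<epsilon>))\<^sup>2 < (D \<gamma> x t)\<^sup>2"
    proof (rule DERIV_neg_imp_decreasing_open[of _ _ "\<lambda>s. (D \<gamma> x s)\<^sup>2", OF _ _ cont])
      show "\<exists>l. ((\<lambda>s. (D \<gamma> x s)\<^sup>2) has_real_derivative l) (at s) \<and> l < 0"
        if "t < s" "s < t + \<epsilon>" for s
        using deriv_D2[of x s] b(2)[of s] that \<epsilon> by auto
    qed (use \<epsilon> in simp)
    then show ?thesis by (rule power2_less_imp_less) (simp add: D_def)
  qed
  then show ?thesis unfolding runs_forward_def using b(1) by (intro exI[of _ "b - t"]) auto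
qed

lemma runs_backwardI:
  assumes "\<forall>\<^sub>F s in at_left t. 0 < F x s"
  shows "runs_backward \<gamma> x t"
proof -
  obtain b where b: "b < t" "\<And>s. b < s \<Longrightarrow> s < t \<Longrightarrow> 0 < F x s"
    using assms unfolding eventually_at_left_field by blast
  have cont: "continuous_on A (\<lambda>s. (D \<gamma> x s)\<^sup>2)" for A
    using DERIV_isCont[OF deriv_D2] by (simp add: continuous_at_imp_continuous_on)
  have "D \<gamma> x (t - \<epsilon>) < D \<gamma> x t" if \<epsilon>: "0 < \<epsilon>" "\<epsilon> < t - b" for \<epsilon>
  proof -
    have "(D \<gamma> x (t - \<epsilon>))\<^sup>2 < (D \<gamma> x t)\<^sup>2"
    proof (rule DERIV_pos_imp_increasing_open[of _ _ "\<lambda>s. (D \<gamma> x s)\<^sup>2", OF _ _ cont])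
      show "\<exists>l. ((\<lambda>s. (D \<gamma> x s)\<^sup>2) has_real_derivative l) (at s) \<and> 0 < l"
        if "t - \<epsilon> < s" "s < t" for s
        using deriv_D2[of x s] b(2)[of s] that \<epsilon> by auto
    qed (use \<epsilon> in simp)
    then show ?thesis by (rule power2_less_imp_less) (simp add: D_def)
  qed
  then show ?thesis unfolding runs_backward_def using b(1) by (intro exI[of _ "t - b"]) auto
qed

text \<open>Sorts the four critical types into the alternatives that
  \<open>first_stable_zero\<close> and \<open>last_stable_zero\<close> ask for.\<close>

lemma zero_sides:
  assumes "F x z = 0"
  shows "stable_conf \<gamma> (x, z) \<or> (\<forall>\<^sub>F t in at_right z. F x t < 0) \<or> (\<forall>\<^sub>F t in at_left z. 0 < F x t)"
  by (rule critical_cases[OF assms]) (use signs_right signs_left in auto)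

lemma continuous_on_column: "continuous_on UNIV (F x)"
  by (intro continuous_intros)

lemma negative_right:
  assumes "F x t < 0" shows "\<forall>\<^sub>F s in at_right t. F x s < 0"
proof -
  have "(F x \<longlongrightarrow> F x t) (at_right t)"
    using continuous_on_column[of x]
    by (simp add: continuous_on_eq_continuous_at isCont_def filterlim_at_split)
  then show ?thesis using assms by (rule order_tendstoD(2))
qed

lemma positive_left:
  assumes "0 < F x t" shows "\<forall>\<^sub>F s in at_left t. 0 < F x s"
proof -
  have "(F x \<longlongrightarrow> F x t) (at_left t)"
    using continuous_on_column[of x]
    by (simp add: continuous_on_eq_continuous_at isCont_def filterlim_at_split)
  then show ?thesis using assms by (rule order_tendstoD(1))
qed

text \<open>The run may pass zeros of \<open>F\<close>. At such a zero \<open>F\<close> is not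
  positive immediately afterwards, because it is nonpositive up to \<open>z\<close>; the critical
  types that remain make \<open>F\<close> negative immediately afterwards, so the puppy keeps
  running forward.\<close>

lemma forward_run:
  assumes start: "\<forall>\<^sub>F t in at_right y. F x t < 0" and b: "y < b" "stable_conf \<gamma> (x, b)"
  obtains z where "y < z" "z \<le> b" "stable_conf \<gamma> (x, z)" "\<And>t. y < t \<Longrightarrow> t \<le> z \<Longrightarrow> F x t \<le> 0"
    "\<And>t. y \<le> t \<Longrightarrow> t < z \<Longrightarrow> runs_forward \<gamma> x t"
proof -
  obtain z where z: "y < z" "z \<le> b" "F x z = 0" "stable_conf \<gamma> (x, z)"
    "\<And>t. y < t \<Longrightarrow> t \<le> z \<Longrightarrow> F x t \<le> 0"
    by (rule first_stable_zero[OF continuous_on_column _ start b(1) signs_right(1)[OF b(2)],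
          where S = "\<lambda>z. stable_conf \<gamma> (x, z)"]) (rule zero_sides, assumption, rule that)
  have "runs_forward \<gamma> x t" if t: "y \<le> t" "t < z" for t
  proof (rule runs_forwardI)
    show "\<forall>\<^sub>F s in at_right t. F x s < 0"
    proof (cases "t = y")
      case False
      then have le: "F x t \<le> 0" using z(5) t by simp
      show ?thesis
      proof (cases "F x t = 0")
        case True
        have "\<not> (\<forall>\<^sub>F s in at_right t. 0 < F x s)"
        proof
          assume "\<forall>\<^sub>F s in at_right t. 0 < F x s"
          then obtain b where b: "t < b" "\<And>s. t < s \<Longrightarrow> s < b \<Longrightarrow> 0 < F x s"
            unfolding eventually_at_right_field by blast
          define s where "s = (t + min b z) / 2"
          have "t < s" "s < b" "s < z" using b(1) t by (auto simp: s_def)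
          then show False using b(2)[of s] z(5)[of s] t by simp
        qed
        then show ?thesis using signs_right by (cases rule: critical_cases[OF True]) auto
      qed (use le negative_right in auto)
    qed (use start in simp)
  qed
  then show thesis using that z by blast
qed

lemma backward_run:
  assumes start: "\<forall>\<^sub>F t in at_left y. 0 < F x t" and b: "b < y" "stable_conf \<gamma> (x, b)"
  obtains z where "z < y" "b \<le> z" "stable_conf \<gamma> (x, z)" "\<And>t. t < y \<Longrightarrow> z \<le> t \<Longrightarrow> 0 \<le> F x t"
    "\<And>t. t \<le> y \<Longrightarrow> z < t \<Longrightarrow> runs_backward \<gamma> x t"
proof -
  obtain z where z: "z < y" "b \<le> z" "F x z = 0" "stable_conf \<gamma> (x, z)"
    "\<And>t. t < y \<Longrightarrow> z \<le> t \<Longrightarrow> 0 \<le> F x t"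
    by (rule last_stable_zero[OF continuous_on_column _ start b(1) signs_left(1)[OF b(2)],
          where S = "\<lambda>z. stable_conf \<gamma> (x, z)"]) (rule zero_sides, assumption, rule that)
  have "runs_backward \<gamma> x t" if t: "t \<le> y" "z < t" for t
  proof (rule runs_backwardI)
    show "\<forall>\<^sub>F s in at_left t. 0 < F x s"
    proof (cases "t = y")
      case False
      then have le: "0 \<le> F x t" using z(5) t by simp
      show ?thesis
      proof (cases "F x t = 0")
        case True
        have "\<not> (\<forall>\<^sub>F s in at_left t. F x s < 0)"
        proof
          assume "\<forall>\<^sub>F s in at_left t. F x s < 0"
          then obtain b where b: "b < t" "\<And>s. b < s \<Longrightarrow> s < t \<Longrightarrow> F x s < 0"
            unfolding eventually_at_left_field by blast
          define s where "s = (t + max b z) / 2"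
          have "s < t" "b < s" "z < s" using b(1) t by (auto simp: s_def)
          then show False using b(2)[of s] z(5)[of s] t by simp
        qed
        then show ?thesis using signs_left by (cases rule: critical_cases[OF True]) auto
      qed (use le positive_left in auto)
    qed (use start in simp)
  qed
  then show thesis using that z by blast
qed

lemma diagonal_stable: "stable_conf \<gamma> (x, x + of_int k)"
  using g1_nz[of x] by (simp add: conf_iff F_def Fy_def curve_int_shift)

text \<open>Positivity of \<open>Fy\<close> on the diagonal spreads to a uniform band by compactness
  of one period, so \<open>F\<close> is monotone in \<open>y\<close> across the band and vanishes
  there only on the diagonal. The upper collar is the underside of the band around the next copy of
  the diagonal.\<close>

lemma diagonal_collar:
  obtains \<epsilon> where "0 < \<epsilon>" "\<epsilon> \<le> 1/2" "\<And>x y. x < y \<Longrightarrow> y < x + \<epsilon> \<Longrightarrow> 0 < F x y"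
    "\<And>x y. y < x + 1 \<Longrightarrow> x + 1 - \<epsilon> < y \<Longrightarrow> F x y < 0"
proof -
  \<comment> \<open>The second range leaves room for points at vertical distance below 1/2 from the
    diagonal over \<open>{0..1}\<close>.\<close>
  let ?K = "{0..1} \<times> {-1..2} :: (real \<times> real) set"
  have "continuous_on {0..1} (\<lambda>x. Fy x x)" by (intro continuous_intros)
  then obtain m where m: "m \<in> {0..1}" "\<And>x. x \<in> {0..1} \<Longrightarrow> Fy m m \<le> Fy x x"
    using continuous_attains_inf[of "{0..1::real}" "\<lambda>x. Fy x x"] by auto
  have m_pos: "0 < Fy m m" using diagonal_stable[of m 0] by (simp add: conf_iff)
  have "uniformly_continuous_on ?K (\<lambda>p. Fy (fst p) (snd p))"
    by (intro compact_uniformly_continuous continuous_intros compact_Times) auto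
  then obtain d where d: "0 < d" "\<And>p q. p \<in> ?K \<Longrightarrow> q \<in> ?K \<Longrightarrow> dist q p < d \<Longrightarrow>
      dist (Fy (fst q) (snd q)) (Fy (fst p) (snd p)) < Fy m m"
    using m_pos unfolding uniformly_continuous_on_def by metis
  define \<epsilon> where "\<epsilon> = min d (1/2)"
  have \<epsilon>: "0 < \<epsilon>" "\<epsilon> \<le> d" "\<epsilon> \<le> 1/2" using d(1) by (auto simp: \<epsilon>_def)
  have unit: "0 < Fy x y" if "0 \<le> x" "x \<le> 1" "\<bar>y - x\<bar> < \<epsilon>" for x y
  proof -
    have "-1 \<le> y" "y \<le> 2" using that \<epsilon> by linarith+
    then have "dist (Fy x y) (Fy x x) < Fy m m"
      using d(2)[of "(x, x)" "(x, y)"] that \<epsilon> by (auto simp: dist_Pair_Pair dist_real_def)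
    then show ?thesis using m(2)[of x] that by (auto simp: dist_real_def)
  qed
  have pos: "0 < Fy x y" if "\<bar>y - x\<bar> < \<epsilon>" for x y
  proof -
    have "0 < Fy (frac x) (y - of_int \<lfloor>x\<rfloor>)"
      using that by (intro unit) (auto simp: frac_def, linarith)
    also have "\<dots> = Fy (frac x + of_int \<lfloor>x\<rfloor>) (y - of_int \<lfloor>x\<rfloor> + of_int \<lfloor>x\<rfloor>)"
      by (rule F_shift(2)[symmetric])
    finally show ?thesis by (simp add: frac_def)
  qed
  have diag: "F x x = 0" for x by (simp add: F_def)
  show thesis
  proof (rule that[OF \<epsilon>(1,3)])
    show "0 < F x y" if "x < y" "y < x + \<epsilon>" for x y
    proof -
      have "F x x < F x y"
        by (rule DERIV_pos_imp_increasing[OF that(1)]) (use deriv_F pos that in fastforce)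
      then show ?thesis by (simp add: diag)
    qed
    show "F x y < 0" if "y < x + 1" "x + 1 - \<epsilon> < y" for x y
    proof -
      have "F x (y - 1) < F x x"
        by (rule DERIV_pos_imp_increasing) (use deriv_F pos that in fastforce)+
      moreover have "F x y = F x (y - 1)" using F_shift(1)[of x 0 "y - 1" 1] by simp
      ultimately show ?thesis by (simp add: diag)
    qed
  qed
qed

subsection \<open>Winning configurations\<close>

text \<open>Unlike in a strategy, here even the first pivot has to start at a pivot configuration;
  this makes the notion closed under prepending pieces.\<close>

inductive good :: "real \<times> real \<Rightarrow> bool" where
  finish: "valid_piece \<gamma> False (Pivot x y0 y1) \<Longrightarrow> on_diagonal (x, y1) \<Longrightarrow> good (x, y0)"
| pivot: "valid_piece \<gamma> False (Pivot x y0 y1) \<Longrightarrow> good (x, y1) \<Longrightarrow> good (x, y0)"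
| walk: "path c \<Longrightarrow> \<forall>t\<in>{0..<1}. stable_conf \<gamma> (c t) \<Longrightarrow> good (c 1) \<Longrightarrow> good (c 0)"

text \<open>The final pivot is kept in the notion because its direction decides between dexter and
  sinister.\<close>

definition winning :: "real \<times> real \<Rightarrow> piece list \<Rightarrow> bool" where
  "winning p ps \<longleftrightarrow> strategy \<gamma> p ps \<and> (\<exists>x y0 y1. last ps = Pivot x y0 y1)"

lemma winning_imp_caught: "winning p ps \<Longrightarrow> dexter \<gamma> p \<or> sinister \<gamma> p"
proof -
  assume w: "winning p ps"
  then obtain x y0 y1 where l: "last ps = Pivot x y0 y1" "strategy \<gamma> p ps" "ps \<noteq> []"
    unfolding winning_def strategy_def by blast
  then have "valid_piece \<gamma> (\<forall>j<length ps - 1. is_walk (ps ! j)) (Pivot x y0 y1)"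
    unfolding strategy_def by (metis last_conv_nth diff_less length_greater_0_conv zero_less_one)
  then have "y0 \<noteq> y1" by simp
  then show ?thesis using l
    unfolding dexter_def dexter_strategy_def sinister_def sinister_strategy_def
    by (metis linorder_neqE_linordered_idom)
qed

lemma valid_piece_mono: "valid_piece \<gamma> False pc \<Longrightarrow> valid_piece \<gamma> b pc"
  by (cases pc) auto

lemma winning_Nil:
  assumes "valid_piece \<gamma> True (Pivot x y0 y1)" "on_diagonal (x, y1)"
  shows "winning (x, y0) [Pivot x y0 y1]"
  using assms by (auto simp: winning_def strategy_def)

text \<open>The validity flag of a piece depends on the pieces before it. Demanding that the old
  pieces be valid without the privilege of a first pivot keeps them valid behind any new piece, and
  only the new one may use that privilege.\<close>

lemma winning_Cons:
  assumes "winning q ps" "\<forall>pc\<in>set ps. valid_piece \<gamma> False pc"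
    "valid_piece \<gamma> True pc" "piece_finish pc = q"
  shows "winning (piece_start pc) (pc # ps)"
proof -
  have ps: "ps \<noteq> []" "piece_start (ps ! 0) = q"
    "\<And>i. Suc i < length ps \<Longrightarrow> piece_finish (ps ! i) = piece_start (ps ! Suc i)"
    using assms(1) by (auto simp: winning_def strategy_def hd_conv_nth)
  have "piece_finish ((pc # ps) ! i) = piece_start ((pc # ps) ! Suc i)"
    if "Suc i < length (pc # ps)" for i
    using that ps assms(4) by (cases i) auto
  moreover have "valid_piece \<gamma> (\<forall>j<i. is_walk ((pc # ps) ! j)) ((pc # ps) ! i)"
    if "i < length (pc # ps)" for i
  proof (cases i)
    case (Suc k)
    then have "ps ! k \<in> set ps" using that by simp
    then show ?thesis using Suc assms(2) valid_piece_mono by (metis nth_Cons_Suc)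
  qed (use assms(3) in simp)
  ultimately show ?thesis using assms(1) ps(1) by (auto simp: winning_def strategy_def)
qed

lemma good_winning:
  "good p \<Longrightarrow> \<exists>ps. winning p ps \<and> (\<forall>pc\<in>set ps. valid_piece \<gamma> False pc)"
proof (induction rule: good.induct)
  case (finish x y0 y1)
  then show ?case using winning_Nil[OF valid_piece_mono] by (intro exI[of _ "[Pivot x y0 y1]"]) auto
next
  case (pivot x y0 y1)
  then obtain ps where ps: "winning (x, y1) ps" "\<forall>pc\<in>set ps. valid_piece \<gamma> False pc" by blast
  show ?case
    using winning_Cons[OF ps valid_piece_mono[OF pivot(1)]] ps(2) pivot(1)
    by (intro exI[of _ "Pivot x y0 y1 # ps"]) auto
next
  case (walk c)
  then obtain ps where ps: "winning (c 1) ps" "\<forall>pc\<in>set ps. valid_piece \<gamma> False pc" by blast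
  have v: "valid_piece \<gamma> b (Walk c)" for b using walk by simp
  show ?case
    using winning_Cons[OF ps v] ps(2) v by (intro exI[of _ "Walk c # ps"]) auto
qed

lemma runs_shift:
  "runs_forward \<gamma> (x + of_int i) (y + of_int j) = runs_forward \<gamma> x y"
  "runs_backward \<gamma> (x + of_int i) (y + of_int j) = runs_backward \<gamma> x y"
proof -
  have "D \<gamma> (x + of_int i) (y + of_int j + e) = D \<gamma> x (y + e)"
    "D \<gamma> (x + of_int i) (y + of_int j - e) = D \<gamma> x (y - e)" for e
    using D_shift[of x i "y + e" j] D_shift[of x i "y - e" j] by (simp_all add: algebra_simps)
  then show "runs_forward \<gamma> (x + of_int i) (y + of_int j) = runs_forward \<gamma> x y"
    "runs_backward \<gamma> (x + of_int i) (y + of_int j) = runs_backward \<gamma> x y"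
    by (simp_all add: runs_forward_def runs_backward_def D_shift)
qed

lemma valid_pivot_shift:
  assumes "valid_piece \<gamma> b (Pivot x y0 y1)"
  shows "valid_piece \<gamma> b (Pivot (x + of_int i) (y0 + of_int j) (y1 + of_int j))"
proof -
  have "runs_forward \<gamma> (x + of_int i) t" if "runs_forward \<gamma> x (t - of_int j)" for t
    using that runs_shift(1)[of x i "t - of_int j" j] by simp
  moreover have "runs_backward \<gamma> (x + of_int i) t" if "runs_backward \<gamma> x (t - of_int j)" for t
    using that runs_shift(2)[of x i "t - of_int j" j] by simp
  ultimately show ?thesis using assms by (auto simp: conf_shift split: if_splits)
qed

lemma good_shift: "good p \<Longrightarrow> good (fst p + of_int i, snd p + of_int j)"
proof (induction rule: good.induct)
  case (finish x y0 y1)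
  have "(x + of_int i) - (y1 + of_int j) \<in> \<int>"
    using finish(2) Ints_add[of "x - y1" "of_int (i - j)"]
    by (simp add: on_diagonal_def algebra_simps)
  then show ?case using good.finish[OF valid_pivot_shift[OF finish(1)], of i j]
    by (simp add: on_diagonal_def)
next
  case (pivot x y0 y1)
  then show ?case using good.pivot[OF valid_pivot_shift[OF pivot(1)], of i j] by simp
next
  case (walk c)
  define c' where "c' t = (fst (c t) + of_int i, snd (c t) + of_int j)" for t
  have "path c'" using walk(1) unfolding path_def c'_def by (intro continuous_intros) auto
  moreover have "\<forall>t\<in>{0..<1}. stable_conf \<gamma> (c' t)"
    using walk(2) by (simp add: c'_def conf_shift)
  moreover have "good (c' 1)" using walk(4) by (simp add: c'_def)
  ultimately have "good (c' 0)" by (rule good.walk)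
  then show ?case by (simp add: c'_def)
qed

subsection \<open>Trapped configurations\<close>

definition trap :: "(real \<times> real) set" where
  "trap = {p \<in> strip. stable_conf \<gamma> p \<and> \<not> good p}"

lemma trap_shift: "p \<in> trap \<Longrightarrow> p + (of_int k, of_int k) \<in> trap"
proof (cases p)
  case (Pair x y)
  assume p: "p \<in> trap"
  have "good (x, y)" if "good (x + of_int k, y + of_int k)"
    using good_shift[OF that, of "- k" "- k"] by simp
  then show ?thesis using p Pair by (auto simp: trap_def strip_def conf_shift)
qed

lemma open_strip: "open strip"
proof -
  have eq: "strip = {p. fst p < snd p} \<inter> {p. snd p < fst p + 1}" by (auto simp: strip_def)
  show ?thesis unfolding eq by (intro open_Int open_Collect_less continuous_intros)
qed

text \<open>The human may walk along a branch in either direction, so a branch is good or trapped as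
  a whole.\<close>

lemma branch_walk:
  assumes h: "continuous_on (ball x0 \<delta>) h" "\<And>x. x \<in> ball x0 \<delta> \<Longrightarrow> stable_conf \<gamma> (x, h x)"
    and x: "a \<in> ball x0 \<delta>" "b \<in> ball x0 \<delta>" and good: "good (b, h b)"
  shows "good (a, h a)"
proof -
  define c where "c t = (a + t * (b - a), h (a + t * (b - a)))" for t
  have in_ball: "a + t * (b - a) \<in> ball x0 \<delta>" if "t \<in> {0..1}" for t
    using convexD[OF convex_ball x, of "1 - t" t] that by (auto simp: algebra_simps)
  have "path c" unfolding path_def c_def
    by (intro continuous_intros continuous_on_compose2[OF h(1)]) (use in_ball in auto)
  moreover have "\<forall>t\<in>{0..<1}. stable_conf \<gamma> (c t)" using in_ball h(2) by (auto simp: c_def)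
  moreover have "good (c 1)" using good by (simp add: c_def)
  ultimately have "good (c 0)" by (rule good.walk)
  then show ?thesis by (simp add: c_def)
qed

text \<open>The branch through a trapped configuration stays trapped. For the envelopes this is
  semicontinuity: near \<open>x0\<close> the top cannot drop, nor the bottom rise, by
  \<open>\<epsilon>\<close> or more from its value at \<open>x0\<close>.\<close>

lemma trap_branch:
  assumes p: "(x0, y0) \<in> trap" and "0 < \<epsilon>"
  obtains \<delta> where "0 < \<delta>" "\<And>x. dist x x0 < \<delta> \<Longrightarrow> \<exists>y. dist y y0 < \<epsilon> \<and> (x, y) \<in> trap"
proof -
  have st: "stable_conf \<gamma> (x0, y0)" and ng: "\<not> good (x0, y0)" and "(x0, y0) \<in> strip"
    using p by (auto simp: trap_def)
  then obtain R where R: "0 < R" "ball (x0, y0) R \<subseteq> strip" using open_strip by (metis openE)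
  define e where "e = min \<epsilon> (R / 2)"
  have e: "0 < e" "e \<le> \<epsilon>" "2 * e \<le> R" using R(1) \<open>0 < \<epsilon>\<close> by (auto simp: e_def)
  obtain \<delta> r h where h: "0 < \<delta>" "0 < r" "r \<le> e" "\<delta> \<le> e" "continuous_on (ball x0 \<delta>) h" "h x0 = y0"
    "\<And>x. x \<in> ball x0 \<delta> \<Longrightarrow> h x \<in> ball y0 r \<and> stable_conf \<gamma> (x, h x)"
    by (rule stable_branch[OF st e(1)]) (rule that)
  show thesis
  proof (rule that[OF h(1)])
    fix x assume "dist x x0 < \<delta>"
    then have x: "x \<in> ball x0 \<delta>" by (simp add: dist_commute)
    have d: "dist x0 x < e" "dist y0 (h x) < e" using h(3,4,7) x by fastforce+
    have "dist (x0, y0) (x, h x) \<le> dist x0 x + dist y0 (h x)"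
      by (simp add: dist_Pair_Pair sqrt_sum_squares_le_sum)
    also have "\<dots> < R" using d e(3) by simp
    finally have "(x, h x) \<in> strip" using R(2) by (simp add: subset_iff)
    moreover have "\<not> good (x, h x)"
      using branch_walk[OF h(5) _ _ x, of x0] h(1,6,7) ng by auto
    ultimately have "(x, h x) \<in> trap" using h(7)[OF x] by (simp add: trap_def)
    moreover have "dist (h x) y0 < \<epsilon>" using d e(2) by (simp add: dist_commute)
    ultimately show "\<exists>y. dist y y0 < \<epsilon> \<and> (x, y) \<in> trap" by blast
  qed
qed

text \<open>The collars hold the trap at a definite distance from both diagonals, so limits cannot
  escape to them.\<close>

lemma trap_closure_critical:
  assumes "(x0, y0) \<in> closure trap"
  shows "F x0 y0 = 0" "(x0, y0) \<in> strip"
proof -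
  obtain \<epsilon> where \<epsilon>: "0 < \<epsilon>" "\<epsilon> \<le> 1/2" "\<And>x y. x < y \<Longrightarrow> y < x + \<epsilon> \<Longrightarrow> 0 < F x y"
    "\<And>x y. y < x + 1 \<Longrightarrow> x + 1 - \<epsilon> < y \<Longrightarrow> F x y < 0" by (rule diagonal_collar) (rule that)
  let ?K = "{p. F2 p = 0} \<inter> {p. fst p + \<epsilon> \<le> snd p} \<inter> {p. snd p \<le> fst p + 1 - \<epsilon>}"
  have "closed ?K"
    by (intro closed_Int closed_Collect_eq closed_Collect_le continuous_intros)
  moreover have "trap \<subseteq> ?K"
  proof
    fix p assume p: "p \<in> trap"
    have "F (fst p) (snd p) = 0" using p by (cases p) (auto simp: trap_def conf_iff)
    moreover have "fst p < snd p" "snd p < fst p + 1" using p by (auto simp: trap_def strip_def)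
    ultimately show "p \<in> ?K" using \<epsilon>(3)[of "fst p" "snd p"] \<epsilon>(4)[of "snd p" "fst p"] by force
  qed
  ultimately have "closure trap \<subseteq> ?K" by (rule closure_minimal[rotated])
  then have "(x0, y0) \<in> ?K" using assms by blast
  then show "F x0 y0 = 0" "(x0, y0) \<in> strip" using \<epsilon>(1) by (auto simp: strip_def)
qed

text \<open>A stable limit is trapped along its branch; an unstable limit cannot occur, as
  \<open>Fy\<close> is positive on the trap. A limiting pivot is not good, since trapped
  configurations near it could walk into it; so its run ends neither on the diagonal nor at a good
  configuration, hence in the trap. The sign of \<open>F\<close> along the run is recorded for the
  envelopes.\<close>

lemma trap_closure:
  assumes cl: "(x0, y0) \<in> closure trap"
  shows "(x0, y0) \<in> trap \<or>
    (\<exists>y1>y0. (x0, y1) \<in> trap \<and> (\<forall>t\<in>{y0..y1}. F x0 t \<le> 0)) \<or>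
    (\<exists>y1<y0. (x0, y1) \<in> trap \<and> (\<forall>t\<in>{y1..y0}. 0 \<le> F x0 t))"
proof -
  note zero = trap_closure_critical(1)[OF cl] and str = trap_closure_critical(2)[OF cl]
  have near: "\<exists>x y. (x, y) \<in> trap \<and> dist x x0 < e \<and> dist y y0 < e" if e: "0 < e" for e
  proof -
    obtain q where q: "q \<in> trap" "dist q (x0, y0) < e"
      using cl e unfolding closure_approachable by blast
    have "dist (fst q) x0 < e" "dist (snd q) y0 < e"
      using dist_fst_le[of q "(x0, y0)"] dist_snd_le[of q "(x0, y0)"] q(2) by auto
    then show ?thesis using q(1) by (metis prod.collapse)
  qed
  have pivot_bad: "\<not> good (x0, y0)" if pv: "pivot_conf \<gamma> (x0, y0)"
  proof
    assume good: "good (x0, y0)"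
    obtain e where e: "0 < e"
      "\<And>x y. dist x x0 < e \<Longrightarrow> dist y y0 < e \<Longrightarrow> stable_conf \<gamma> (x, y) \<Longrightarrow>
        \<exists>c. path c \<and> c 0 = (x, y) \<and> c 1 = (x0, y0) \<and> (\<forall>t\<in>{0..<1}. stable_conf \<gamma> (c t))"
      by (rule pivot_branch[OF pv]) (rule that)
    obtain x y where xy: "(x, y) \<in> trap" "dist x x0 < e" "dist y y0 < e" using near[OF e(1)] by blast
    obtain c where "path c" "c 0 = (x, y)" "c 1 = (x0, y0)" "\<forall>t\<in>{0..<1}. stable_conf \<gamma> (c t)"
      using e(2)[OF xy(2,3)] xy(1) by (auto simp: trap_def)
    then have "good (x, y)" using good.walk[of c] good by simp
    then show False using xy(1) by (simp add: trap_def)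
  qed
  have bounds: "x0 < y0" "y0 < x0 + 1" using str by (auto simp: strip_def)
  show ?thesis
  proof (rule critical_cases[OF zero])
    assume st: "stable_conf \<gamma> (x0, y0)"
    obtain \<delta> r h where h: "0 < \<delta>" "0 < r" "r \<le> 1" "\<delta> \<le> 1" "continuous_on (ball x0 \<delta>) h" "h x0 = y0"
      "\<And>x. x \<in> ball x0 \<delta> \<Longrightarrow> h x \<in> ball y0 r \<and> stable_conf \<gamma> (x, h x)"
      "\<And>x y. x \<in> ball x0 \<delta> \<Longrightarrow> y \<in> ball y0 r \<Longrightarrow> F x y = 0 \<Longrightarrow> y = h x"
      by (rule stable_branch[OF st zero_less_one]) (rule that)
    obtain x y where xy: "(x, y) \<in> trap" "dist x x0 < min \<delta> r" "dist y y0 < min \<delta> r"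
      using near[of "min \<delta> r"] h(1,2) by auto
    have x: "x \<in> ball x0 \<delta>" using xy(2) by (simp add: dist_commute)
    have "y = h x" using h(8)[OF x] xy by (auto simp: trap_def conf_iff dist_commute)
    then have "\<not> good (x0, y0)"
      using branch_walk[OF h(5) _ x, of x0] h(1,6,7) xy(1) by (auto simp: trap_def)
    then show ?thesis using st str by (simp add: trap_def)
  next
    assume "unstable_conf \<gamma> (x0, y0)"
    then have pos: "0 < - Fy x0 y0" by (simp add: conf_iff)
    obtain R where R: "0 < R" "\<And>q. q \<in> ball (x0, y0) R \<Longrightarrow> 0 < - Fy (fst q) (snd q)"
      by (rule pos_ball[of "\<lambda>p. - Fy (fst p) (snd p)" "(x0, y0)"])
        (use pos in \<open>auto intro!: continuous_intros\<close>)
    obtain q where q: "q \<in> trap" "dist q (x0, y0) < R"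
      using cl R(1) unfolding closure_approachable by blast
    have "0 < Fy (fst q) (snd q)" using q(1) by (cases q) (auto simp: trap_def conf_iff)
    then show ?thesis using R(2)[of q] q(2) by (simp add: dist_commute)
  next
    assume fp: "forward_pivot_conf \<gamma> (x0, y0)"
    then have pv: "pivot_conf \<gamma> (x0, y0)" by (simp add: pivot_conf_def)
    obtain z where z: "y0 < z" "z \<le> x0 + 1" "stable_conf \<gamma> (x0, z)"
      "\<And>t. y0 < t \<Longrightarrow> t \<le> z \<Longrightarrow> F x0 t \<le> 0" "\<And>t. y0 \<le> t \<Longrightarrow> t < z \<Longrightarrow> runs_forward \<gamma> x0 t"
      by (rule forward_run[OF signs_right(3)[OF fp] bounds(2)])
        (use diagonal_stable[of x0 1] that in auto)
    have v: "valid_piece \<gamma> False (Pivot x0 y0 z)" using z pv by simp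
    have "\<not> good (x0, z)" "\<not> on_diagonal (x0, z)"
      using pivot_bad[OF pv] good.finish[OF v] good.pivot[OF v] by blast+
    moreover have "z \<noteq> x0 + 1" using \<open>\<not> on_diagonal (x0, z)\<close> by (auto simp: on_diagonal_def)
    ultimately have "(x0, z) \<in> trap" using z bounds by (auto simp: trap_def strip_def)
    moreover have "F x0 t \<le> 0" if "t \<in> {y0..z}" for t
      using z(4)[of t] zero that by (cases "t = y0") auto
    ultimately show ?thesis using z(1) by blast
  next
    assume bp: "backward_pivot_conf \<gamma> (x0, y0)"
    then have pv: "pivot_conf \<gamma> (x0, y0)" by (simp add: pivot_conf_def)
    obtain z where z: "z < y0" "x0 \<le> z" "stable_conf \<gamma> (x0, z)"
      "\<And>t. t < y0 \<Longrightarrow> z \<le> t \<Longrightarrow> 0 \<le> F x0 t" "\<And>t. t \<le> y0 \<Longrightarrow> z < t \<Longrightarrow> runs_backward \<gamma> x0 t"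
      by (rule backward_run[OF signs_left(4)[OF bp] bounds(1)])
        (use diagonal_stable[of x0 0] that in auto)
    have v: "valid_piece \<gamma> False (Pivot x0 y0 z)" using z pv by simp
    have "\<not> good (x0, z)" "\<not> on_diagonal (x0, z)"
      using pivot_bad[OF pv] good.finish[OF v] good.pivot[OF v] by blast+
    moreover have "z \<noteq> x0" using \<open>\<not> on_diagonal (x0, z)\<close> by (auto simp: on_diagonal_def)
    ultimately have "(x0, z) \<in> trap" using z bounds by (auto simp: trap_def strip_def)
    moreover have "0 \<le> F x0 t" if "t \<in> {z..y0}" for t
      using z(4)[of t] zero that by (cases "t = y0") auto
    ultimately show ?thesis using z(1) by blast
  qed
qed

subsection \<open>The top and the bottom of a trap\<close>

lemma trap_bounds:
  assumes "(x, y) \<in> trap" shows "x < y" "y < x + 1" "F x y = 0" "stable_conf \<gamma> (x, y)"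
  using assms by (auto simp: trap_def strip_def conf_iff)

lemma trap_subsequence:
  assumes "f \<longlonglongrightarrow> x0" "\<And>n. (f n, g n) \<in> trap"
  obtains r y where "strict_mono r" "(\<lambda>n. g (r n)) \<longlonglongrightarrow> y" "(x0, y) \<in> closure trap"
proof -
  have "bounded (range f)" using assms(1) by (rule convergent_imp_bounded)
  then obtain B where B: "\<And>n. \<bar>f n\<bar> \<le> B" by (auto simp: bounded_iff)
  have "\<bar>g n\<bar> \<le> B + 1" for n using B[of n] trap_bounds(1,2)[OF assms(2)[of n]] by linarith
  then have "bounded (range g)" by (auto simp: bounded_iff)
  then obtain y r where r: "strict_mono r" "(g \<circ> r) \<longlonglongrightarrow> y"
    using bounded_imp_convergent_subsequence by blast
  have "(\<lambda>n. f (r n)) \<longlonglongrightarrow> x0" using LIMSEQ_subseq_LIMSEQ[OF assms(1) r(1)] by (simp add: o_def)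
  moreover have "(\<lambda>n. g (r n)) \<longlonglongrightarrow> y" using r(2) by (simp add: o_def)
  ultimately have "(\<lambda>n. (f (r n), g (r n))) \<longlonglongrightarrow> (x0, y)" by (rule tendsto_Pair)
  then have "(x0, y) \<in> closure trap"
    unfolding closure_sequential using assms(2)
    by (intro exI[of _ "\<lambda>n. (f (r n), g (r n))"] conjI allI)
  with r show thesis by (intro that[of r y]) (simp_all add: o_def)
qed

text \<open>Once the trap is nonempty, its columns are finite and nonempty, so both extrema are
  themselves trapped. Neither function need be continuous in \<open>x\<close>.\<close>

definition trap_top where "trap_top x = Max {y. (x, y) \<in> trap}"
definition trap_bot where "trap_bot x = Min {y. (x, y) \<in> trap}"

context
  assumes nonempty: "trap \<noteq> {}"
begin

text \<open>The projection of the trap to the human's coordinate is open because branches extend,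
  and closed because a limit is trapped or is a pivot whose run lands on the trap in the same
  column. The line is connected.\<close>

lemma column_nonempty: "\<exists>y. (x, y) \<in> trap"
proof -
  let ?X = "{x. \<exists>y. (x, y) \<in> trap}"
  have "open ?X" unfolding open_dist
  proof
    fix x0 assume "x0 \<in> ?X"
    then obtain y0 where y0: "(x0, y0) \<in> trap" by blast
    obtain \<delta> where "0 < \<delta>" "\<And>x. dist x x0 < \<delta> \<Longrightarrow> \<exists>y. dist y y0 < 1 \<and> (x, y) \<in> trap"
      by (rule trap_branch[OF y0 zero_less_one]) (rule that)
    then show "\<exists>e>0. \<forall>y. dist y x0 < e \<longrightarrow> y \<in> ?X" by blast
  qed
  moreover have "closed ?X" unfolding closed_sequential_limits
  proof (intro allI impI)
    fix f x0 assume f: "(\<forall>n. f n \<in> ?X) \<and> f \<longlonglongrightarrow> x0"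
    then have "\<forall>n. \<exists>y. (f n, y) \<in> trap" by simp
    then obtain g where g: "\<And>n. (f n, g n) \<in> trap" by metis
    obtain y where "(x0, y) \<in> closure trap"
      by (rule trap_subsequence[of f x0 g]) (use f g that in auto)
    from trap_closure[OF this] show "x0 \<in> ?X" by blast
  qed
  moreover have "?X \<noteq> {}" using nonempty by auto
  ultimately have "?X = UNIV" using clopen[of ?X] by (simp only: simp_thms)
  then show ?thesis by (auto simp: set_eq_iff)
qed

lemma column_finite: "finite {y. (x, y) \<in> trap}"
  by (rule finite_subset[OF _ finite_critical_column[of x "x + 1" x]])
     (auto dest: trap_bounds intro: less_imp_le)

lemma top_trap: "(x, trap_top x) \<in> trap" and top_ge: "(x, y) \<in> trap \<Longrightarrow> y \<le> trap_top x"
  and bot_trap: "(x, trap_bot x) \<in> trap" and bot_le: "(x, y) \<in> trap \<Longrightarrow> trap_bot x \<le> y"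
proof -
  have ne: "{y. (x, y) \<in> trap} \<noteq> {}" using column_nonempty by auto
  show "(x, trap_top x) \<in> trap" "(x, trap_bot x) \<in> trap"
    using Max_in[OF column_finite ne] Min_in[OF column_finite ne] by (auto simp: trap_top_def trap_bot_def)
  show "y \<le> trap_top x" "trap_bot x \<le> y" if "(x, y) \<in> trap"
    using that Max_ge[OF column_finite] Min_le[OF column_finite] by (auto simp: trap_top_def trap_bot_def)
qed

lemma top_bot_shift: "trap_top (x + of_int k) = trap_top x + of_int k" "trap_bot (x + of_int k) = trap_bot x + of_int k"
proof -
  have *: "(x + of_int k, y + of_int k) \<in> trap" if "(x, y) \<in> trap" for x y k
    using trap_shift[OF that, of k] by simp
  have le: "trap_top x + of_int k \<le> trap_top (x + of_int k)" "trap_bot (x + of_int k) \<le> trap_bot x + of_int k" for x k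
    using top_ge bot_le * top_trap bot_trap by auto
  show "trap_top (x + of_int k) = trap_top x + of_int k" "trap_bot (x + of_int k) = trap_bot x + of_int k"
    using le[of x k] le[of "x + of_int k" "- k"] by simp_all
qed

text \<open>If the tops converge to a point strictly above \<open>trap_top x0\<close>, that point is
  not trapped and has no trapped point above it, so \<open>trap_closure\<close> leaves a downward
  run that ends no higher than the top. Its sign covers the whole jump.\<close>

lemma top_limit:
  assumes f: "f \<longlonglongrightarrow> x0" and g: "(\<lambda>n. trap_top (f n)) \<longlonglongrightarrow> y" and cl: "(x0, y) \<in> closure trap"
  shows "trap_top x0 \<le> y" "\<And>t. trap_top x0 \<le> t \<Longrightarrow> t \<le> y \<Longrightarrow> 0 \<le> F x0 t"
proof -
  show le: "trap_top x0 \<le> y"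
  proof (rule field_le_epsilon)
    fix e :: real assume e: "0 < e"
    obtain \<delta> where \<delta>: "0 < \<delta>" "\<And>x. dist x x0 < \<delta> \<Longrightarrow> \<exists>y. dist y (trap_top x0) < e \<and> (x, y) \<in> trap"
      by (rule trap_branch[OF top_trap e]) (rule that)
    have "\<forall>\<^sub>F n in sequentially. dist (f n) x0 < \<delta>" using tendstoD[OF f \<delta>(1)] .
    then have "\<forall>\<^sub>F n in sequentially. trap_top x0 - e \<le> trap_top (f n)"
    proof eventually_elim
      case (elim n)
      then obtain z where "dist z (trap_top x0) < e" "(f n, z) \<in> trap" using \<delta>(2) by blast
      then show ?case using top_ge[of "f n" z] by (auto simp: dist_real_def)
    qed
    then have "trap_top x0 - e \<le> y" by (rule tendsto_lowerbound[OF g]) simp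
    then show "trap_top x0 \<le> y + e" by simp
  qed
  show "0 \<le> F x0 t" if t: "trap_top x0 \<le> t" "t \<le> y" for t
    using trap_closure[OF cl]
  proof (elim disjE exE conjE)
    assume "(x0, y) \<in> trap"
    then have "t = trap_top x0" using top_ge[of x0 y] t le by simp
    then show ?thesis using trap_bounds(3)[OF top_trap] by simp
  next
    fix y1 assume "y < y1" "(x0, y1) \<in> trap"
    then show ?thesis using top_ge[of x0 y1] le by simp
  next
    fix y1 assume "(x0, y1) \<in> trap" "\<forall>t\<in>{y1..y}. 0 \<le> F x0 t"
    then show ?thesis using top_ge[of x0 y1] t by simp
  qed
qed

text \<open>Dually, a jump of the bottom is filled by an upward run.\<close>

lemma bot_limit:
  assumes f: "f \<longlonglongrightarrow> x0" and g: "(\<lambda>n. trap_bot (f n)) \<longlonglongrightarrow> y" and cl: "(x0, y) \<in> closure trap"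
  shows "\<And>t. y \<le> t \<Longrightarrow> t \<le> trap_bot x0 \<Longrightarrow> F x0 t \<le> 0"
proof -
  have le: "y \<le> trap_bot x0"
  proof (rule field_le_epsilon)
    fix e :: real assume e: "0 < e"
    obtain \<delta> where \<delta>: "0 < \<delta>" "\<And>x. dist x x0 < \<delta> \<Longrightarrow> \<exists>y. dist y (trap_bot x0) < e \<and> (x, y) \<in> trap"
      by (rule trap_branch[OF bot_trap e]) (rule that)
    have "\<forall>\<^sub>F n in sequentially. dist (f n) x0 < \<delta>" using tendstoD[OF f \<delta>(1)] .
    then have "\<forall>\<^sub>F n in sequentially. trap_bot (f n) \<le> trap_bot x0 + e"
    proof eventually_elim
      case (elim n)
      then obtain z where "dist z (trap_bot x0) < e" "(f n, z) \<in> trap" using \<delta>(2) by blast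
      then show ?case using bot_le[of "f n" z] by (auto simp: dist_real_def)
    qed
    then show "y \<le> trap_bot x0 + e" by (rule tendsto_upperbound[OF g]) simp
  qed
  show "F x0 t \<le> 0" if t: "y \<le> t" "t \<le> trap_bot x0" for t
    using trap_closure[OF cl]
  proof (elim disjE exE conjE)
    assume "(x0, y) \<in> trap"
    then have "t = trap_bot x0" using bot_le[of x0 y] t le by simp
    then show ?thesis using trap_bounds(3)[OF bot_trap] by simp
  next
    fix y1 assume "(x0, y1) \<in> trap" "\<forall>t\<in>{y..y1}. F x0 t \<le> 0"
    then show ?thesis using bot_le[of x0 y1] t by simp
  next
    fix y1 assume "y1 < y" "(x0, y1) \<in> trap"
    then show ?thesis using bot_le[of x0 y1] le by simp
  qed
qed

text \<open>The region just above the top of the trap is connected across the jumps of the top,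
  because a jump happens at a backward pivot, where the puppy crosses a region of positive sign.\<close>

lemma borders_top:
  assumes W: "W = connected_component_set {q. 0 < F2 q} w" and b: "borders F2 W (0, trap_top 0)"
  shows "borders F2 W (x, trap_top x)"
proof (rule connected_induction_simple[of UNIV 0 x "\<lambda>x. borders F2 W (x, trap_top x)"])
  have reg: "regular_nonneg F2 (x, trap_top x)" for x
    using trap_bounds(3)[OF top_trap] by (intro regular_at_nonneg) simp
  have ev: "\<forall>\<^sub>F x in nhds x0. borders F2 W (x, trap_top x) \<longleftrightarrow> borders F2 W (x0, trap_top x0)" for x0
  proof (rule ccontr)
    assume "\<not> ?thesis"
    then obtain f where f: "f \<longlonglongrightarrow> x0"
      "\<And>n. \<not> (borders F2 W (f n, trap_top (f n)) \<longleftrightarrow> borders F2 W (x0, trap_top x0))"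
      by (rule not_eventually_nhds_sequence) blast
    obtain r y where r: "strict_mono r" "(\<lambda>n. trap_top (f (r n))) \<longlonglongrightarrow> y" "(x0, y) \<in> closure trap"
      by (rule trap_subsequence[OF f(1) top_trap]) (rule that)
    have fr: "(\<lambda>n. f (r n)) \<longlonglongrightarrow> x0" using LIMSEQ_subseq_LIMSEQ[OF f(1) r(1)] by (simp add: o_def)
    note lim = top_limit[OF fr r(2,3)]
    \<comment> \<open>The jump at \<open>x0\<close> lies in \<open>F \<ge> 0\<close>, so bordering
      \<open>W\<close> is carried along it from the top at \<open>x0\<close> to the point where the
      nearby tops accumulate.\<close>
    let ?K = "(\<lambda>t. (x0, t)) ` {trap_top x0..y}"
    have K: "connected ?K" by (intro connected_continuous_image continuous_intros) auto
    have K_reg: "regular_nonneg F2 p" if "p \<in> ?K" for p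
      using that lim(2) by (auto intro!: regular_at_nonneg)
    have "(x0, trap_top x0) \<in> ?K" "(x0, y) \<in> ?K" using lim(1) by auto
    then have same: "borders F2 W (x0, trap_top x0) \<longleftrightarrow> borders F2 W (x0, y)"
      using borders_connected[OF continuous_F2 W K K_reg] by blast
    have conv: "(\<lambda>n. (f (r n), trap_top (f (r n)))) \<longlonglongrightarrow> (x0, y)"
      using fr r(2) by (rule tendsto_Pair)
    have "\<forall>\<^sub>F q in nhds (x0, y). regular_nonneg F2 q \<longrightarrow>
        (borders F2 W q \<longleftrightarrow> borders F2 W (x0, y))"
      using lim by (intro borders_eventually_iff[OF continuous_F2 _ W] regular_at_nonneg) auto
    from eventually_compose_filterlim[OF this conv]
    have "\<forall>\<^sub>F n in sequentially. regular_nonneg F2 (f (r n), trap_top (f (r n))) \<longrightarrow>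
        (borders F2 W (f (r n), trap_top (f (r n))) \<longleftrightarrow> borders F2 W (x0, y))"
      by simp
    then obtain n where "regular_nonneg F2 (f (r n), trap_top (f (r n))) \<longrightarrow>
        (borders F2 W (f (r n), trap_top (f (r n))) \<longleftrightarrow> borders F2 W (x0, y))"
      using eventually_happens'[OF sequentially_bot] by blast
    then show False using f(2)[of "r n"] same reg by simp
  qed
  fix x0 :: real
  obtain T where T: "open T" "x0 \<in> T"
    "\<And>x. x \<in> T \<Longrightarrow> borders F2 W (x, trap_top x) \<longleftrightarrow> borders F2 W (x0, trap_top x0)"
    using ev[of x0] unfolding eventually_nhds by blast
  show "\<exists>T. openin (top_of_set UNIV) T \<and> x0 \<in> T \<and>
      (\<forall>x\<in>T. \<forall>y\<in>T. borders F2 W (x, trap_top x) \<longrightarrow> borders F2 W (y, trap_top y))"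
  proof (intro exI[of _ T] conjI ballI impI)
    show "openin (top_of_set UNIV) T" using T(1) by simp
    show "borders F2 W (y, trap_top y)" if "x \<in> T" "y \<in> T" "borders F2 W (x, trap_top x)" for x y
      using T(3)[OF that(1)] T(3)[OF that(2)] that(3) by simp
  qed (rule T(2))
qed (use b in auto)

text \<open>The component bordering the graph of the top contains the points just above it over 0
  and over 1; periodicity of the top lets these be chosen as translates by (1, 1). So
  \<open>W\<close> wraps around the torus.\<close>

lemma above_top:
  obtains W a where "connected W" "W \<subseteq> {q. 0 < F2 q}" "a \<in> W" "a + (1, 1) \<in> W" "a \<in> strip"
    "trap_bot (fst a) < snd a"
proof -
  obtain w where w: "borders F2 (connected_component_set {q. 0 < F2 q} w) (0, trap_top 0)"
    using regular_nonneg_borders[OF continuous_F2 regular_at_nonneg] trap_bounds(3)[OF top_trap]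
    by (metis order_refl)
  define W where "W = connected_component_set {q. 0 < F2 q} w"
  have top1: "trap_top 1 = trap_top 0 + 1" using top_bot_shift(1)[of 0 1] by simp
  have b: "borders F2 W (x, trap_top x)" for x
    using borders_top[OF W_def] w by (simp add: W_def)
  have "((\<lambda>t. (0, t)) \<longlongrightarrow> (0, trap_top 0)) (at_right (trap_top 0))"
    "((\<lambda>t. (1, t + 1)) \<longlongrightarrow> (1, trap_top 0 + 1)) (at_right (trap_top 0))"
    by (intro tendsto_intros)+
  from eventually_compose_filterlim[OF b[of 0, unfolded borders_def] this(1)]
    eventually_compose_filterlim[OF b[of 1, unfolded borders_def top1] this(2)]
  have ev: "\<forall>\<^sub>F t in at_right (trap_top 0). 0 < F 0 t \<longrightarrow> (0, t) \<in> W"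
    "\<forall>\<^sub>F t in at_right (trap_top 0). 0 < F 1 (t + 1) \<longrightarrow> (1, t + 1) \<in> W"
    by simp_all
  have pos: "\<forall>\<^sub>F t in at_right (trap_top 0). 0 < F 0 t"
    using signs_right(1) trap_bounds(4)[OF top_trap] by blast
  have "\<forall>\<^sub>F t in at_right (trap_top 0). t < 1" "\<forall>\<^sub>F t in at_right (trap_top 0). trap_top 0 < t"
    using trap_bounds(2)[OF top_trap, of 0]
    by (auto simp: eventually_at_right_less eventually_at_right_field intro!: exI[of _ 1])
  with ev pos have "\<forall>\<^sub>F t in at_right (trap_top 0). (0, t) \<in> W \<and> (1, t + 1) \<in> W \<and> t < 1 \<and> trap_top 0 < t"
  proof eventually_elim
    case (elim t)
    then show ?case using F_shift(1)[of 0 1 t 1] by simp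
  qed
  then obtain t where t: "(0, t) \<in> W" "(1, t + 1) \<in> W" "t < 1" "trap_top 0 < t"
    using eventually_happens[of _ "at_right (trap_top 0)"] by (auto simp: trivial_limit_at_right_real)
  show thesis
  proof (rule that[of W "(0, t)"])
    show "connected W" "W \<subseteq> {q. 0 < F2 q}"
      unfolding W_def by (auto dest: connected_component_in)
    show "(0, t) \<in> strip" using t trap_bounds(1)[OF top_trap, of 0] by (auto simp: strip_def)
    show "trap_bot (fst (0, t)) < snd (0, t)" using t(4) bot_le[OF top_trap, of 0] by simp
  qed (use t in auto)
qed

text \<open>By \<open>trap_branch\<close> the bottom cannot suddenly rise, so a point strictly above
  it keeps this position under small moves.\<close>

lemma open_above_bot: "open {p \<in> strip. 0 < F2 p \<and> trap_bot (fst p) < snd p}" (is "open ?A")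
proof -
  have G: "open (strip \<inter> {p. 0 < F2 p})"
    using continuous_F2 by (intro open_Int open_strip) (simp add: open_Collect_less)
  have "\<forall>\<^sub>F q in nhds p. q \<in> ?A" if p: "p \<in> ?A" for p
  proof -
    define e where "e = (snd p - trap_bot (fst p)) / 2"
    have e: "0 < e" using p by (simp add: e_def)
    obtain \<delta> where \<delta>: "0 < \<delta>"
      "\<And>x. dist x (fst p) < \<delta> \<Longrightarrow> \<exists>y. dist y (trap_bot (fst p)) < e \<and> (x, y) \<in> trap"
      by (rule trap_branch[OF bot_trap e]) (rule that)
    have "\<forall>\<^sub>F q in nhds p. q \<in> strip \<inter> {p. 0 < F2 p}"
      using p by (intro eventually_nhds_in_open G) auto
    moreover have "\<forall>\<^sub>F q in nhds p. dist q p < min \<delta> e"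
      using \<delta>(1) e unfolding eventually_nhds_metric by (intro exI[of _ "min \<delta> e"]) auto
    ultimately show ?thesis
    proof eventually_elim
      case (elim q)
      have "dist (fst q) (fst p) < \<delta>" "dist (snd q) (snd p) < e"
        using elim(2) dist_fst_le[of q p] dist_snd_le[of q p] by auto
      then obtain y where y: "dist y (trap_bot (fst p)) < e" "(fst q, y) \<in> trap" using \<delta>(2) by blast
      have "snd p = trap_bot (fst p) + 2 * e" by (simp add: e_def field_simps)
      moreover have "y < trap_bot (fst p) + e" "snd p - e < snd q"
        using y(1) \<open>dist (snd q) (snd p) < e\<close> by (auto simp: dist_real_def abs_less_iff)
      ultimately have "trap_bot (fst q) < snd q" using bot_le[OF y(2)] by linarith
      then show ?case using elim(1) by simp
    qed
  qed
  then show ?thesis by (rule open_if_eventually_mem)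
qed

text \<open>Lying below the bottom may fail to be an open condition where the bottom jumps, but
  inside a jump \<open>bot_limit\<close> gives \<open>F \<le> 0\<close>. Restricting to positive
  points restores openness; here the trap acts as a barrier.\<close>

lemma open_below_bot: "open {p \<in> strip. 0 < F2 p \<and> snd p < trap_bot (fst p)}" (is "open ?B")
proof -
  let ?G = "strip \<inter> {p. 0 < F2 p}"
  have G: "open ?G"
    using continuous_F2 by (intro open_Int open_strip) (simp add: open_Collect_less)
  have "\<forall>\<^sub>F q in nhds p. q \<in> ?B" if p: "p \<in> ?B" for p
  proof -
    have "\<forall>\<^sub>F q in nhds p. q \<in> ?G \<longrightarrow> snd q < trap_bot (fst q)"
    proof (rule ccontr)
      assume "\<not> ?thesis"
      then obtain f where f: "f \<longlonglongrightarrow> p" "\<And>n. \<not> (f n \<in> ?G \<longrightarrow> snd (f n) < trap_bot (fst (f n)))"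
        by (rule not_eventually_nhds_sequence) blast
      have f': "trap_bot (fst (f n)) \<le> snd (f n)" for n using f(2)[of n] by auto
      have lim: "(\<lambda>n. fst (f n)) \<longlonglongrightarrow> fst p" "(\<lambda>n. snd (f n)) \<longlonglongrightarrow> snd p"
        using f(1) by (auto intro: tendsto_intros)
      obtain r y where r: "strict_mono r" "(\<lambda>n. trap_bot (fst (f (r n)))) \<longlonglongrightarrow> y" "(fst p, y) \<in> closure trap"
        by (rule trap_subsequence[OF lim(1) bot_trap]) (rule that)
      have "(\<lambda>n. snd (f (r n))) \<longlonglongrightarrow> snd p" "(\<lambda>n. fst (f (r n))) \<longlonglongrightarrow> fst p"
        using LIMSEQ_subseq_LIMSEQ[OF lim(2) r(1)] LIMSEQ_subseq_LIMSEQ[OF lim(1) r(1)]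
        by (simp_all add: o_def)
      moreover from this(1) have "y \<le> snd p"
        using LIMSEQ_le[OF r(2)] f' by blast
      ultimately have "F (fst p) (snd p) \<le> 0"
        using bot_limit[OF _ r(2,3), of "snd p"] p by simp
      then show False using p by simp
    qed
    moreover have "\<forall>\<^sub>F q in nhds p. q \<in> ?G"
      using p by (intro eventually_nhds_in_open G) auto
    ultimately show ?thesis by eventually_elim simp
  qed
  then show ?thesis by (rule open_if_eventually_mem)
qed

end

section \<open>Critical cycles and the final contradiction\<close>

lemma torus_pt_critical_iff: "torus_pt p \<in> critical_set \<gamma> \<longleftrightarrow> F2 p = 0"
proof
  assume "torus_pt p \<in> critical_set \<gamma>"
  then obtain q where q: "torus_pt p = torus_pt q" "critical \<gamma> q" by (auto simp: critical_set_def)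
  obtain i j :: int where "fst p - fst q = of_int i" "snd p - snd q = of_int j"
    using q(1) by (auto simp: torus_pt_eq_iff elim!: Ints_cases)
  then have "fst p = fst q + of_int i" "snd p = snd q + of_int j" by simp_all
  then show "F2 p = 0" using q(2) conf_iff(1)[of "fst q" "snd q"] by (simp add: F_shift)
next
  assume "F2 p = 0"
  then show "torus_pt p \<in> critical_set \<gamma>"
    using conf_iff(1)[of "fst p" "snd p"] by (auto simp: critical_set_def)
qed

text \<open>The collars split the critical set into two disjoint closed parts, the diagonal and the
  rest, and a component cannot meet both.\<close>

lemma diagonal_component:
  assumes C: "C \<in> components (critical_set \<gamma>)" "C \<inter> diagonal_cycle \<noteq> {}"
  shows "C = diagonal_cycle"
proof
  obtain \<epsilon> where \<epsilon>: "0 < \<epsilon>" "\<epsilon> \<le> 1/2" "\<And>x y. x < y \<Longrightarrow> y < x + \<epsilon> \<Longrightarrow> 0 < F x y"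
    "\<And>x y. y < x + 1 \<Longrightarrow> x + 1 - \<epsilon> < y \<Longrightarrow> F x y < 0" by (rule diagonal_collar) (rule that)
  let ?line = "{p :: real \<times> real. fst p = snd p}"
  have line: "?line = (\<lambda>t. (t, t)) ` UNIV" by (auto simp: image_iff)
  have "connected ?line"
    unfolding line by (intro connected_continuous_image continuous_intros connected_UNIV)
  then have con: "connected diagonal_cycle"
    unfolding diagonal_cycle_def by (intro connected_continuous_image continuous_intros)
  have crit: "diagonal_cycle \<subseteq> critical_set \<gamma>"
    using torus_pt_critical_iff by (auto simp: diagonal_cycle_def F_def)
  show "diagonal_cycle \<subseteq> C" using components_maximal[OF C(1) con crit C(2)] .
  have "diagonal_cycle = torus_pt ` (\<lambda>t. (t, t)) ` {0..1}"
  proof -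
    have "torus_pt (t, t) = torus_pt (frac t, frac t)" for t
      by (simp add: torus_pt_eq_iff frac_def)
    then have "torus_pt (t, t) \<in> torus_pt ` (\<lambda>t. (t, t)) ` {0..1}" for t
      by (auto simp: image_iff intro!: bexI[of _ "frac t"] less_imp_le[OF frac_lt_1])
    then show ?thesis unfolding diagonal_cycle_def line by blast
  qed
  moreover have "compact (torus_pt ` (\<lambda>t. (t, t)) ` {0..1})"
    by (intro compact_continuous_image continuous_intros) auto
  ultimately have cl1: "closed diagonal_cycle" by (simp add: compact_imp_closed)
  \<comment> \<open>A compact window with representatives of all critical configurations off the
    diagonal: \<open>x\<close> runs over one period and \<open>y\<close> stays below
    \<open>x + 1\<close>.\<close>
  define E where "E = {p. F2 p = 0} \<inter> {p. fst p + \<epsilon> \<le> snd p} \<inter> {p. snd p \<le> fst p + 1 - \<epsilon>} \<inter>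
    {0..1} \<times> {0..2}"
  have "compact E" unfolding E_def
    by (intro closed_Int_compact closed_Int closed_Collect_eq closed_Collect_le continuous_intros
        compact_Times) auto
  then have "compact (torus_pt ` E)" by (intro compact_continuous_image continuous_intros)
  then have cl2: "closed (torus_pt ` E)" by (rule compact_imp_closed)
  have E_strip: "E \<subseteq> strip" using \<epsilon>(1) by (auto simp: E_def strip_def)
  have cover: "critical_set \<gamma> \<subseteq> diagonal_cycle \<union> torus_pt ` E"
  proof
    fix q assume q: "q \<in> critical_set \<gamma>"
    show "q \<in> diagonal_cycle \<union> torus_pt ` E"
    proof (cases "q \<in> diagonal_cycle")
      case False
      have "q \<in> torus" using q by (auto simp: critical_set_def)
      then obtain x y where xy: "(x, y) \<in> strip" "q = torus_pt (x, y)"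
        using False torus_minus_diagonal by (metis Diff_iff imageE prod.collapse)
      define y' where "y' = y - of_int \<lfloor>x\<rfloor>"
      have q': "q = torus_pt (frac x, y')"
        unfolding xy(2) by (simp add: torus_pt_eq_iff y'_def frac_def)
      have zero: "F (frac x) y' = 0" using q torus_pt_critical_iff q' by auto
      have b: "frac x < y'" "y' < frac x + 1" using xy(1) by (auto simp: y'_def frac_def strip_def)
      have "frac x + \<epsilon> \<le> y'" using \<epsilon>(3)[OF b(1)] zero by force
      moreover have "y' \<le> frac x + 1 - \<epsilon>" using \<epsilon>(4)[OF b(2)] zero by force
      moreover have "0 \<le> frac x" "frac x < 1" by (simp_all add: frac_lt_1)
      moreover from this have "0 \<le> y'" "y' \<le> 2" using b by linarith+
      ultimately have "(frac x, y') \<in> E" using b zero by (auto simp: E_def)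
      then show ?thesis using q' by blast
    qed simp
  qed
  have "torus_pt ` E \<inter> diagonal_cycle = {}" using E_strip torus_minus_diagonal by blast
  moreover have "C \<subseteq> diagonal_cycle \<union> torus_pt ` E"
    using cover in_components_subset[OF C(1)] by blast
  ultimately have "torus_pt ` E \<inter> C = {}"
    using connected_closedD[OF in_components_connected[OF C(1)] _ _ cl1 cl2] C(2) by blast
  with \<open>C \<subseteq> diagonal_cycle \<union> torus_pt ` E\<close> show "C \<subseteq> diagonal_cycle" by blast
qed

lemma trap_empty:
  assumes two: "card {C \<in> critical_cycles \<gamma>. essential C} = 2"
  shows "trap = {}"
proof (rule ccontr)
  assume ne: "trap \<noteq> {}"
  obtain \<C> where \<C>: "finite \<C>" "\<And>C. C \<in> \<C> \<Longrightarrow> simple_closed_curve_in_torus C"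
    "pairwise disjnt \<C>" "\<Union>\<C> = critical_set \<gamma>"
    using generic unfolding generic_def by blast
  have "compact C \<and> connected C \<and> C \<noteq> {}" if "C \<in> \<C>" for C
    using \<C>(2)[OF that] homeomorphic_compactness[of C "sphere (0::complex) 1"]
      homeomorphic_connectedness[of C "sphere (0::complex) 1"]
    by (auto simp: simple_closed_curve_in_torus_def connected_sphere)
  then have comp: "critical_cycles \<gamma> = \<C>"
    using components_finite_disjoint_union[OF \<C>(1,3)] \<C>(4) by (simp add: critical_cycles_def)
  have crit: "torus_pt p \<in> \<Union>\<C> \<longleftrightarrow> F2 p = 0" for p using torus_pt_critical_iff \<C>(4) by simp
  have crit_disj: "torus_pt ` M \<inter> \<Union>\<C> = {}" if "\<And>p. p \<in> M \<Longrightarrow> F2 p \<noteq> 0" for M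
  proof (intro equals0I, elim IntE imageE)
    fix q p assume "q \<in> \<Union>\<C>" "q = torus_pt p" "p \<in> M"
    then show False using that crit[of p] by metis
  qed
  have "torus_pt (0, 0) \<in> \<Union>\<C>" unfolding crit by (simp add: F_def)
  then obtain C0 where C0: "C0 \<in> \<C>" "torus_pt (0, 0) \<in> C0" by blast
  have "torus_pt (0, 0) \<in> diagonal_cycle" by (auto simp: diagonal_cycle_def)
  then have "C0 = diagonal_cycle"
    using diagonal_component[of C0] C0 comp by (auto simp: critical_cycles_def)
  then have diag: "diagonal_cycle \<in> \<C>" using C0 by simp
  obtain \<epsilon> where \<epsilon>: "0 < \<epsilon>" "\<epsilon> \<le> 1/2" "\<And>x y. x < y \<Longrightarrow> y < x + \<epsilon> \<Longrightarrow> 0 < F x y"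
    "\<And>x y. y < x + 1 \<Longrightarrow> x + 1 - \<epsilon> < y \<Longrightarrow> F x y < 0" by (rule diagonal_collar) (rule that)
  obtain W a where W: "connected W" "W \<subseteq> {q. 0 < F2 q}" "a \<in> W" "a + (1, 1) \<in> W" "a \<in> strip"
    "trap_bot (fst a) < snd a"
    by (rule above_top[OF ne]) (rule that)
  \<comment> \<open>The positive set is cut at the bottom of the trap, on which \<open>F\<close>
    vanishes, so the two halves and \<open>N\<close> cover everything off the critical set. The
    witness \<open>a\<close> lies in \<open>A\<close>, the lower collar in \<open>B\<close>.\<close>
  define A where "A = {p \<in> strip. 0 < F2 p \<and> trap_bot (fst p) < snd p}"
  define B where "B = {p \<in> strip. 0 < F2 p \<and> snd p < trap_bot (fst p)}"
  define N where "N = strip \<inter> {p. F2 p < 0}"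
  \<comment> \<open>A line inside the upper collar, where \<open>F\<close> is negative; it is the
    wrapping set for the witness in \<open>N\<close>.\<close>
  define L where "L = (\<lambda>x. (x, x + (1 - \<epsilon> / 2))) ` UNIV"
  have L_neg: "F2 p < 0" if "p \<in> L" for p
    using that \<epsilon>(1) by (auto simp: L_def intro!: \<epsilon>(4))
  have bot_zero: "F x (trap_bot x) = 0" for x using trap_bounds(3)[OF bot_trap[OF ne]] .
  have strip_shift: "p + (of_int k, of_int k) \<in> strip \<longleftrightarrow> p \<in> strip" for p :: "real \<times> real" and k :: int
    by (auto simp: strip_def)
  have "card {C \<in> \<C>. essential C} \<noteq> 2"
  proof (rule three_regions[OF \<C>(1,2,3) diag, of A B N \<epsilon> a W "(0, 1 - \<epsilon> / 2)" L])
    show "open A" "open B" unfolding A_def B_def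
      by (rule open_above_bot[OF ne], rule open_below_bot[OF ne])
    show "open N" unfolding N_def
      using continuous_F2 by (intro open_Int open_strip) (simp add: open_Collect_less)
    show "p + (of_int k, of_int k) \<in> A" if "p \<in> A" for p k
      using that by (simp add: A_def strip_shift F_shift top_bot_shift[OF ne])
    show "p + (of_int k, of_int k) \<in> B" if "p \<in> B" for p k
      using that by (simp add: B_def strip_shift F_shift top_bot_shift[OF ne])
    show "p + (of_int k, of_int k) \<in> N" if "p \<in> N" for p k
      using that by (simp add: N_def strip_shift F_shift)
    show "A \<inter> B = {}" "A \<inter> N = {}" "B \<inter> N = {}" by (auto simp: A_def B_def N_def)
    show "p \<in> A \<union> B \<union> N" if "p \<in> strip" "torus_pt p \<notin> \<Union>\<C>" for p
    proof -
      have "F2 p \<noteq> 0" using that(2) unfolding crit .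
      moreover from this have "snd p \<noteq> trap_bot (fst p)" using bot_zero[of "fst p"] by auto
      ultimately show ?thesis using that(1) by (auto simp: A_def B_def N_def)
    qed
    show "0 < \<epsilon>" by (rule \<epsilon>)
    show "(x, y) \<in> B" if xy: "x < y" "y < x + \<epsilon>" for x y
    proof -
      have "y < trap_bot x"
        using \<epsilon>(3)[of x "trap_bot x"] bot_zero[of x] trap_bounds(1)[OF bot_trap[OF ne], of x] xy by force
      then show ?thesis using xy \<epsilon> by (auto simp: B_def strip_def)
    qed
    show "a \<in> A" using W by (auto simp: A_def)
    show "torus_pt ` W \<inter> \<Union>\<C> = {}" using W(2) by (intro crit_disj) auto
    show "torus_pt ` L \<inter> \<Union>\<C> = {}" using L_neg by (intro crit_disj) force
    show "connected L" unfolding L_def by (intro connected_continuous_image continuous_intros connected_UNIV)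
    show "(0, 1 - \<epsilon> / 2) \<in> L" by (auto simp: L_def)
    then show "(0, 1 - \<epsilon> / 2) \<in> N"
      using L_neg[of "(0, 1 - \<epsilon> / 2)"] \<epsilon> by (auto simp: N_def strip_def)
    show "(0, 1 - \<epsilon> / 2) + (1, 1) \<in> L" by (auto simp: L_def image_iff)
    show "(0, 1 - \<epsilon> / 2) \<in> strip" using \<epsilon> by (auto simp: strip_def)
  qed (use W in auto)
  then show False using two comp by simp
qed

text \<open>From a stable start the empty trap yields a strategy directly. Any other start makes the
  puppy run at once, and this is the one pivot allowed to start outside the pivot configurations; it
  stops on the diagonal or at a good stable configuration.\<close>

lemma all_caught:
  assumes two: "card {C \<in> critical_cycles \<gamma>. essential C} = 2" and p: "\<not> on_diagonal (x, y)"
  shows "\<exists>ps. winning (x, y) ps"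
proof -
  have good: "good (x, z)" if st: "stable_conf \<gamma> (x, z)" and od: "\<not> on_diagonal (x, z)" for z
  proof -
    define n where "n = \<lfloor>z - x\<rfloor>"
    have "z - x \<noteq> of_int n"
    proof
      assume "z - x = of_int n"
      then have "x - z = of_int (- n)" by simp
      then show False using od by (simp add: on_diagonal_def del: of_int_minus)
    qed
    moreover have "of_int n \<le> z - x" "z - x < of_int n + 1" unfolding n_def by linarith+
    ultimately have "(x, z - of_int n) \<in> strip" by (auto simp: strip_def)
    moreover have "stable_conf \<gamma> (x, z - of_int n)"
      using conf_shift(1)[of x 0 z "- n"] st by simp
    ultimately have "good (x, z - of_int n)" using trap_empty[OF two] by (auto simp: trap_def)
    from good_shift[OF this, of 0 n] show ?thesis by simp
  qed
  have pivot: "\<exists>ps. winning (x, y) ps"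
    if v: "valid_piece \<gamma> True (Pivot x y z)" for z
  proof (cases "on_diagonal (x, z)")
    case True
    then show ?thesis using winning_Nil[OF v] by blast
  next
    case False
    have "stable_conf \<gamma> (x, z)" using v by simp
    from good_winning[OF good[OF this False]] show ?thesis using winning_Cons[OF _ _ v] by fastforce
  qed
  \<comment> \<open>Two consecutive copies of the diagonal bracket \<open>y\<close>. They are
    stable, so a run ends there at the latest.\<close>
  define n where "n = \<lfloor>y - x\<rfloor>"
  have "of_int n \<le> y - x" "y - x < of_int n + 1" unfolding n_def by linarith+
  moreover have "y - x \<noteq> of_int n"
  proof
    assume "y - x = of_int n"
    then have "x - y = of_int (- n)" by simp
    then show False using p by (simp add: on_diagonal_def del: of_int_minus)
  qed
  ultimately have n: "x + of_int n < y" "y < x + of_int (n + 1)" by auto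
  have fwd: ?thesis if neg: "\<forall>\<^sub>F t in at_right y. F x t < 0"
  proof -
    obtain z where "y < z" "stable_conf \<gamma> (x, z)" "\<And>t. y \<le> t \<Longrightarrow> t < z \<Longrightarrow> runs_forward \<gamma> x t"
      by (rule forward_run[OF neg n(2) diagonal_stable]) (rule that)
    then have "valid_piece \<gamma> True (Pivot x y z)" by simp
    then show ?thesis by (rule pivot)
  qed
  have bwd: ?thesis if pos: "\<forall>\<^sub>F t in at_left y. 0 < F x t"
  proof -
    obtain z where "z < y" "stable_conf \<gamma> (x, z)" "\<And>t. t \<le> y \<Longrightarrow> z < t \<Longrightarrow> runs_backward \<gamma> x t"
      by (rule backward_run[OF pos n(1) diagonal_stable]) (rule that)
    then have "valid_piece \<gamma> True (Pivot x y z)" by simp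
    then show ?thesis by (rule pivot)
  qed
  consider "F x y < 0" | "0 < F x y" | "F x y = 0" by linarith
  then show ?thesis
  proof cases
    case 3
    then show ?thesis
    proof (rule critical_cases)
      assume "stable_conf \<gamma> (x, y)"
      then show ?thesis using good_winning[OF good] p by blast
    qed (use fwd bwd signs_right signs_left in auto)
  qed (use fwd bwd negative_right positive_left in auto)
qed

end

theorem theorem6:
  fixes \<gamma> :: "real \<Rightarrow> complex"
  assumes "track \<gamma>"
    and "generic \<gamma>"
    and "card {C \<in> critical_cycles \<gamma>. essential C} = 2"
  shows "(\<forall>p. \<not> on_diagonal p \<longrightarrow> dexter \<gamma> p \<or> sinister \<gamma> p) \<and>
         (\<forall>p. on_diagonal p \<or> (\<exists>ps. strategy \<gamma> p ps))"
proof -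
  obtain g1 g2 g3 where g: "\<And>t. (\<gamma> has_vector_derivative g1 t) (at t)"
    "\<And>t. (g1 has_vector_derivative g2 t) (at t)" "\<And>t. (g2 has_vector_derivative g3 t) (at t)"
    using assms(1) unfolding track_def C3_curve_def by blast
  interpret generic_track \<gamma> g1 g2 g3
  proof
    show "g1 t \<noteq> 0" for t
      using assms(1) vector_derivative_at[OF g(1)] unfolding track_def by metis
  qed (use g assms in \<open>auto simp: track_def\<close>)
  have "\<exists>ps. winning p ps" if "\<not> on_diagonal p" for p
    using all_caught[OF assms(3), of "fst p" "snd p"] that by simp
  then show ?thesis using winning_imp_caught unfolding winning_def by blast
qed

end
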